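(* Let $D\ge 2$, let $\sigma$ be a compact $D$-dimensional spatial slice in a solution $(M,g,\Phi)$ of general relativity conformally coupled to a scalar field, let $(q_{ab},P^{ab},\Phi,\pi_\Phi)$ be the induced canonical data on $\sigma$ with $a(\Phi)\neq 0$ everywhere, and let $\delta\in\mathbb R$. Suppose that the gauge condition $\mathcal D_\delta=\mathcal D-\sqrt q\,\delta=0$ holds on $\sigma$, and that the energy-momentum tensor $T_{\mu\nu}$ satisfies (i) the weak energy condition, if $\delta\neq 0$; or (ii) the dominant energy condition, if $\delta=0$. Then the function $$\mathcal P=\frac{\kappa^2}{2q\,a(\Phi)^2}P^{ab}_{\mathrm{tf}}P^{\mathrm{tf}}_{ab}+\frac12 R^{(D)}+\delta^2\frac{\kappa^2(D+1)}{2(\Delta^g)^2D(D-1)^2}$$ is strictly positive on $\sigma$, and the equation $$\big[D_aD^a-\mathcal P(x)\big]N(x)=0$$ on $\sigma$ (with $N|_{\partial\sigma}=0$ if $\partial\sigma\neq\emptyset$) has $N=0$ as its unique solution. In this sense $\mathcal D_\delta$ is locally a good gauge fixing condition for the Hamiltonian constraint.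
   Context: The theory has action on the $(D+1)$-dimensional globally hyperbolic spacetime $M$ (signature mostly plus) $$S=\frac1\kappa\int_M d^{D+1}X\sqrt{|g|}\,R^{(D+1)}a(\Phi)+\frac1{2\lambda}\int_M d^{D+1}X\sqrt{|g|}\,g^{\mu\nu}(\nabla_\mu\Phi)(\nabla_\nu\Phi),\qquad a(\Phi)=1-\alpha\Phi^2,\quad \alpha=-\frac{\kappa(D-1)}{8\lambda D},$$ with nonzero coupling constants $\kappa>0$ and $\lambda$ (in the paper's conventions $\kappa/\lambda<0$). The fixed nonzero number $\Delta^g$ is the conformal weight of the metric, and $\Delta^\Phi=\frac{1-D}{4}\Delta^g$ is that of $\Phi$. The metric field equation is written $G_{\mu\nu}=8\pi T_{\mu\nu}$, where $T_{\mu\nu}$ is the energy-momentum tensor of $\Phi$. On the slice: $q_{ab}$ is the induced Riemannian metric, $q$ its determinant, $D_a$ its Levi-Civita derivative, $R^{(D)}$ its scalar curvature, $n^\mu$ the future pointing unit normal, $K_{ab}$ the extrinsic curvature and $K=q^{ab}K_{ab}$. The canonical momenta are $$\pi_\Phi=-\frac1\lambda\sqrt q\,(\mathcal L_n\Phi)+\frac{4\alpha}{\kappa}\sqrt q\,\Phi K,\qquad P^{ab}=\frac1\kappa a(\Phi)\sqrt q\,(K^{ab}-q^{ab}K)+\frac{2\alpha}{\kappa}\sqrt q\,q^{ab}\Phi(\mathcal L_n\Phi).$$ Write $P=q_{ab}P^{ab}$ and $P^{ab}_{\mathrm{tf}}=P^{ab}-\frac1D q^{ab}P$. The generator of local conformal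 transformations is $\mathcal D=\Delta^gP+\Delta^\Phi\pi_\Phi\Phi$; one has $\mathcal D=-\frac{(D-1)\Delta^g}{\kappa}\sqrt q\,K$, so $\mathcal D_\delta=0$ says that $\sigma$ has constant mean curvature. Let $\mathcal H[N]$ be the Hamiltonian constraint of the theory, smeared with the lapse $N$, and let $\mathcal D_\delta[\rho]=\int_\sigma d^Dx\,\rho\,\mathcal D_\delta$. On the surface where the constraints hold, $\{\kappa\mathcal H[N],\mathcal D_\delta[\rho]\}=\int_\sigma d^Dx\,(D-1)\sqrt q\,\Delta^g\rho\,[D_aD^a-\mathcal P]N$. "Locally a good gauge fixing" means that this (formally self-adjoint) operator acting on $N$ has trivial kernel. Functions $N$ are smooth real functions on $\sigma$. Energy conditions: the weak energy condition is $T_{\mu\nu}\zeta^\mu\zeta^\nu\ge 0$ for all future timelike vectors $\zeta$. The dominant energy condition is that $-T_\mu{}^\nu\zeta^\mu$ is a future causal vector for all future timelike $\zeta$, where causal vectors are nonzero by convention (so that $T_{\mu\nu}n^\mu n^\nu>0$). *)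

theory Defs
  imports "HOL-Analysis.Analysis"
begin

section \<open>Smooth functions on coordinate domains\<close>

text \<open>
  All derivatives are taken within the coordinate domain \<open>S\<close>.  Below, \<open>S\<close> is open or
  relatively open in a closed half-space; in both cases the derivative within \<open>S\<close> is unique, and at
  a boundary point of a half-space it is the one-sided derivative.
\<close>

definition pderiv_on ::
    "'e::euclidean_space set \<Rightarrow> 'e \<Rightarrow> ('e \<Rightarrow> 'b::real_normed_vector) \<Rightarrow> 'e \<Rightarrow> 'b" where
  "pderiv_on S b f z = frechet_derivative f (at z within S) b"

primrec Ck_on ::
    "nat \<Rightarrow> 'e::euclidean_space set \<Rightarrow> ('e \<Rightarrow> 'b::real_normed_vector) \<Rightarrow> bool" where
  "Ck_on 0 S f \<longleftrightarrow> continuous_on S f"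
| "Ck_on (Suc k) S f \<longleftrightarrow> f differentiable_on S \<and> (\<forall>b\<in>Basis. Ck_on k S (pderiv_on S b f))"

definition smooth_on ::
    "'e::euclidean_space set \<Rightarrow> ('e \<Rightarrow> 'b::real_normed_vector) \<Rightarrow> bool" where
  "smooth_on S f \<longleftrightarrow> (\<forall>k. Ck_on k S f)"

section \<open>Charts and tensor calculus in a chart\<close>

text \<open>
  A chart is a domain together with a coordinate map.  Fields are functions of the point of the
  manifold whose values are the components of the field in a chart.
\<close>

type_synonym ('a, 'n) chart = "'a set \<times> ('a \<Rightarrow> real^'n)"

abbreviation cdom :: "('a, 'n) chart \<Rightarrow> 'a set" where "cdom c \<equiv> fst c"
abbreviation cmap :: "('a, 'n) chart \<Rightarrow> 'a \<Rightarrow> real^'n" where "cmap c \<equiv> snd c"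

definition cimg :: "('a, 'n) chart \<Rightarrow> (real^'n) set" where
  "cimg c = cmap c ` cdom c"

definition cinv :: "('a, 'n) chart \<Rightarrow> real^'n \<Rightarrow> 'a" where
  "cinv c = inv_into (cdom c) (cmap c)"

definition csmooth :: "('a, 'n::finite) chart \<Rightarrow> ('a \<Rightarrow> 'b::real_normed_vector) \<Rightarrow> bool" where
  "csmooth c f \<longleftrightarrow> smooth_on (cimg c) (f \<circ> cinv c)"

text \<open>The partial derivative of \<open>f\<close> with respect to the \<open>i\<close>-th coordinate of \<open>c\<close>, at the point \<open>p\<close>.\<close>

definition cpd :: "('a, 'n::finite) chart \<Rightarrow> 'n \<Rightarrow> ('a \<Rightarrow> 'b::real_normed_vector) \<Rightarrow> 'a \<Rightarrow> 'b" where
  "cpd c i f p = pderiv_on (cimg c) (axis i 1) (f \<circ> cinv c) (cmap c p)"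

definition bil :: "real^'n^'n \<Rightarrow> real^'n \<Rightarrow> real^'n \<Rightarrow> real" where
  "bil h v w = (\<Sum>i\<in>UNIV. \<Sum>j\<in>UNIV. h $ i $ j * v $ i * w $ j)"

text \<open>The trace \<open>h\<^sup>i\<^sup>j A\<^sub>i\<^sub>j\<close> of a covariant tensor.\<close>

definition mtrace :: "real^'n^'n \<Rightarrow> real^'n^'n \<Rightarrow> real" where
  "mtrace h A = (\<Sum>i\<in>UNIV. \<Sum>j\<in>UNIV. matrix_inv h $ i $ j * A $ i $ j)"

text \<open>\<open>christoffel c h k i j\<close> is the symbol with upper index \<open>k\<close> and lower indices \<open>i\<close>, \<open>j\<close>.\<close>

definition christoffel ::
    "('a, 'n::finite) chart \<Rightarrow> ('a \<Rightarrow> real^'n^'n) \<Rightarrow> 'n \<Rightarrow> 'n \<Rightarrow> 'n \<Rightarrow> 'a \<Rightarrow> real" where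
  "christoffel c h k i j p =
     (\<Sum>l\<in>UNIV. matrix_inv (h p) $ k $ l *
        (cpd c i (\<lambda>x. h x $ j $ l) p + cpd c j (\<lambda>x. h x $ i $ l) p
          - cpd c l (\<lambda>x. h x $ i $ j) p)) / 2"

text \<open>
  \<open>riemann c h k l i j\<close> has upper index \<open>k\<close>; the sign is such that
  \<open>[\<nabla>\<^sub>i, \<nabla>\<^sub>j] v\<^sup>k = R\<^sup>k\<^sub>l\<^sub>i\<^sub>j v\<^sup>l\<close>, so round spheres have positive scalar curvature.
\<close>

definition riemann ::
    "('a, 'n::finite) chart \<Rightarrow> ('a \<Rightarrow> real^'n^'n) \<Rightarrow> 'n \<Rightarrow> 'n \<Rightarrow> 'n \<Rightarrow> 'n \<Rightarrow> 'a \<Rightarrow> real" where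
  "riemann c h k l i j p =
     cpd c i (christoffel c h k j l) p - cpd c j (christoffel c h k i l) p
     + (\<Sum>m\<in>UNIV. christoffel c h k i m p * christoffel c h m j l p
                - christoffel c h k j m p * christoffel c h m i l p)"

definition ricci ::
    "('a, 'n::finite) chart \<Rightarrow> ('a \<Rightarrow> real^'n^'n) \<Rightarrow> 'a \<Rightarrow> real^'n^'n" where
  "ricci c h p = (\<chi> i j. \<Sum>k\<in>UNIV. riemann c h k i k j p)"

definition scalar_curv ::
    "('a, 'n::finite) chart \<Rightarrow> ('a \<Rightarrow> real^'n^'n) \<Rightarrow> 'a \<Rightarrow> real" where
  "scalar_curv c h p = mtrace (h p) (ricci c h p)"

definition einstein ::
    "('a, 'n::finite) chart \<Rightarrow> ('a \<Rightarrow> real^'n^'n) \<Rightarrow> 'a \<Rightarrow> real^'n^'n" where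
  "einstein c h p = ricci c h p - (scalar_curv c h p / 2) *\<^sub>R h p"

text \<open>Second covariant derivative of a scalar, and its trace (Laplace-Beltrami or wave operator).\<close>

definition hessian ::
    "('a, 'n::finite) chart \<Rightarrow> ('a \<Rightarrow> real^'n^'n) \<Rightarrow> ('a \<Rightarrow> real) \<Rightarrow> 'a \<Rightarrow> real^'n^'n" where
  "hessian c h f p =
     (\<chi> i j. cpd c i (cpd c j f) p - (\<Sum>k\<in>UNIV. christoffel c h k i j p * cpd c k f p))"

definition laplacian ::
    "('a, 'n::finite) chart \<Rightarrow> ('a \<Rightarrow> real^'n^'n) \<Rightarrow> ('a \<Rightarrow> real) \<Rightarrow> 'a \<Rightarrow> real" where
  "laplacian c h f p = mtrace (h p) (hessian c h f p)"

section \<open>Spacetimes\<close>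

text \<open>
  The underlying point set is the whole (Hausdorff, second countable) type.  \<open>metric\<close> and
  \<open>time_field\<close> give, for a chart and a point, the components of the metric and of a timelike vector
  field that fixes the time orientation.
\<close>

record ('a, 'm) spacetime =
  atlas :: "('a, 'm) chart set"
  metric :: "('a, 'm) chart \<Rightarrow> 'a \<Rightarrow> real^'m^'m"
  time_field :: "('a, 'm) chart \<Rightarrow> 'a \<Rightarrow> real^'m"

definition smooth_atlas ::
    "('a::{t2_space,second_countable_topology}, 'm::finite) chart set \<Rightarrow> bool" where
  "smooth_atlas A \<longleftrightarrow>
     (\<forall>c\<in>A. open (cdom c) \<and> open (cimg c) \<and>
             homeomorphism (cdom c) (cimg c) (cmap c) (cinv c)) \<and>
     (\<Union>c\<in>A. cdom c) = UNIV \<and>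
     (\<forall>c\<in>A. \<forall>d\<in>A. smooth_on (cmap c ` (cdom c \<inter> cdom d)) (cmap d \<circ> cinv c))"

text \<open>The Jacobian matrix of the coordinates \<open>d\<close> with respect to the coordinates \<open>c\<close>.\<close>

definition jacobian ::
    "('a, 'm::finite) chart \<Rightarrow> ('a, 'm) chart \<Rightarrow> 'a \<Rightarrow> real^'m^'m" where
  "jacobian c d p = matrix (frechet_derivative (cmap d \<circ> cinv c) (at (cmap c p)))"

definition lorentzian_form :: "real^'m::finite^'m \<Rightarrow> bool" where
  "lorentzian_form h \<longleftrightarrow> transpose h = h \<and>
     (\<exists>(E :: real^'m^'m) t. transpose E ** h ** E = (\<chi> i j. if i = j then (if i = t then - 1 else 1) else 0))"

definition timelike :: "('a, 'm) spacetime \<Rightarrow> ('a, 'm) chart \<Rightarrow> 'a \<Rightarrow> real^'m \<Rightarrow> bool" where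
  "timelike M c p v \<longleftrightarrow> bil (metric M c p) v v < 0"

definition future_timelike :: "('a, 'm) spacetime \<Rightarrow> ('a, 'm) chart \<Rightarrow> 'a \<Rightarrow> real^'m \<Rightarrow> bool" where
  "future_timelike M c p v \<longleftrightarrow> timelike M c p v \<and> bil (metric M c p) v (time_field M c p) < 0"

definition future_causal :: "('a, 'm) spacetime \<Rightarrow> ('a, 'm) chart \<Rightarrow> 'a \<Rightarrow> real^'m \<Rightarrow> bool" where
  "future_causal M c p v \<longleftrightarrow> v \<noteq> 0 \<and> bil (metric M c p) v v \<le> 0 \<and>
     bil (metric M c p) v (time_field M c p) < 0"

definition lorentzian_spacetime ::
    "('a::{t2_space,second_countable_topology}, 'm::finite) spacetime \<Rightarrow> bool" where
  "lorentzian_spacetime M \<longleftrightarrow> smooth_atlas (atlas M) \<and>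
     (\<forall>c\<in>atlas M. csmooth c (metric M c) \<and> csmooth c (time_field M c) \<and>
        (\<forall>p\<in>cdom c. lorentzian_form (metric M c p) \<and> timelike M c p (time_field M c p))) \<and>
     (\<forall>c\<in>atlas M. \<forall>d\<in>atlas M. \<forall>p\<in>cdom c \<inter> cdom d.
        metric M c p = transpose (jacobian c d p) ** metric M d p ** jacobian c d p \<and>
        time_field M d p = jacobian c d p *v time_field M c p)"

text \<open>Every open interval is diffeomorphic to the real line, so curves may be parametrised by it.\<close>

definition inextendible_timelike_curve ::
    "('a::{t2_space,second_countable_topology}, 'm::finite) spacetime \<Rightarrow> (real \<Rightarrow> 'a) \<Rightarrow> bool" where
  "inextendible_timelike_curve M \<gamma> \<longleftrightarrow> continuous_on UNIV \<gamma> \<and>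
     (\<forall>c\<in>atlas M. smooth_on (\<gamma> -` cdom c) (cmap c \<circ> \<gamma>) \<and>
        (\<forall>t\<in>\<gamma> -` cdom c. timelike M c (\<gamma> t) (vector_derivative (cmap c \<circ> \<gamma>) (at t)))) \<and>
     \<not> (\<exists>p. (\<gamma> \<longlongrightarrow> p) at_top) \<and> \<not> (\<exists>p. (\<gamma> \<longlongrightarrow> p) at_bot)"

definition globally_hyperbolic ::
    "('a::{t2_space,second_countable_topology}, 'm::finite) spacetime \<Rightarrow> bool" where
  "globally_hyperbolic M \<longleftrightarrow>
     (\<exists>C. \<forall>\<gamma>. inextendible_timelike_curve M \<gamma> \<longrightarrow> (\<exists>!t. \<gamma> t \<in> C))"

section \<open>Field equations and energy conditions\<close>

text \<open>
  Variation of \<open>(1/\<kappa>) \<integral> \<surd>|g| R (1 - \<alpha> \<Phi>\<^sup>2) + (1/2\<lambda>) \<integral> \<surd>|g| (\<nabla>\<Phi>)\<^sup>2\<close>.  The Einstein-Hilbert part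
  contributes \<open>G/\<kappa>\<close>; everything else is \<open>\<Phi>\<close>-dependent, and \<open>- 8 \<pi> / \<kappa>\<close> times the
  energy-momentum tensor is its derivative with respect to the inverse metric.  The variation of
  \<open>\<surd>|g| R f\<close> is \<open>f G\<^sub>\<mu>\<^sub>\<nu> + g\<^sub>\<mu>\<^sub>\<nu> \<box>f - \<nabla>\<^sub>\<mu>\<nabla>\<^sub>\<nu> f\<close>, here used for \<open>f = - \<alpha> \<Phi>\<^sup>2\<close>.
\<close>

definition energy_momentum ::
    "real \<Rightarrow> real \<Rightarrow> real \<Rightarrow> ('a, 'm::finite) spacetime \<Rightarrow> ('a \<Rightarrow> real)
      \<Rightarrow> ('a, 'm) chart \<Rightarrow> 'a \<Rightarrow> real^'m^'m" where
  "energy_momentum \<kappa> l \<alpha> M \<Phi> c p = (1 / (8 * pi)) *\<^sub>R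
     (let g = metric M c; f = (\<lambda>x. (\<Phi> x)\<^sup>2);
          dd = (\<chi> \<mu> \<nu>. cpd c \<mu> \<Phi> p * cpd c \<nu> \<Phi> p)
      in \<alpha> *\<^sub>R (f p *\<^sub>R einstein c g p + laplacian c g f p *\<^sub>R g p - hessian c g f p)
         - (\<kappa> / (2 * l)) *\<^sub>R (dd - (mtrace (g p) dd / 2) *\<^sub>R g p))"

definition conformal_scalar_solution ::
    "real \<Rightarrow> real \<Rightarrow> real \<Rightarrow> ('a::{t2_space,second_countable_topology}, 'm::finite) spacetime
      \<Rightarrow> ('a \<Rightarrow> real) \<Rightarrow> bool" where
  "conformal_scalar_solution \<kappa> l \<alpha> M \<Phi> \<longleftrightarrow>
     (\<forall>c\<in>atlas M. csmooth c \<Phi> \<and> (\<forall>p\<in>cdom c.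
        einstein c (metric M c) p = (8 * pi) *\<^sub>R energy_momentum \<kappa> l \<alpha> M \<Phi> c p \<and>
        laplacian c (metric M c) \<Phi> p / l
          + 2 * \<alpha> / \<kappa> * scalar_curv c (metric M c) p * \<Phi> p = 0))"

definition weak_energy_condition_at ::
    "('a, 'm::finite) spacetime \<Rightarrow> (('a, 'm) chart \<Rightarrow> 'a \<Rightarrow> real^'m^'m) \<Rightarrow> 'a \<Rightarrow> bool" where
  "weak_energy_condition_at M T p \<longleftrightarrow>
     (\<forall>c\<in>atlas M. p \<in> cdom c \<longrightarrow> (\<forall>\<zeta>. future_timelike M c p \<zeta> \<longrightarrow> bil (T c p) \<zeta> \<zeta> \<ge> 0))"

definition dominant_energy_condition_at ::
    "('a, 'm::finite) spacetime \<Rightarrow> (('a, 'm) chart \<Rightarrow> 'a \<Rightarrow> real^'m^'m) \<Rightarrow> 'a \<Rightarrow> bool" where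
  "dominant_energy_condition_at M T p \<longleftrightarrow>
     (\<forall>c\<in>atlas M. p \<in> cdom c \<longrightarrow> (\<forall>\<zeta>. future_timelike M c p \<zeta> \<longrightarrow>
        future_causal M c p
          (\<chi> \<nu>. - (\<Sum>\<mu>\<in>UNIV. \<Sum>\<rho>\<in>UNIV.
                   T c p $ \<mu> $ \<rho> * matrix_inv (metric M c p) $ \<rho> $ \<nu> * \<zeta> $ \<mu>))))"

section \<open>Spatial slices\<close>

text \<open>
  A slice chart \<open>(c, d)\<close> consists of a chart \<open>c\<close> of the spacetime and a chart \<open>d\<close> of \<open>\<sigma>\<close> with
  domain inside that of \<open>c\<close>, with values in a half-space (interior charts fit into this after a
  translation).  The maps \<open>cmap c \<circ> cinv d\<close> are smooth immersions and \<open>cmap d\<close> is a homeomorphism for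
  the subspace topology, so \<open>\<sigma>\<close> is an embedded submanifold, possibly with boundary, once such
  charts cover it.
\<close>

type_synonym ('a, 'm, 'n) schart = "('a, 'm) chart \<times> ('a, 'n) chart"

definition slice_charts ::
    "('a::{t2_space,second_countable_topology}, 'm::finite) spacetime \<Rightarrow> 'a set
      \<Rightarrow> ('a, 'm, 'n::finite) schart set" where
  "slice_charts M \<sigma> = {(c, d). c \<in> atlas M \<and> cdom d \<subseteq> cdom c \<and>
     openin (top_of_set \<sigma>) (cdom d) \<and>
     (\<exists>i. openin (top_of_set {z. 0 \<le> z $ i}) (cimg d)) \<and>
     homeomorphism (cdom d) (cimg d) (cmap d) (cinv d) \<and>
     csmooth d (cmap c) \<and>
     (\<forall>z\<in>cimg d. inj (frechet_derivative (cmap c \<circ> cinv d) (at z within cimg d)))}"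

abbreviation sdom :: "('a, 'm, 'n) schart \<Rightarrow> 'a set" where "sdom e \<equiv> cdom (snd e)"

definition slice_boundary ::
    "('a, 'm, 'n::finite) schart set \<Rightarrow> 'a set" where
  "slice_boundary E = {p. \<exists>e\<in>E. \<exists>i. p \<in> sdom e \<and>
     openin (top_of_set {z. 0 \<le> z $ i}) (cimg (snd e)) \<and> cmap (snd e) p $ i = 0}"

definition tangent :: "('a, 'm::finite, 'n::finite) schart \<Rightarrow> 'n \<Rightarrow> 'a \<Rightarrow> real^'m" where
  "tangent e a p = cpd (snd e) a (cmap (fst e)) p"

definition induced_metric ::
    "('a, 'm::finite) spacetime \<Rightarrow> ('a, 'm, 'n::finite) schart \<Rightarrow> 'a \<Rightarrow> real^'n^'n" where
  "induced_metric M e p = (\<chi> a b. bil (metric M (fst e) p) (tangent e a p) (tangent e b p))"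

text \<open>
  The (maximal) set \<open>E\<close> of slice charts of \<open>\<sigma>\<close> is an argument because the dimension of \<open>\<sigma>\<close> is not
  determined by the types of \<open>M\<close> and \<open>\<sigma>\<close>.
\<close>

definition spatial_slice ::
    "('a::{t2_space,second_countable_topology}, 'm::finite) spacetime \<Rightarrow> 'a set
      \<Rightarrow> ('a, 'm, 'n::finite) schart set \<Rightarrow> bool" where
  "spatial_slice M \<sigma> E \<longleftrightarrow> E = slice_charts M \<sigma> \<and> (\<Union>e\<in>E. sdom e) = \<sigma> \<and>
     (\<forall>e\<in>E. \<forall>p\<in>sdom e. \<forall>v. v \<noteq> 0 \<longrightarrow> bil (induced_metric M e p) v v > 0)"

definition future_unit_normal ::
    "('a, 'm::finite) spacetime \<Rightarrow> ('a, 'm, 'n::finite) schart set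
      \<Rightarrow> (('a, 'm) chart \<Rightarrow> 'a \<Rightarrow> real^'m) \<Rightarrow> bool" where
  "future_unit_normal M E n \<longleftrightarrow> (\<forall>e\<in>E. csmooth (snd e) (n (fst e)) \<and>
     (\<forall>p\<in>sdom e. future_timelike M (fst e) p (n (fst e) p) \<and>
        bil (metric M (fst e) p) (n (fst e) p) (n (fst e) p) = - 1 \<and>
        (\<forall>a. bil (metric M (fst e) p) (n (fst e) p) (tangent e a p) = 0)))"

text \<open>
  \<open>K\<^sub>a\<^sub>b = g(\<nabla>\<^sub>a n, \<partial>\<^sub>b)\<close>, that is, half the Lie derivative of the induced metric along \<open>n\<close>.  This is
  the sign for which the momenta below are those of the action (for the other sign \<open>P\<^sup>a\<^sup>b\<close> would be
  \<open>(a/\<kappa>) \<surd>q (q\<^sup>a\<^sup>b K - K\<^sup>a\<^sup>b) + \<dots>\<close>).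
\<close>

definition extrinsic_curv ::
    "('a, 'm::finite) spacetime \<Rightarrow> (('a, 'm) chart \<Rightarrow> 'a \<Rightarrow> real^'m)
      \<Rightarrow> ('a, 'm, 'n::finite) schart \<Rightarrow> 'a \<Rightarrow> real^'n^'n" where
  "extrinsic_curv M n e p = (\<chi> a b. bil (metric M (fst e) p)
     (cpd (snd e) a (n (fst e)) p
       + (\<chi> \<mu>. \<Sum>\<nu>\<in>UNIV. \<Sum>\<rho>\<in>UNIV. christoffel (fst e) (metric M (fst e)) \<mu> \<nu> \<rho> p
                * tangent e a p $ \<nu> * n (fst e) p $ \<rho>))
     (tangent e b p))"

definition normal_deriv ::
    "(('a, 'm::finite) chart \<Rightarrow> 'a \<Rightarrow> real^'m) \<Rightarrow> ('a \<Rightarrow> real)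
      \<Rightarrow> ('a, 'm, 'n::finite) schart \<Rightarrow> 'a \<Rightarrow> real" where
  "normal_deriv n \<Phi> e p = (\<Sum>\<mu>\<in>UNIV. n (fst e) p $ \<mu> * cpd (fst e) \<mu> \<Phi> p)"

section \<open>Canonical data\<close>

definition coupling :: "real \<Rightarrow> real \<Rightarrow> real" where
  "coupling \<alpha> \<phi> = 1 - \<alpha> * \<phi>\<^sup>2"

definition raise2 :: "real^'n^'n \<Rightarrow> real^'n^'n \<Rightarrow> real^'n^'n" where
  "raise2 q A = (\<chi> a b. \<Sum>c\<in>UNIV. \<Sum>d\<in>UNIV. matrix_inv q $ a $ c * matrix_inv q $ b $ d * A $ c $ d)"

definition lower2 :: "real^'n^'n \<Rightarrow> real^'n^'n \<Rightarrow> real^'n^'n" where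
  "lower2 q A = (\<chi> a b. \<Sum>c\<in>UNIV. \<Sum>d\<in>UNIV. q $ a $ c * q $ b $ d * A $ c $ d)"

definition momentum_scalar ::
    "real \<Rightarrow> real \<Rightarrow> real \<Rightarrow> ('a, 'm::finite) spacetime \<Rightarrow> (('a, 'm) chart \<Rightarrow> 'a \<Rightarrow> real^'m)
      \<Rightarrow> ('a \<Rightarrow> real) \<Rightarrow> ('a, 'm, 'n::finite) schart \<Rightarrow> 'a \<Rightarrow> real" where
  "momentum_scalar \<kappa> l \<alpha> M n \<Phi> e p =
     (let q = induced_metric M e p; K = mtrace q (extrinsic_curv M n e p)
      in - (1 / l) * sqrt (det q) * normal_deriv n \<Phi> e p
         + 4 * \<alpha> / \<kappa> * sqrt (det q) * \<Phi> p * K)"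

definition momentum_metric ::
    "real \<Rightarrow> real \<Rightarrow> ('a, 'm::finite) spacetime \<Rightarrow> (('a, 'm) chart \<Rightarrow> 'a \<Rightarrow> real^'m)
      \<Rightarrow> ('a \<Rightarrow> real) \<Rightarrow> ('a, 'm, 'n::finite) schart \<Rightarrow> 'a \<Rightarrow> real^'n^'n" where
  "momentum_metric \<kappa> \<alpha> M n \<Phi> e p =
     (let q = induced_metric M e p; K = extrinsic_curv M n e p
      in (1 / \<kappa> * coupling \<alpha> (\<Phi> p) * sqrt (det q)) *\<^sub>R (raise2 q K - mtrace q K *\<^sub>R matrix_inv q)
         + (2 * \<alpha> / \<kappa> * sqrt (det q) * \<Phi> p * normal_deriv n \<Phi> e p) *\<^sub>R matrix_inv q)"

definition up_trace :: "real^'n^'n \<Rightarrow> real^'n^'n \<Rightarrow> real" where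
  "up_trace q P = (\<Sum>a\<in>UNIV. \<Sum>b\<in>UNIV. q $ a $ b * P $ a $ b)"

definition trace_free :: "real^'n::finite^'n \<Rightarrow> real^'n^'n \<Rightarrow> real^'n^'n" where
  "trace_free q P = P - (up_trace q P / real CARD('n)) *\<^sub>R matrix_inv q"

text \<open>\<open>conf_generator wg w\<Phi> q P \<phi> \<pi>\<close> is \<open>\<D>\<close> at a point; \<open>wg\<close>, \<open>w\<Phi>\<close> are the conformal weights.\<close>

definition conf_generator ::
    "real \<Rightarrow> real \<Rightarrow> real^'n^'n \<Rightarrow> real^'n^'n \<Rightarrow> real \<Rightarrow> real \<Rightarrow> real" where
  "conf_generator wg w\<Phi> q P \<phi> \<pi>\<phi> = wg * up_trace q P + w\<Phi> * \<pi>\<phi> * \<phi>"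

definition gauge_potential ::
    "real \<Rightarrow> real \<Rightarrow> real \<Rightarrow> real \<Rightarrow> real^'n::finite^'n \<Rightarrow> real^'n^'n \<Rightarrow> real \<Rightarrow> real \<Rightarrow> real" where
  "gauge_potential \<kappa> \<alpha> wg \<delta> q P \<phi> R =
     (let D = real CARD('n); Ptf = trace_free q P
      in \<kappa>\<^sup>2 / (2 * det q * (coupling \<alpha> \<phi>)\<^sup>2)
           * (\<Sum>a\<in>UNIV. \<Sum>b\<in>UNIV. Ptf $ a $ b * lower2 q Ptf $ a $ b)
         + R / 2
         + \<delta>\<^sup>2 * (\<kappa>\<^sup>2 * (D + 1) / (2 * wg\<^sup>2 * D * (D - 1)\<^sup>2)))"

text \<open>
  On the constraint surface the bracket of the smeared constraint \<open>\<kappa> H[N]\<close> with the smeared gauge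
  condition is the integral of \<open>\<rho>\<close> times the operator below applied to \<open>N\<close>; the gauge fixing is
  locally good if that operator has trivial kernel.
\<close>

definition bracket_operator ::
    "real \<Rightarrow> (('a, 'm::finite, 'n::finite) schart \<Rightarrow> 'a \<Rightarrow> real^'n^'n)
      \<Rightarrow> (('a, 'm, 'n) schart \<Rightarrow> 'a \<Rightarrow> real) \<Rightarrow> ('a \<Rightarrow> real) \<Rightarrow> ('a, 'm, 'n) schart \<Rightarrow> 'a \<Rightarrow> real" where
  "bracket_operator wg q \<P> N e p =
     (real CARD('n) - 1) * sqrt (det (q e p)) * wg * (laplacian (snd e) (q e) N p - \<P> e p * N p)"

definition locally_good_gauge_fixing ::
    "('a, 'm::finite, 'n::finite) schart set \<Rightarrow> real
      \<Rightarrow> (('a, 'm, 'n) schart \<Rightarrow> 'a \<Rightarrow> real^'n^'n) \<Rightarrow> (('a, 'm, 'n) schart \<Rightarrow> 'a \<Rightarrow> real) \<Rightarrow> bool" where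
  "locally_good_gauge_fixing E wg q \<P> \<longleftrightarrow>
     (\<forall>N. (\<forall>e\<in>E. csmooth (snd e) N) \<and> (\<forall>p\<in>slice_boundary E. N p = 0) \<and>
          (\<forall>e\<in>E. \<forall>p\<in>sdom e. bracket_operator wg q \<P> N e p = 0)
        \<longrightarrow> (\<forall>e\<in>E. \<forall>p\<in>sdom e. N p = 0))"

end

theory Submission
  imports Defs
begin

text \<open>
  The twice contracted Gauss equation \<open>2 G(n, n) = R + K\<^sup>2 - K\<^sub>a\<^sub>b K\<^sup>a\<^sup>b\<close> turns the potential into the sum
  of the squared trace-free part of the extrinsic curvature, the energy density
  \<open>G(n, n) = 8 \<pi> T(n, n)\<close>, and \<open>K\<^sup>2 / D\<close>, where the gauge condition says that \<open>K\<close> is a nonzero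
  multiple of \<open>\<delta>\<close>.  All three terms are nonnegative, and the energy conditions make one of the last
  two positive.  A solution of \<open>\<Delta>N = \<P> N\<close> that vanishes on the boundary then cannot have a positive
  maximum or a negative minimum, because \<open>\<Delta>N \<le> 0\<close> at an interior maximum.
\<close>

section \<open>Derivatives within quadrant-open sets\<close>

text \<open>Let k be the trace of K. The \<delta> term of the potential equals k^2/2 + k^2/(2D).
  Eliminating R/2 through the constraint cancels k^2/2 and leaves K_ab K^ab + 8 \<pi> T(n,n), whose
  part k^2/D is the trace part of K_ab K^ab. The generator depends on k alone because of the exact
  values of \<alpha> and of the weight of \<Phi>: with them the terms containing the normal
  derivative of \<Phi>, and those quadratic in \<Phi>, cancel. Two obstacles shape the geometry.
  Positivity is claimed up to the boundary of the slice, where derivatives are one-sided, so the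
  whole calculus, including the symmetry of second derivatives, has to work there. And the normal is
  a field on the slice only: instead of extending it, the spacetime connection is pulled back and
  every derivative is taken along the slice. The double trace of the pulled-back curvature then
  yields 2 G(n,n) directly, as R + 2 Ric(n,n) with g(n,n) = -1.\<close>

text \<open>
  Open sets and relatively open subsets of a coordinate half-space both have this property, and it
  leaves enough room for derivatives to be unique and for mixed partial derivatives to commute,
  also at boundary points.
\<close>

definition quadrant_open :: "(real^'n::finite) set \<Rightarrow> bool" where
  "quadrant_open S \<longleftrightarrow>
     (\<forall>z\<in>S. \<exists>e>0. \<forall>w. dist w z < e \<and> (\<forall>i. z $ i \<le> w $ i) \<longrightarrow> w \<in> S)"

lemma quadrant_openD:
  assumes "quadrant_open S" "z \<in> S"
  obtains e where "e > 0" "\<And>w. dist w z < e \<Longrightarrow> (\<And>i. z $ i \<le> w $ i) \<Longrightarrow> w \<in> S"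
  using assms unfolding quadrant_open_def by meson

lemma quadrant_open_open: "open S \<Longrightarrow> quadrant_open S"
  unfolding quadrant_open_def open_dist by meson

lemma quadrant_open_halfspace:
  fixes S :: "(real^'n::finite) set"
  assumes "openin (top_of_set {z. 0 \<le> z $ i}) S"
  shows "quadrant_open S"
  unfolding quadrant_open_def
proof
  fix z assume z: "z \<in> S"
  obtain e where e: "e > 0" "\<forall>w\<in>{z. 0 \<le> z $ i}. dist w z < e \<longrightarrow> w \<in> S"
    and S: "S \<subseteq> {z. 0 \<le> z $ i}"
    using assms z unfolding openin_euclidean_subtopology_iff by blast
  show "\<exists>e>0. \<forall>w. dist w z < e \<and> (\<forall>i. z $ i \<le> w $ i) \<longrightarrow> w \<in> S"
  proof (intro exI conjI allI impI)
    fix w assume w: "dist w z < e \<and> (\<forall>i. z $ i \<le> w $ i)"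
    have "0 \<le> z $ i" using z S by auto
    also have "\<dots> \<le> w $ i" using w by auto
    finally show "w \<in> S" using e w by auto
  qed (use e in auto)
qed

text \<open>Uniqueness within a set only asks for arbitrarily small steps along each basis vector,
  of either sign. Basis vectors have nonnegative components, so small positive steps stay in
  \<open>S\<close>.\<close>

lemma quadrant_open_has_derivative_unique:
  fixes S :: "(real^'n::finite) set"
  assumes S: "quadrant_open S" "z \<in> S"
    and "(f has_derivative f') (at z within S)" "(f has_derivative f'') (at z within S)"
  shows "f' = f''"
proof (rule frechet_derivative_unique_within[OF assms(3,4)])
  fix b :: "real^'n" and e :: real assume b: "b \<in> Basis" and e: "e > 0"
  obtain d where d: "d > 0" "\<And>w. dist w z < d \<Longrightarrow> (\<And>i. z $ i \<le> w $ i) \<Longrightarrow> w \<in> S"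
    using quadrant_openD[OF S] by metis
  let ?t = "min d e / 2"
  have "z + ?t *\<^sub>R b \<in> S"
  proof (rule d(2))
    show "dist (z + ?t *\<^sub>R b) z < d" using b d(1) e by (simp add: dist_norm)
    fix i
    obtain j where "b = axis j 1" using b by (auto simp: Basis_vec_def)
    then have "0 \<le> b $ i" by (simp add: axis_def)
    then show "z $ i \<le> (z + ?t *\<^sub>R b) $ i" using d(1) e by simp
  qed
  moreover have "0 < \<bar>?t\<bar>" "\<bar>?t\<bar> < e" using d(1) e by auto
  ultimately show "\<exists>d. 0 < \<bar>d\<bar> \<and> \<bar>d\<bar> < e \<and> z + d *\<^sub>R b \<in> S" by blast
qed

lemma pderiv_on_eqI:
  fixes S :: "(real^'n::finite) set"
  assumes "quadrant_open S" "z \<in> S" "(f has_derivative f') (at z within S)"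
  shows "pderiv_on S b f z = f' b"
proof -
  have "(f has_derivative frechet_derivative f (at z within S)) (at z within S)"
    using assms(3) frechet_derivative_works differentiable_def by blast
  then show ?thesis
    using quadrant_open_has_derivative_unique[OF assms(1,2,3)] by (simp add: pderiv_on_def)
qed

lemma has_derivative_cong_within:
  assumes "\<And>x. x \<in> S \<Longrightarrow> f x = g x" "z \<in> S"
  shows "(f has_derivative f') (at z within S) \<longleftrightarrow> (g has_derivative f') (at z within S)"
  using assms by (metis has_derivative_transform)

lemma pderiv_on_cong:
  assumes "\<And>x. x \<in> S \<Longrightarrow> f x = g x" "z \<in> S"
  shows "pderiv_on S b f z = pderiv_on S b g z"
  unfolding pderiv_on_def frechet_derivative_def
  using has_derivative_cong_within[of S f g z] assms by simp

lemma Ck_on_cong: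
  assumes "\<And>x. x \<in> S \<Longrightarrow> f x = g x"
  shows "Ck_on k S f \<longleftrightarrow> Ck_on k S g"
  using assms
proof (induction k arbitrary: f g)
  case 0
  then show ?case by (auto intro: continuous_on_cong[THEN iffD1])
next
  case (Suc k)
  have "Ck_on k S (pderiv_on S b f) \<longleftrightarrow> Ck_on k S (pderiv_on S b g)" for b
    by (rule Suc.IH) (rule pderiv_on_cong[OF Suc.prems])
  moreover have "f differentiable_on S \<longleftrightarrow> g differentiable_on S"
    unfolding differentiable_on_def differentiable_def
    using has_derivative_cong_within[of S f g] Suc.prems by metis
  ultimately show ?case by simp
qed

text \<open>The segment may run inside the boundary of \<open>S\<close>, so the one-variable
  derivative is obtained from the derivative within \<open>S\<close>, restricted to the segment.
  This is the form in which the mean value theorem gets applied.\<close>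

lemma has_derivative_along_segment:
  fixes S :: "(real^'n::finite) set" and f :: "real^'n \<Rightarrow> real"
  assumes S: "quadrant_open S" and f: "f differentiable_on S"
    and seg: "\<And>s. s \<in> {0..t} \<Longrightarrow> y + s *\<^sub>R v \<in> S" and s: "s \<in> {0..t}"
  shows "((\<lambda>s. f (y + s *\<^sub>R v)) has_derivative (\<lambda>h. h * pderiv_on S v f (y + s *\<^sub>R v)))
    (at s within {0..t})"
proof -
  obtain f' where f': "(f has_derivative f') (at (y + s *\<^sub>R v) within S)"
    using f seg[OF s] unfolding differentiable_on_def differentiable_def by blast
  have line: "((\<lambda>s. y + s *\<^sub>R v) has_derivative (\<lambda>h. h *\<^sub>R v)) (at s within {0..t})"
    by (auto intro!: derivative_eq_intros)
  have "(f has_derivative f') (at (y + s *\<^sub>R v) within (\<lambda>s. y + s *\<^sub>R v) ` {0..t})"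
    by (rule has_derivative_subset[OF f']) (use seg in auto)
  from diff_chain_within[OF line this]
  have "((\<lambda>s. f (y + s *\<^sub>R v)) has_derivative (\<lambda>h. f' (h *\<^sub>R v))) (at s within {0..t})"
    by (simp add: o_def)
  moreover have "f' (h *\<^sub>R v) = h * pderiv_on S v f (y + s *\<^sub>R v)" for h
    using pderiv_on_eqI[OF S seg[OF s] f', of v] linear_scale[OF has_derivative_linear[OF f']] by simp
  ultimately show ?thesis by simp
qed

text \<open>The mean value theorem is used twice: in the direction \<open>a\<close> for the
  difference of \<open>f\<close> along two opposite sides of the square, then in the direction
  \<open>b\<close> for the resulting difference of \<open>pderiv_on S a f\<close>.\<close>

lemma second_difference_mvt:
  fixes S :: "(real^'n::finite) set" and f :: "real^'n \<Rightarrow> real"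
  assumes S: "quadrant_open S" and f: "f differentiable_on S" "pderiv_on S a f differentiable_on S"
    and t: "0 < t" and sq: "\<And>r s. r \<in> {0..t} \<Longrightarrow> s \<in> {0..t} \<Longrightarrow> z + r *\<^sub>R a + s *\<^sub>R b \<in> S"
  shows "\<exists>r\<in>{0..t}. \<exists>s\<in>{0..t}.
    f (z + t *\<^sub>R a + t *\<^sub>R b) - f (z + t *\<^sub>R a) - f (z + t *\<^sub>R b) + f z
      = t\<^sup>2 * pderiv_on S b (pderiv_on S a f) (z + r *\<^sub>R a + s *\<^sub>R b)"
proof -
  let ?g = "\<lambda>r. f ((z + t *\<^sub>R b) + r *\<^sub>R a) - f (z + r *\<^sub>R a)"
  have m0: "z + r *\<^sub>R a \<in> S" if "r \<in> {0..t}" for r using sq[OF that, of 0] t by simp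
  have m1: "(z + t *\<^sub>R b) + r *\<^sub>R a \<in> S" if "r \<in> {0..t}" for r
    using sq[OF that, of t] t by (simp add: algebra_simps)
  have "(?g has_derivative (\<lambda>h. h * pderiv_on S a f ((z + t *\<^sub>R b) + r *\<^sub>R a)
          - h * pderiv_on S a f (z + r *\<^sub>R a))) (at r within {0..t})" if "0 \<le> r" "r \<le> t" for r
    using that by (intro has_derivative_diff has_derivative_along_segment[OF S f(1)] m0 m1) auto
  from mvt_simple[OF t, of ?g, OF this]
  obtain r where r: "r \<in> {0<..<t}" and "?g t - ?g 0 =
      (t - 0) * pderiv_on S a f ((z + t *\<^sub>R b) + r *\<^sub>R a) - (t - 0) * pderiv_on S a f (z + r *\<^sub>R a)"
    by blast
  then have g: "?g t - ?g 0 =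
      t * (pderiv_on S a f ((z + t *\<^sub>R b) + r *\<^sub>R a) - pderiv_on S a f (z + r *\<^sub>R a))"
    and r: "r \<in> {0..t}"
    by (auto simp: right_diff_distrib)
  have "((\<lambda>s. pderiv_on S a f ((z + r *\<^sub>R a) + s *\<^sub>R b)) has_derivative
      (\<lambda>h. h * pderiv_on S b (pderiv_on S a f) ((z + r *\<^sub>R a) + s *\<^sub>R b))) (at s within {0..t})"
    if "0 \<le> s" "s \<le> t" for s
    using that by (intro has_derivative_along_segment[OF S f(2)] sq r) auto
  from mvt_simple[OF t, of "\<lambda>s. pderiv_on S a f ((z + r *\<^sub>R a) + s *\<^sub>R b)", OF this]
  obtain s where s: "s \<in> {0<..<t}" and "pderiv_on S a f ((z + r *\<^sub>R a) + t *\<^sub>R b)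
      - pderiv_on S a f ((z + r *\<^sub>R a) + 0 *\<^sub>R b)
      = (t - 0) * pderiv_on S b (pderiv_on S a f) ((z + r *\<^sub>R a) + s *\<^sub>R b)"
    by blast
  with g have "?g t - ?g 0 = t\<^sup>2 * pderiv_on S b (pderiv_on S a f) (z + r *\<^sub>R a + s *\<^sub>R b)"
    by (simp add: power2_eq_square algebra_simps)
  moreover have "s \<in> {0..t}" using s by simp
  ultimately show ?thesis using r by (intro bexI[of _ r] bexI[of _ s]) (simp_all add: algebra_simps)
qed

text \<open>Clairaut's theorem, with the square for the second difference placed in the positive
  quadrant at \<open>z\<close>, so that boundary points are covered. The second difference is
  symmetric in the two directions, and divided by the squared side it is a nearby value of either
  mixed derivative.\<close>

lemma mixed_partials_commute_real:
  fixes S :: "(real^'n::finite) set" and f :: "real^'n \<Rightarrow> real"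
  assumes S: "quadrant_open S" and z: "z \<in> S" and f: "Ck_on 2 S f"
  shows "pderiv_on S (axis i 1) (pderiv_on S (axis j 1) f) z
    = pderiv_on S (axis j 1) (pderiv_on S (axis i 1) f) z"
proof (rule ccontr)
  let ?a = "axis i 1 :: real^'n" and ?b = "axis j 1 :: real^'n"
  let ?F = "pderiv_on S ?b (pderiv_on S ?a f)" and ?G = "pderiv_on S ?a (pderiv_on S ?b f)"
  assume "?G z \<noteq> ?F z"
  define \<epsilon> where "\<epsilon> = \<bar>?F z - ?G z\<bar> / 2"
  have \<epsilon>: "\<epsilon> > 0" using \<open>?G z \<noteq> ?F z\<close> by (simp add: \<epsilon>_def)
  have d: "f differentiable_on S" "pderiv_on S ?a f differentiable_on S"
      "pderiv_on S ?b f differentiable_on S"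
    and c: "continuous_on S ?F" "continuous_on S ?G"
    using f by (auto simp: numeral_2_eq_2)
  obtain d1 where d1: "d1 > 0" "\<And>w. w \<in> S \<Longrightarrow> dist w z < d1 \<Longrightarrow> dist (?F w) (?F z) < \<epsilon>"
    using c(1) z \<epsilon> unfolding continuous_on_iff by metis
  obtain d2 where d2: "d2 > 0" "\<And>w. w \<in> S \<Longrightarrow> dist w z < d2 \<Longrightarrow> dist (?G w) (?G z) < \<epsilon>"
    using c(2) z \<epsilon> unfolding continuous_on_iff by metis
  obtain e where e: "e > 0" "\<And>w. dist w z < e \<Longrightarrow> (\<And>i. z $ i \<le> w $ i) \<Longrightarrow> w \<in> S"
    using quadrant_openD[OF S z] by metis
  \<comment> \<open>Points of the square have distance at most 2t from \<open>z\<close>; the divisor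
    3 makes this strictly smaller than each of the three radii.\<close>
  define t where "t = min e (min d1 d2) / 3"
  have t: "t > 0" "3 * t \<le> e" "3 * t \<le> d1" "3 * t \<le> d2"
    using e(1) d1(1) d2(1) by (auto simp: t_def)
  have near: "dist (z + r *\<^sub>R axis k 1 + s *\<^sub>R axis l 1) z < 3 * t"
    if "r \<in> {0..t}" "s \<in> {0..t}" for r s k l
  proof -
    have "norm (r *\<^sub>R axis k 1 + s *\<^sub>R axis l 1 :: real^'n) \<le> r + s"
      using that by (intro order.trans[OF norm_triangle_ineq]) simp
    then show ?thesis using that t(1) by (simp add: dist_norm add.assoc)
  qed
  have mem: "z + r *\<^sub>R axis k 1 + s *\<^sub>R axis l 1 \<in> S" if "r \<in> {0..t}" "s \<in> {0..t}" for r s k l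
    using near[OF that] t that by (intro e(2)) (auto simp: axis_def intro: less_le_trans)
  obtain r s where rs: "r \<in> {0..t}" "s \<in> {0..t}" and
    F: "f (z + t *\<^sub>R ?a + t *\<^sub>R ?b) - f (z + t *\<^sub>R ?a) - f (z + t *\<^sub>R ?b) + f z
      = t\<^sup>2 * ?F (z + r *\<^sub>R ?a + s *\<^sub>R ?b)"
    using second_difference_mvt[OF S d(1,2) t(1) mem] by blast
  obtain r' s' where rs': "r' \<in> {0..t}" "s' \<in> {0..t}" and
    G: "f (z + t *\<^sub>R ?b + t *\<^sub>R ?a) - f (z + t *\<^sub>R ?b) - f (z + t *\<^sub>R ?a) + f z
      = t\<^sup>2 * ?G (z + r' *\<^sub>R ?b + s' *\<^sub>R ?a)"
    using second_difference_mvt[OF S d(1,3) t(1) mem] by blast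
  have "t\<^sup>2 * ?F (z + r *\<^sub>R ?a + s *\<^sub>R ?b) = t\<^sup>2 * ?G (z + r' *\<^sub>R ?b + s' *\<^sub>R ?a)"
    using F G by (simp add: algebra_simps)
  then have "?F (z + r *\<^sub>R ?a + s *\<^sub>R ?b) = ?G (z + r' *\<^sub>R ?b + s' *\<^sub>R ?a)" using t(1) by simp
  moreover have "dist (?F (z + r *\<^sub>R ?a + s *\<^sub>R ?b)) (?F z) < \<epsilon>"
    using d1(2)[OF mem[OF rs]] near[OF rs] t(3) by (meson less_le_trans)
  moreover have "dist (?G (z + r' *\<^sub>R ?b + s' *\<^sub>R ?a)) (?G z) < \<epsilon>"
    using d2(2)[OF mem[OF rs']] near[OF rs'] t(4) by (meson less_le_trans)
  \<comment> \<open>A single number cannot be closer than half of |x - y| to both x and y; this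
    explains the choice of \<epsilon>.\<close>
  moreover have False if "u = v" "\<bar>u - x\<bar> < \<bar>x - y\<bar> / 2" "\<bar>v - y\<bar> < \<bar>x - y\<bar> / 2" for u v x y :: real
    using that by (smt (verit) field_sum_of_halves)
  ultimately show False unfolding \<epsilon>_def dist_real_def by blast
qed

lemma pderiv_on_bounded_linear:
  fixes S :: "(real^'n::finite) set"
  assumes "quadrant_open S" "z \<in> S" "f differentiable (at z within S)" "bounded_linear L"
  shows "pderiv_on S b (\<lambda>x. L (f x)) z = L (pderiv_on S b f z)"
proof -
  obtain f' where f': "(f has_derivative f') (at z within S)" using assms(3) by (auto simp: differentiable_def)
  show ?thesis
    using pderiv_on_eqI[OF assms(1,2) f'] pderiv_on_eqI[OF assms(1,2)
        bounded_linear.has_derivative[OF assms(4) f']] by simp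
qed

text \<open>Serves two purposes: passing to the components of vector-valued maps, and passing from a
  solution N to -N.\<close>

lemma Ck_on_bounded_linear:
  fixes S :: "(real^'n::finite) set"
  assumes "quadrant_open S" "bounded_linear L" "Ck_on k S f"
  shows "Ck_on k S (\<lambda>x. L (f x))"
  using assms(3)
proof (induction k arbitrary: f)
  case 0
  then show ?case using assms(2) by (simp add: bounded_linear.continuous_on)
next
  case (Suc k)
  have f: "f differentiable_on S" using Suc.prems by simp
  then have "(\<lambda>x. L (f x)) differentiable_on S"
    unfolding differentiable_on_def differentiable_def
    using bounded_linear.has_derivative[OF assms(2)] by blast
  moreover have "Ck_on k S (pderiv_on S b (\<lambda>x. L (f x)))" if "b \<in> Basis" for b
  proof (subst Ck_on_cong)
    show "pderiv_on S b (\<lambda>x. L (f x)) z = L (pderiv_on S b f z)" if "z \<in> S" for z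
      using pderiv_on_bounded_linear[OF assms(1) that _ assms(2)] f that
      by (auto simp: differentiable_on_def)
    show "Ck_on k S (\<lambda>x. L (pderiv_on S b f x))"
      using Suc that by simp
  qed
  ultimately show ?case by simp
qed

text \<open>The mean value theorem is confined to real values, so the real case is applied to every
  component; taking a component commutes with \<open>pderiv_on\<close>.\<close>

lemma mixed_partials_commute:
  fixes S :: "(real^'n::finite) set" and f :: "real^'n \<Rightarrow> 'b::euclidean_space"
  assumes S: "quadrant_open S" and z: "z \<in> S" and f: "Ck_on 2 S f"
  shows "pderiv_on S (axis i 1) (pderiv_on S (axis j 1) f) z
    = pderiv_on S (axis j 1) (pderiv_on S (axis i 1) f) z"
proof (rule euclidean_eqI)
  fix b :: 'b assume "b \<in> Basis"
  have L: "bounded_linear (\<lambda>x. x \<bullet> b)" by (rule bounded_linear_inner_left)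
  have d: "f differentiable_on S" "pderiv_on S (axis k 1) f differentiable_on S" for k
    using f by (auto simp: numeral_2_eq_2)
  have eq: "pderiv_on S (axis k 1) (pderiv_on S (axis l 1) (\<lambda>x. f x \<bullet> b)) z
     = pderiv_on S (axis k 1) (pderiv_on S (axis l 1) f) z \<bullet> b" for k l
  proof -
    have "pderiv_on S (axis k 1) (pderiv_on S (axis l 1) (\<lambda>x. f x \<bullet> b)) z
      = pderiv_on S (axis k 1) (\<lambda>x. pderiv_on S (axis l 1) f x \<bullet> b) z"
      using pderiv_on_bounded_linear[OF S _ _ L] d(1) z
      by (intro pderiv_on_cong) (auto simp: differentiable_on_def)
    also have "\<dots> = pderiv_on S (axis k 1) (pderiv_on S (axis l 1) f) z \<bullet> b"
      using pderiv_on_bounded_linear[OF S z _ L] d(2) z by (auto simp: differentiable_on_def)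
    finally show ?thesis .
  qed
  show "pderiv_on S (axis i 1) (pderiv_on S (axis j 1) f) z \<bullet> b
    = pderiv_on S (axis j 1) (pderiv_on S (axis i 1) f) z \<bullet> b"
    using mixed_partials_commute_real[OF S z Ck_on_bounded_linear[OF S L f], of i j]
    unfolding eq .
qed

section \<open>Calculus in a chart\<close>

text \<open>One notion for spacetime charts, with open image, and for slice charts, with image
  relatively open in a half-space. Injectivity makes \<open>cinv c\<close> a left inverse of the
  coordinate map.\<close>

definition quadrant_chart :: "('a, 'n::finite) chart \<Rightarrow> bool" where
  "quadrant_chart c \<longleftrightarrow> inj_on (cmap c) (cdom c) \<and> quadrant_open (cimg c)"

definition cdiff :: "('a, 'n::finite) chart \<Rightarrow> ('a \<Rightarrow> 'b::real_normed_vector) \<Rightarrow> 'a \<Rightarrow> bool" where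
  "cdiff c f p \<longleftrightarrow> (f \<circ> cinv c) differentiable (at (cmap c p) within cimg c)"

text \<open>The full linear derivative is kept, so that the sum, product and chain rules are
  inherited from \<open>has_derivative\<close>; partial derivatives are its values on the
  axes.\<close>

definition has_cder ::
    "('a, 'n::finite) chart \<Rightarrow> ('a \<Rightarrow> 'b::real_normed_vector) \<Rightarrow> (real^'n \<Rightarrow> 'b) \<Rightarrow> 'a \<Rightarrow> bool" where
  "has_cder c f F p \<longleftrightarrow> ((f \<circ> cinv c) has_derivative F) (at (cmap c p) within cimg c)"

lemma cdiff_iff: "cdiff c f p \<longleftrightarrow> (\<exists>F. has_cder c f F p)"
  by (simp add: cdiff_def has_cder_def differentiable_def)

lemma has_cder_cdiff: "has_cder c f F p \<Longrightarrow> cdiff c f p"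
  by (auto simp: cdiff_iff)

lemma cinv_cmap: "quadrant_chart c \<Longrightarrow> p \<in> cdom c \<Longrightarrow> cinv c (cmap c p) = p"
  by (simp add: quadrant_chart_def cinv_def)

lemma cmap_cinv: "z \<in> cimg c \<Longrightarrow> cmap c (cinv c z) = z"
  by (auto simp: cinv_def cimg_def f_inv_into_f)

lemma cinv_cdom: "z \<in> cimg c \<Longrightarrow> cinv c z \<in> cdom c"
  by (auto simp: cinv_def cimg_def inv_into_into)

lemma cmap_cimg: "p \<in> cdom c \<Longrightarrow> cmap c p \<in> cimg c"
  by (simp add: cimg_def)

lemma cpd_has_cder:
  assumes "quadrant_chart c" "p \<in> cdom c" "has_cder c f F p"
  shows "cpd c i f p = F (axis i 1)"
  using assms pderiv_on_eqI[of "cimg c" "cmap c p"]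
  by (simp add: cpd_def quadrant_chart_def has_cder_def cmap_cimg)

text \<open>Fields are total functions on the points, but most identities between them hold on the
  chart domain only. Derivatives within the chart image do not see other values.\<close>

lemma cpd_cong:
  assumes "p \<in> cdom c" "\<And>x. x \<in> cdom c \<Longrightarrow> f x = g x"
  shows "cpd c i f p = cpd c i g p"
  unfolding cpd_def by (rule pderiv_on_cong) (use assms in \<open>auto simp: cinv_cdom cmap_cimg\<close>)

lemma cdiff_cong:
  assumes "p \<in> cdom c" "\<And>x. x \<in> cdom c \<Longrightarrow> f x = g x"
  shows "cdiff c f p \<longleftrightarrow> cdiff c g p"
  unfolding cdiff_def differentiable_def
  using assms by (subst has_derivative_cong_within[of "cimg c" _ "g \<circ> cinv c"]) (auto simp: cinv_cdom cmap_cimg)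

lemma has_cder_linear: "has_cder c f F p \<Longrightarrow> bounded_linear L \<Longrightarrow> has_cder c (\<lambda>x. L (f x)) (\<lambda>v. L (F v)) p"
  using bounded_linear.has_derivative[of L "f \<circ> cinv c" F] by (simp add: has_cder_def o_def)

lemma cdiff_linear: "bounded_linear L \<Longrightarrow> cdiff c f p \<Longrightarrow> cdiff c (\<lambda>x. L (f x)) p"
  unfolding cdiff_iff using has_cder_linear[of c f _ p L] by blast

lemma cpd_linear:
  assumes "bounded_linear L" "quadrant_chart c" "p \<in> cdom c" "cdiff c f p"
  shows "cpd c i (\<lambda>x. L (f x)) p = L (cpd c i f p)"
proof -
  obtain F where F: "has_cder c f F p" using assms(4) by (auto simp: cdiff_iff)
  show ?thesis
    using cpd_has_cder[OF assms(2,3) F] cpd_has_cder[OF assms(2,3) has_cder_linear[OF F assms(1)]] by simp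
qed

lemma has_cder_bilinear:
  assumes "bounded_bilinear B" "quadrant_chart c" "p \<in> cdom c" "has_cder c f F p" "has_cder c g G p"
  shows "has_cder c (\<lambda>x. B (f x) (g x)) (\<lambda>v. B (f p) (G v) + B (F v) (g p)) p"
  using bounded_bilinear.FDERIV[OF assms(1), of "f \<circ> cinv c" F "cmap c p" "cimg c" "g \<circ> cinv c" G] assms
  by (simp add: has_cder_def o_def cinv_cmap)

lemma cdiff_bilinear:
  assumes "bounded_bilinear B" "quadrant_chart c" "p \<in> cdom c" "cdiff c f p" "cdiff c g p"
  shows "cdiff c (\<lambda>x. B (f x) (g x)) p"
  using assms(4,5) has_cder_bilinear[OF assms(1-3), of f _ g] unfolding cdiff_iff by blast

lemma cpd_bilinear:
  assumes "bounded_bilinear B" "quadrant_chart c" "p \<in> cdom c" "cdiff c f p" "cdiff c g p"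
  shows "cpd c i (\<lambda>x. B (f x) (g x)) p = B (f p) (cpd c i g p) + B (cpd c i f p) (g p)"
proof -
  obtain F G where FG: "has_cder c f F p" "has_cder c g G p" using assms by (auto simp: cdiff_iff)
  show ?thesis
    using cpd_has_cder[OF assms(2,3) FG(1)] cpd_has_cder[OF assms(2,3) FG(2)]
      cpd_has_cder[OF assms(2,3) has_cder_bilinear[OF assms(1,2,3) FG]] by simp
qed

lemma has_cder_const: "has_cder c (\<lambda>x. k) (\<lambda>v. 0) p"
  by (simp add: has_cder_def o_def)

lemma cdiff_const: "cdiff c (\<lambda>x. k) p"
  by (rule has_cder_cdiff[OF has_cder_const])

lemma cpd_const: "quadrant_chart c \<Longrightarrow> p \<in> cdom c \<Longrightarrow> cpd c i (\<lambda>x. k) p = 0"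
  by (rule cpd_has_cder[OF _ _ has_cder_const])

lemma has_cder_sum:
  assumes "\<And>j. j \<in> I \<Longrightarrow> has_cder c (f j) (F j) p"
  shows "has_cder c (\<lambda>x. \<Sum>j\<in>I. f j x) (\<lambda>v. \<Sum>j\<in>I. F j v) p"
  using has_derivative_sum[of I "\<lambda>j. f j \<circ> cinv c" F] assms by (simp add: has_cder_def o_def)

lemma cdiff_sum: "(\<And>j. j \<in> I \<Longrightarrow> cdiff c (f j) p) \<Longrightarrow> cdiff c (\<lambda>x. \<Sum>j\<in>I. f j x) p"
  unfolding cdiff_iff using has_cder_sum[of I c f _ p] by metis

lemma cpd_sum:
  assumes "quadrant_chart c" "p \<in> cdom c" "\<And>j. j \<in> I \<Longrightarrow> cdiff c (f j) p"
  shows "cpd c i (\<lambda>x. \<Sum>j\<in>I. f j x) p = (\<Sum>j\<in>I. cpd c i (f j) p)"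
proof -
  obtain F where F: "\<And>j. j \<in> I \<Longrightarrow> has_cder c (f j) (F j) p"
    using assms(3) unfolding cdiff_iff by metis
  have "cpd c i (f j) p = F j (axis i 1)" if "j \<in> I" for j
    using cpd_has_cder[OF assms(1,2) F[OF that]] .
  then show ?thesis using cpd_has_cder[OF assms(1,2) has_cder_sum[OF F]] by simp
qed

lemma has_cder_add: "has_cder c f F p \<Longrightarrow> has_cder c g G p \<Longrightarrow> has_cder c (\<lambda>x. f x + g x) (\<lambda>v. F v + G v) p"
  using has_derivative_add[of "f \<circ> cinv c" F _ "g \<circ> cinv c" G] by (simp add: has_cder_def o_def)

lemma cdiff_add: "cdiff c f p \<Longrightarrow> cdiff c g p \<Longrightarrow> cdiff c (\<lambda>x. f x + g x) p"
  unfolding cdiff_iff using has_cder_add[of c f _ p g] by blast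

lemma cpd_add:
  assumes "quadrant_chart c" "p \<in> cdom c" "cdiff c f p" "cdiff c g p"
  shows "cpd c i (\<lambda>x. f x + g x) p = cpd c i f p + cpd c i g p"
proof -
  obtain F G where FG: "has_cder c f F p" "has_cder c g G p" using assms by (auto simp: cdiff_iff)
  show ?thesis
    using cpd_has_cder[OF assms(1,2) FG(1)] cpd_has_cder[OF assms(1,2) FG(2)]
      cpd_has_cder[OF assms(1,2) has_cder_add[OF FG]] by simp
qed

lemma cdiff_uminus: "cdiff c f p \<Longrightarrow> cdiff c (\<lambda>x. - f x) p"
  by (rule cdiff_linear) (rule bounded_linear_minus[OF bounded_linear_ident])

lemma cdiff_diff:
  assumes "cdiff c f p" "cdiff c g p"
  shows "cdiff c (\<lambda>x. f x - g x) p"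
  using cdiff_add[OF assms(1) cdiff_uminus[OF assms(2)]] by simp

lemma cdiff_prod:
  fixes f :: "'i \<Rightarrow> 'a \<Rightarrow> real"
  assumes "quadrant_chart c" "p \<in> cdom c" "finite I" "\<And>j. j \<in> I \<Longrightarrow> cdiff c (f j) p"
  shows "cdiff c (\<lambda>x. \<Prod>j\<in>I. f j x) p"
  using assms(3,4)
proof (induction I rule: finite_induct)
  case (insert j I)
  then show ?case
    using cdiff_bilinear[OF bounded_bilinear_mult assms(1,2), of "f j" "\<lambda>x. \<Prod>j\<in>I. f j x"] by simp
qed (simp add: cdiff_const)

lemma cdiff_inverse:
  fixes f :: "'a \<Rightarrow> real"
  assumes "quadrant_chart c" "p \<in> cdom c" "cdiff c f p" "f p \<noteq> 0"
  shows "cdiff c (\<lambda>x. inverse (f x)) p"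
  using differentiable_inverse[of "f \<circ> cinv c" "cmap c p" "cimg c"] assms
  by (simp add: cdiff_def o_def cinv_cmap)

section \<open>Matrix-valued fields and differentiability of the inverse metric\<close>

lemma bounded_bilinear_matrix_vector_mult:
  "bounded_bilinear ((*v) :: real^'n::finite^'m::finite \<Rightarrow> real^'n \<Rightarrow> real^'m)"
  unfolding bilinear_conv_bounded_bilinear[symmetric] bilinear_def
  by (auto intro!: linearI simp: algebra_simps scaleR_matrix_vector_assoc)

lemma bounded_bilinear_matrix_matrix_mult:
  "bounded_bilinear ((**) :: real^'n::finite^'m::finite \<Rightarrow> real^'k::finite^'n \<Rightarrow> real^'k^'m)"
  unfolding bilinear_conv_bounded_bilinear[symmetric] bilinear_def
  by (auto intro!: linearI simp: matrix_add_ldistrib matrix_matrix_mult_def vec_eq_iff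
      sum.distrib sum_distrib_left algebra_simps)

lemma bounded_linear_transpose: "bounded_linear (transpose :: real^'n::finite^'m::finite \<Rightarrow> _)"
  by (intro linear_conv_bounded_linear[THEN iffD1] linearI) (auto simp: transpose_def vec_eq_iff)

lemma bounded_linear_entry: "bounded_linear (\<lambda>A :: real^'n::finite^'m::finite. A $ i $ j)"
  by (intro linear_conv_bounded_linear[THEN iffD1] linearI) auto

text \<open>A matrix is a vector of rows: this version assembles rows into a matrix, the real
  version below assembles entries into a row. The embedding of one slot, \<open>axis i\<close>, is
  linear, which reduces both to a finite sum.\<close>

lemma cdiff_vec_lambda:
  fixes f :: "'n::finite \<Rightarrow> 'a \<Rightarrow> real^'k::finite"
  assumes "\<And>i. cdiff c (f i) p"
  shows "cdiff c (\<lambda>x. \<chi> i. f i x) p"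
proof -
  have "bounded_linear (\<lambda>v :: real^'k. axis i v :: real^'k^'n)" for i
    by (intro linear_conv_bounded_linear[THEN iffD1] linearI) (auto simp: axis_def vec_eq_iff)
  then have "cdiff c (\<lambda>x. \<Sum>i\<in>UNIV. axis i (f i x)) p"
    by (intro cdiff_sum cdiff_linear[of "axis _"] assms)
  moreover have "(\<Sum>i\<in>UNIV. axis i (f i x)) = (\<chi> i. f i x)" for x
    by (auto simp: vec_eq_iff axis_def if_distrib[of "\<lambda>v. v $ _"] cong: if_cong)
  ultimately show ?thesis by simp
qed

lemma cdiff_vec_lambda_real:
  fixes f :: "'n::finite \<Rightarrow> 'a \<Rightarrow> real"
  assumes "\<And>i. cdiff c (f i) p"
  shows "cdiff c (\<lambda>x. \<chi> i. f i x) p"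
proof -
  have "bounded_linear (\<lambda>v :: real. axis i v :: real^'n)" for i
    by (intro linear_conv_bounded_linear[THEN iffD1] linearI) (auto simp: axis_def vec_eq_iff)
  then have "cdiff c (\<lambda>x. \<Sum>i\<in>UNIV. axis i (f i x)) p"
    by (intro cdiff_sum cdiff_linear[of "axis _"] assms)
  moreover have "(\<Sum>i\<in>UNIV. axis i (f i x)) = (\<chi> i. f i x)" for x
    by (auto simp: vec_eq_iff axis_def if_distrib[of "\<lambda>v. v $ _"] cong: if_cong)
  ultimately show ?thesis by simp
qed

lemma matrix_inv_inverse:
  fixes A :: "real^'n::finite^'n"
  assumes "invertible A"
  shows "A ** matrix_inv A = mat 1" "matrix_inv A ** A = mat 1"
  using someI_ex[OF assms[unfolded invertible_def]] by (auto simp: matrix_inv_def)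

text \<open>Cramer's rule writes each entry of the inverse as a polynomial in the entries of
  \<open>A\<close> times \<open>inverse (det A)\<close>, a form to which the sum, product and
  reciprocal rules apply.\<close>

lemma matrix_inv_cramer:
  fixes A :: "real^'n::finite^'n"
  assumes "invertible A"
  shows "matrix_inv A $ k $ j = det (\<chi> r s. if s = k then (axis j 1 :: real^'n) $ r else A $ r $ s) * inverse (det A)"
proof -
  have "A *v (matrix_inv A *v axis j 1) = axis j 1"
    by (simp add: matrix_vector_mul_assoc matrix_inv_inverse[OF assms])
  with cramer[of A "matrix_inv A *v axis j 1" "axis j 1"] assms
  have "(matrix_inv A *v axis j 1) $ k = det (\<chi> r s. if s = k then (axis j 1 :: real^'n) $ r else A $ r $ s) / det A"
    by (simp add: invertible_det_nz)
  then show ?thesis by (simp add: matrix_vector_mult_basis column_def divide_inverse)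
qed

lemma cdiff_det:
  fixes A :: "'a \<Rightarrow> real^'k::finite^'k"
  assumes "quadrant_chart c" "p \<in> cdom c" "\<And>i j. cdiff c (\<lambda>x. A x $ i $ j) p"
  shows "cdiff c (\<lambda>x. det (A x)) p"
  unfolding det_def
  by (intro cdiff_sum cdiff_bilinear[OF bounded_bilinear_mult assms(1,2)] cdiff_const
      cdiff_prod assms(1,2,3)) simp

lemma cdiff_matrix_inv:
  fixes A :: "'a \<Rightarrow> real^'k::finite^'k"
  assumes "quadrant_chart c" "p \<in> cdom c" "cdiff c A p" "\<And>x. x \<in> cdom c \<Longrightarrow> invertible (A x)"
  shows "cdiff c (\<lambda>x. matrix_inv (A x)) p"
proof -
  have entry: "cdiff c (\<lambda>x. A x $ i $ j) p" for i j
    using cdiff_linear[OF bounded_linear_entry assms(3)] .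
  have "cdiff c (\<lambda>x. \<chi> k j. det (\<chi> r s. if s = k then (axis j 1 :: real^'k) $ r else A x $ r $ s) * inverse (det (A x))) p"
  proof (intro cdiff_vec_lambda cdiff_vec_lambda_real cdiff_bilinear[OF bounded_bilinear_mult assms(1,2)]
      cdiff_inverse[OF assms(1,2)] cdiff_det[OF assms(1,2)] entry)
    show "det (A p) \<noteq> 0" using assms(2,4) invertible_det_nz by blast
    show "cdiff c (\<lambda>x. (\<chi> r s. if s = k then (axis j 1 :: real^'k) $ r else A x $ r $ s) $ i $ l) p" for k j i l
      by (cases "l = k") (simp_all add: entry cdiff_const)
  qed
  then show ?thesis
    by (subst cdiff_cong[OF assms(2)]) (auto simp: vec_eq_iff matrix_inv_cramer[OF assms(4)])
qed

section \<open>Smooth fields and the change from spacetime to slice coordinates\<close>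

lemma csmooth_cdiff: "csmooth c f \<Longrightarrow> p \<in> cdom c \<Longrightarrow> cdiff c f p"
  unfolding csmooth_def smooth_on_def cdiff_def
  by (metis Ck_on.simps(2) cmap_cimg differentiable_on_def)

lemma csmooth_cpd:
  assumes "csmooth c f"
  shows "csmooth c (cpd c i f)"
proof -
  have "Ck_on k (cimg c) (cpd c i f \<circ> cinv c)" for k
  proof -
    have "Ck_on k (cimg c) (pderiv_on (cimg c) (axis i 1) (f \<circ> cinv c))"
      using assms by (auto simp: csmooth_def smooth_on_def dest: spec[of _ "Suc k"])
    then show ?thesis
      by (subst Ck_on_cong) (auto simp: cpd_def cmap_cinv)
  qed
  then show ?thesis by (simp add: csmooth_def smooth_on_def)
qed

lemma csmooth_cpd_commute:
  fixes f :: "'a \<Rightarrow> 'b::euclidean_space"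
  assumes "quadrant_chart c" "p \<in> cdom c" "csmooth c f"
  shows "cpd c i (cpd c j f) p = cpd c j (cpd c i f) p"
proof -
  have "cpd c k (cpd c l f) p
    = pderiv_on (cimg c) (axis k 1) (pderiv_on (cimg c) (axis l 1) (f \<circ> cinv c)) (cmap c p)" for k l
    unfolding cpd_def[of c k] using assms(2)
    by (intro pderiv_on_cong) (auto simp: cpd_def cmap_cinv cmap_cimg)
  moreover have "Ck_on 2 (cimg c) (f \<circ> cinv c)"
    using assms(3) by (simp add: csmooth_def smooth_on_def)
  ultimately show ?thesis
    using mixed_partials_commute[of "cimg c" "cmap c p" "f \<circ> cinv c" i j] assms(1,2)
    by (simp add: quadrant_chart_def cmap_cimg)
qed

lemma has_cder_expand:
  assumes "has_cder c f F p" "quadrant_chart c" "p \<in> cdom c"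
  shows "F v = (\<Sum>i\<in>UNIV. v $ i *\<^sub>R cpd c i f p)"
proof -
  have F: "linear F" using assms(1) by (auto simp: has_cder_def dest: has_derivative_linear)
  have "F v = F (\<Sum>i\<in>UNIV. v $ i *\<^sub>R axis i 1)"
    by (simp add: basis_expansion[of v, unfolded scalar_mult_eq_scaleR])
  also have "\<dots> = (\<Sum>i\<in>UNIV. v $ i *\<^sub>R F (axis i 1))"
    using F by (simp add: linear_sum linear_scale)
  finally show ?thesis using cpd_has_cder[OF assms(2,3,1)] by simp
qed

text \<open>Here \<open>d\<close> may be a chart of the slice and \<open>c\<close> one of spacetime,
  of different dimensions. The coordinate map sends \<open>cimg d\<close> into
  \<open>cimg c\<close>, so the derivative within the latter restricts to the image.\<close>

lemma has_cder_chain: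
  assumes c: "quadrant_chart c" and d: "quadrant_chart d" and sub: "cdom d \<subseteq> cdom c" and p: "p \<in> cdom d"
    and X: "has_cder d (cmap c) X p" and f: "has_cder c f F p"
  shows "has_cder d f (\<lambda>v. F (X v)) p"
proof -
  let ?X = "cmap c \<circ> cinv d"
  have pc: "p \<in> cdom c" using sub p by blast
  have x0: "?X (cmap d p) = cmap c p" using cinv_cmap[OF d p] by simp
  have img: "?X ` cimg d \<subseteq> cimg c" using sub cinv_cdom[of _ d] by (auto intro!: cmap_cimg)
  have "((f \<circ> cinv c) has_derivative F) (at (?X (cmap d p)) within ?X ` cimg d)"
    using f unfolding has_cder_def x0 by (rule has_derivative_subset[OF _ img])
  from diff_chain_within[OF X[unfolded has_cder_def] this]
  have "((f \<circ> cinv c) \<circ> ?X has_derivative F \<circ> X) (at (cmap d p) within cimg d)" .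
  moreover have "((f \<circ> cinv c) \<circ> ?X) z = (f \<circ> cinv d) z" if "z \<in> cimg d" for z
    using cinv_cmap[OF c] cinv_cdom[OF that] sub by auto
  ultimately show ?thesis
    using has_derivative_cong_within[of "cimg d" "(f \<circ> cinv c) \<circ> ?X" "f \<circ> cinv d"] cmap_cimg[OF p]
    by (simp add: has_cder_def o_def)
qed

lemma cdiff_chain:
  assumes "quadrant_chart c" "quadrant_chart d" "cdom d \<subseteq> cdom c" "p \<in> cdom d"
    "cdiff d (cmap c) p" "cdiff c f p"
  shows "cdiff d f p"
  using assms(5,6) has_cder_chain[OF assms(1-4), of _ f] unfolding cdiff_iff by blast

lemma cpd_chain:
  assumes "quadrant_chart c" "quadrant_chart d" "cdom d \<subseteq> cdom c" "p \<in> cdom d"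
    "cdiff d (cmap c) p" "cdiff c f p"
  shows "cpd d a f p = (\<Sum>i\<in>UNIV. cpd d a (cmap c) p $ i *\<^sub>R cpd c i f p)"
proof -
  obtain X F where XF: "has_cder d (cmap c) X p" "has_cder c f F p" using assms by (auto simp: cdiff_iff)
  have "cpd d a f p = F (X (axis a 1))"
    using cpd_has_cder[OF assms(2,4) has_cder_chain[OF assms(1-4) XF]] .
  then show ?thesis
    using has_cder_expand[OF XF(2) assms(1)] cpd_has_cder[OF assms(2,4) XF(1)] assms(3,4) by auto
qed

section \<open>The Levi-Civita connection in matrix form\<close>

lemma transpose_add: "transpose (A + B) = transpose A + (transpose B :: real^'n^'m)"
  and transpose_diff: "transpose (A - B) = transpose A - (transpose B :: real^'n^'m)"
  and transpose_nth: "transpose A $ i $ j = A $ j $ i"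
  by (simp_all add: transpose_def vec_eq_iff)

lemma transpose_sum: "transpose (\<Sum>i\<in>I. f i) = (\<Sum>i\<in>I. transpose (f i :: real^'n::finite^'m::finite))"
  by (intro linear_sum bounded_linear.linear bounded_linear_transpose)

lemmas matrix_mult_add_left = bounded_bilinear.add_left[OF bounded_bilinear_matrix_matrix_mult]
  and matrix_mult_add_right = bounded_bilinear.add_right[OF bounded_bilinear_matrix_matrix_mult]
  and matrix_mult_diff_left = bounded_bilinear.diff_left[OF bounded_bilinear_matrix_matrix_mult]
  and matrix_mult_diff_right = bounded_bilinear.diff_right[OF bounded_bilinear_matrix_matrix_mult]
  and matrix_mult_sum_left = bounded_bilinear.sum_left[OF bounded_bilinear_matrix_matrix_mult]
  and matrix_mult_sum_right = bounded_bilinear.sum_right[OF bounded_bilinear_matrix_matrix_mult]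
  and matrix_mult_scaleR_left = bounded_bilinear.scaleR_left[OF bounded_bilinear_matrix_matrix_mult]
  and matrix_mult_scaleR_right = bounded_bilinear.scaleR_right[OF bounded_bilinear_matrix_matrix_mult]

lemmas matrix_mult_algebra = matrix_mult_add_left matrix_mult_add_right
  matrix_mult_diff_left matrix_mult_diff_right matrix_mul_assoc

text \<open>
  The connection along the \<open>i\<close>-th coordinate as an endomorphism, the same with the first index
  lowered, and the curvature as an endomorphism.
\<close>

definition conn :: "('a, 'n::finite) chart \<Rightarrow> ('a \<Rightarrow> real^'n^'n) \<Rightarrow> 'n \<Rightarrow> 'a \<Rightarrow> real^'n^'n" where
  "conn c h i p = (\<chi> k l. christoffel c h k i l p)"

definition conn_low :: "('a, 'n::finite) chart \<Rightarrow> ('a \<Rightarrow> real^'n^'n) \<Rightarrow> 'n \<Rightarrow> 'a \<Rightarrow> real^'n^'n" where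
  "conn_low c h i p = (\<chi> l j. (cpd c i h p $ j $ l + cpd c j h p $ i $ l - cpd c l h p $ i $ j) / 2)"

definition curv :: "('a, 'n::finite) chart \<Rightarrow> ('a \<Rightarrow> real^'n^'n) \<Rightarrow> 'n \<Rightarrow> 'n \<Rightarrow> 'a \<Rightarrow> real^'n^'n" where
  "curv c h i j p = (\<chi> k l. riemann c h k l i j p)"

text \<open>Shared by the spacetime metric and the induced metric, so it speaks of symmetry and
  invertibility rather than of a signature. Two derivatives are what curvature calls for; the
  symmetry of second derivatives is supplied where it enters.\<close>

locale metric_chart =
  fixes c :: "('a, 'n::finite) chart" and h :: "'a \<Rightarrow> real^'n^'n"
  assumes chart: "quadrant_chart c"
    and sym: "x \<in> cdom c \<Longrightarrow> transpose (h x) = h x"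
    and inv: "x \<in> cdom c \<Longrightarrow> invertible (h x)"
    and diff: "x \<in> cdom c \<Longrightarrow> cdiff c h x"
    and diff2: "x \<in> cdom c \<Longrightarrow> cdiff c (cpd c i h) x"
begin

lemma h_sym: "p \<in> cdom c \<Longrightarrow> h p $ i $ j = h p $ j $ i"
  using sym transpose_nth by metis

lemma cpd_entry:
  assumes "p \<in> cdom c"
  shows "cpd c i (\<lambda>x. h x $ j $ l) p = cpd c i h p $ j $ l"
  using cpd_linear[OF bounded_linear_entry chart assms diff[OF assms]] .

lemma cpd_sym:
  assumes "p \<in> cdom c"
  shows "cpd c i h p $ j $ l = cpd c i h p $ l $ j"
proof -
  have "cpd c i (\<lambda>x. h x $ j $ l) p = cpd c i (\<lambda>x. h x $ l $ j) p"
    by (rule cpd_cong[OF assms h_sym])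
  then show ?thesis by (simp add: cpd_entry[OF assms])
qed

lemma conn_eq:
  assumes "p \<in> cdom c"
  shows "conn c h i p = matrix_inv (h p) ** conn_low c h i p"
  by (simp add: conn_def conn_low_def christoffel_def cpd_entry[OF assms] vec_eq_iff
      matrix_matrix_mult_def sum_divide_distrib)

lemma mult_conn:
  assumes "p \<in> cdom c"
  shows "h p ** conn c h i p = conn_low c h i p"
  by (simp add: conn_eq[OF assms] matrix_mul_assoc matrix_inv_inverse[OF inv[OF assms]])

lemma conn_low_transpose:
  assumes "p \<in> cdom c"
  shows "transpose (conn_low c h i p) + conn_low c h i p = cpd c i h p"
  using cpd_sym[OF assms] by (simp add: vec_eq_iff transpose_def conn_low_def field_simps)

lemma conn_low_sym:
  assumes "p \<in> cdom c"
  shows "conn_low c h i p $ l $ j = conn_low c h j p $ l $ i"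
  using cpd_sym[OF assms] by (simp add: conn_low_def)

lemma christoffel_sym:
  assumes "p \<in> cdom c"
  shows "christoffel c h k i j p = christoffel c h k j i p"
proof -
  have "conn c h i p $ k $ j = conn c h j p $ k $ i"
    by (simp add: conn_eq[OF assms] matrix_matrix_mult_def conn_low_sym[OF assms, of i _ j])
  then show ?thesis by (simp add: conn_def)
qed

text \<open>The vanishing of the covariant derivative of the metric, in matrix form: the lowered
  connection matrix and its transpose add up to the derivative of \<open>h\<close>, since the other
  two terms of the Christoffel formula are antisymmetric.\<close>

lemma metric_compatible:
  assumes "p \<in> cdom c"
  shows "cpd c i h p = transpose (conn c h i p) ** h p + h p ** conn c h i p"
proof -
  have "transpose (conn_low c h i p) = transpose (conn c h i p) ** h p"
    using mult_conn[OF assms, of i] sym[OF assms] by (metis matrix_transpose_mul)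
  then show ?thesis by (simp add: conn_low_transpose[OF assms, symmetric] mult_conn[OF assms])
qed

lemma conn_low_diff:
  assumes "p \<in> cdom c"
  shows "cdiff c (conn_low c h i) p"
proof -
  have e: "cdiff c (\<lambda>x. cpd c i h x $ j $ k) p" for i j k
    by (rule cdiff_linear[OF bounded_linear_entry diff2[OF assms]])
  have "cdiff c (\<lambda>x. \<chi> l j. (cpd c i h x $ j $ l + cpd c j h x $ i $ l - cpd c l h x $ i $ j) * (1 / 2)) p"
    by (intro cdiff_vec_lambda cdiff_vec_lambda_real cdiff_bilinear[OF bounded_bilinear_mult chart assms]
        cdiff_const cdiff_diff cdiff_add e)
  then show ?thesis by (simp add: conn_low_def[abs_def])
qed

lemma conn_diff:
  assumes "p \<in> cdom c"
  shows "cdiff c (conn c h i) p"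
proof -
  have "cdiff c (\<lambda>x. matrix_inv (h x) ** conn_low c h i x) p"
    by (intro cdiff_bilinear[OF bounded_bilinear_matrix_matrix_mult chart assms]
        conn_low_diff assms cdiff_matrix_inv[OF chart assms] diff inv)
  then show ?thesis by (subst cdiff_cong[OF assms conn_eq]) auto
qed

lemma curv_eq:
  assumes "p \<in> cdom c"
  shows "curv c h i j p = cpd c i (conn c h j) p - cpd c j (conn c h i) p
    + conn c h i p ** conn c h j p - conn c h j p ** conn c h i p"
proof -
  have "cpd c i (\<lambda>x. conn c h j x $ k $ l) p = cpd c i (conn c h j) p $ k $ l" for i j k l
    by (rule cpd_linear[OF bounded_linear_entry chart assms conn_diff[OF assms]])
  then have "cpd c i (christoffel c h k j l) p = cpd c i (conn c h j) p $ k $ l" for i j k l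
    by (simp add: conn_def)
  then show ?thesis
    by (simp add: vec_eq_iff curv_def riemann_def matrix_matrix_mult_def conn_def sum_subtractf)
qed

lemma curv_antisym: "p \<in> cdom c \<Longrightarrow> curv c h i j p = - curv c h j i p"
  by (simp add: curv_eq)

text \<open>Differentiating \<open>h ** conn = conn_low\<close> and using metric compatibility
  absorbs the products of two connection matrices. What is left involves derivatives of the lowered
  symbols, which along the slice are inner products of frame vectors.\<close>

lemma mult_curv:
  assumes "p \<in> cdom c"
  shows "h p ** curv c h i j p = (cpd c i (conn_low c h j) p - transpose (conn c h i p) ** conn_low c h j p)
    - (cpd c j (conn_low c h i) p - transpose (conn c h j p) ** conn_low c h i p)"
proof -
  have "cpd c i (conn_low c h j) p = h p ** cpd c i (conn c h j) p + cpd c i h p ** conn c h j p" for i j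
  proof -
    have "cpd c i (conn_low c h j) p = cpd c i (\<lambda>x. h x ** conn c h j x) p"
      by (rule cpd_cong[OF assms]) (simp add: mult_conn)
    then show ?thesis
      by (simp add: cpd_bilinear[OF bounded_bilinear_matrix_matrix_mult chart assms diff[OF assms] conn_diff[OF assms]])
  qed
  then show ?thesis
    by (simp add: metric_compatible[OF assms] curv_eq[OF assms] mult_conn[OF assms, symmetric]
        matrix_mult_algebra)
qed

text \<open>Antisymmetry of the Riemann tensor in its first index pair. The symmetric part of the
  derivative terms is the commutator of second derivatives of \<open>h\<close>, which vanishes, and
  transposing the quadratic term exchanges \<open>i\<close> and \<open>j\<close>.\<close>

lemma mult_curv_antisym:
  assumes p: "p \<in> cdom c" and comm: "\<And>i j. cpd c i (cpd c j h) p = cpd c j (cpd c i h) p"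
  shows "transpose (h p ** curv c h i j p) = - (h p ** curv c h i j p)"
proof -
  note [simp] = transpose_add transpose_diff matrix_transpose_mul
  have "cpd c i (cpd c j h) p = transpose (cpd c i (conn_low c h j) p) + cpd c i (conn_low c h j) p" for i j
  proof -
    have "cpd c i (cpd c j h) p = cpd c i (\<lambda>x. transpose (conn_low c h j x) + conn_low c h j x) p"
      by (rule cpd_cong[OF p]) (simp add: conn_low_transpose)
    then show ?thesis
      by (simp add: cpd_add[OF chart p] cdiff_linear[OF bounded_linear_transpose] conn_low_diff[OF p]
          cpd_linear[OF bounded_linear_transpose chart p])
  qed
  then have "transpose (cpd c i (conn_low c h j) p) + cpd c i (conn_low c h j) p
      = transpose (cpd c j (conn_low c h i) p) + cpd c j (conn_low c h i) p"
    using comm by metis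
  moreover have "transpose (transpose (conn c h i p) ** conn_low c h j p)
      = transpose (conn c h j p) ** conn_low c h i p" for i j
    by (simp add: mult_conn[OF p, symmetric] sym[OF p] matrix_mul_assoc)
  ultimately show ?thesis
    unfolding mult_curv[OF p] transpose_diff by (simp add: algebra_simps)
qed

end

section \<open>The Gauss equation along an embedded chart\<close>

lemma bil_inner: "bil h v w = v \<bullet> (h *v w)"
  by (simp add: bil_def inner_vec_def matrix_vector_mult_def sum_distrib_left mult_ac)

lemma inner_vector_matrix_mult: "v \<bullet> (w v* A) = (A *v v) \<bullet> (w :: real^'n::finite)"
  by (metis dot_lmul_matrix inner_commute)

lemma (in metric_chart) ip_sym: "p \<in> cdom c \<Longrightarrow> v \<bullet> (h p *v w) = w \<bullet> (h p *v v)"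
  by (metis sym inner_vector_matrix_mult transpose_matrix_vector inner_commute)

lemma (in metric_chart) matrix_inv_sym:
  assumes "p \<in> cdom c"
  shows "transpose (matrix_inv (h p)) = matrix_inv (h p)"
proof -
  have "transpose (matrix_inv (h p)) ** h p = mat 1"
    using matrix_inv_inverse(1)[OF inv[OF assms]] sym[OF assms]
    by (metis matrix_transpose_mul transpose_mat)
  then have "transpose (matrix_inv (h p)) ** (h p ** matrix_inv (h p)) = matrix_inv (h p)"
    by (simp add: matrix_mul_assoc)
  then show ?thesis by (simp add: matrix_inv_inverse[OF inv[OF assms]])
qed

text \<open>The normal is differentiable in the slice chart \<open>d\<close> only. The last
  assumption says that the induced metric is invertible; it is spelled out because \<open>q\<close>
  is defined inside the locale. The dimension condition makes tangent vectors and normal a complete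
  frame.\<close>

locale embedded_chart = metric_chart c g
  for c :: "('a, 'm::finite) chart" and g :: "'a \<Rightarrow> real^'m^'m" +
  fixes d :: "('a, 'n::finite) chart" and n :: "'a \<Rightarrow> real^'m"
  assumes dim: "CARD('m) = CARD('n) + 1"
    and comm: "x \<in> cdom c \<Longrightarrow> cpd c i (cpd c j g) x = cpd c j (cpd c i g) x"
    and dchart: "quadrant_chart d" and sub: "cdom d \<subseteq> cdom c" and emb: "csmooth d (cmap c)"
    and ndiff: "x \<in> cdom d \<Longrightarrow> cdiff d n x"
    and unit: "x \<in> cdom d \<Longrightarrow> bil (g x) (n x) (n x) = - 1"
    and orth: "x \<in> cdom d \<Longrightarrow> bil (g x) (n x) (cpd d a (cmap c) x) = 0"
    and qinv: "x \<in> cdom d \<Longrightarrow>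
      invertible (\<chi> a b. bil (g x) (cpd d a (cmap c) x) (cpd d b (cmap c) x))"
begin

text \<open>
  \<open>T a\<close> are the coordinate vectors of the slice, \<open>nab a\<close> is the covariant derivative of the spacetime
  along them, acting on fields given only on the slice, \<open>A a\<close> is its connection matrix and \<open>F a b\<close>
  its curvature.
\<close>

definition T :: "'n \<Rightarrow> 'a \<Rightarrow> real^'m" where "T a = cpd d a (cmap c)"

definition q :: "'a \<Rightarrow> real^'n^'n" where "q x = (\<chi> a b. T a x \<bullet> (g x *v T b x))"

definition A :: "'n \<Rightarrow> 'a \<Rightarrow> real^'m^'m" where "A a x = (\<Sum>i\<in>UNIV. T a x $ i *\<^sub>R conn c g i x)"

definition nab :: "'n \<Rightarrow> ('a \<Rightarrow> real^'m) \<Rightarrow> 'a \<Rightarrow> real^'m" where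
  "nab a W x = cpd d a W x + A a x *v W x"

definition F :: "'n \<Rightarrow> 'n \<Rightarrow> 'a \<Rightarrow> real^'m^'m" where
  "F a b x = (\<Sum>i\<in>UNIV. \<Sum>j\<in>UNIV. (T a x $ i * T b x $ j) *\<^sub>R curv c g i j x)"

definition K :: "'n \<Rightarrow> 'n \<Rightarrow> 'a \<Rightarrow> real" where
  "K a b x = nab a n x \<bullet> (g x *v T b x)"

lemma in_c: "p \<in> cdom d \<Longrightarrow> p \<in> cdom c" using sub by blast

lemma Xdiff: "p \<in> cdom d \<Longrightarrow> cdiff d (cmap c) p" by (rule csmooth_cdiff[OF emb])

lemma T_smooth: "csmooth d (T a)" unfolding T_def by (rule csmooth_cpd[OF emb])

lemma T_diff: "p \<in> cdom d \<Longrightarrow> cdiff d (T a) p" by (rule csmooth_cdiff[OF T_smooth])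

lemma dT_diff: "p \<in> cdom d \<Longrightarrow> cdiff d (cpd d b (T a)) p"
  by (rule csmooth_cdiff[OF csmooth_cpd[OF T_smooth]])

lemma dT_comm: "p \<in> cdom d \<Longrightarrow> cpd d a (T b) p = cpd d b (T a) p"
  unfolding T_def by (rule csmooth_cpd_commute[OF dchart _ emb])

lemma ddT_comm: "p \<in> cdom d \<Longrightarrow> cpd d a (cpd d b (T e)) p = cpd d b (cpd d a (T e)) p"
  by (rule csmooth_cpd_commute[OF dchart _ T_smooth])

lemma chain:
  assumes "p \<in> cdom d" "cdiff c f p"
  shows "cpd d a f p = (\<Sum>i\<in>UNIV. T a p $ i *\<^sub>R cpd c i f p)"
  unfolding T_def by (rule cpd_chain[OF chart dchart sub assms(1) Xdiff assms(2)]) (rule assms)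

lemma diff_d: "p \<in> cdom d \<Longrightarrow> cdiff c f p \<Longrightarrow> cdiff d f p"
  by (rule cdiff_chain[OF chart dchart sub _ Xdiff])

lemma T_nth_diff: "p \<in> cdom d \<Longrightarrow> cdiff d (\<lambda>x. T a x $ i) p"
  by (rule cdiff_linear[OF bounded_linear_vec_nth T_diff])

lemma A_diff:
  assumes "p \<in> cdom d"
  shows "cdiff d (A a) p"
proof -
  have "cdiff d (\<lambda>x. \<Sum>i\<in>UNIV. T a x $ i *\<^sub>R conn c g i x) p"
    by (intro cdiff_sum cdiff_bilinear[OF bounded_bilinear_scaleR dchart assms] T_nth_diff diff_d
        conn_diff in_c assms)
  then show ?thesis by (simp add: A_def[abs_def])
qed

lemma dg:
  assumes "p \<in> cdom d"
  shows "cpd d a g p = transpose (A a p) ** g p + g p ** A a p"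
proof -
  have "cpd d a g p = (\<Sum>i\<in>UNIV. T a p $ i *\<^sub>R (transpose (conn c g i p) ** g p + g p ** conn c g i p))"
    by (simp add: chain[OF assms diff[OF in_c[OF assms]]] metric_compatible[OF in_c[OF assms]])
  then show ?thesis
    by (simp add: A_def transpose_sum matrix_mult_sum_left matrix_mult_sum_right matrix_mult_scaleR_left
        matrix_mult_scaleR_right transpose_scalar scaleR_add_right sum.distrib)
qed

text \<open>The first sum comes from differentiating the coefficients \<open>T b\<close>. By
  \<open>dT_comm\<close> it is symmetric in \<open>a\<close> and \<open>b\<close>, and so drops out
  of the curvature.\<close>

lemma dA:
  assumes "p \<in> cdom d"
  shows "cpd d a (A b) p = (\<Sum>i\<in>UNIV. cpd d a (T b) p $ i *\<^sub>R conn c g i p)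
    + (\<Sum>i\<in>UNIV. \<Sum>j\<in>UNIV. (T a p $ i * T b p $ j) *\<^sub>R cpd c i (conn c g j) p)"
proof -
  have 1: "cdiff d (\<lambda>x. T b x $ i *\<^sub>R conn c g i x) p" for i
    by (intro cdiff_bilinear[OF bounded_bilinear_scaleR dchart assms] T_nth_diff diff_d
        conn_diff in_c assms)
  have 2: "cpd d a (\<lambda>x. T b x $ i) p = cpd d a (T b) p $ i" for i
    by (rule cpd_linear[OF bounded_linear_vec_nth dchart assms T_diff[OF assms]])
  have 3: "cpd d a (\<lambda>x. T b x $ i *\<^sub>R conn c g i x) p = T b p $ i *\<^sub>R cpd d a (conn c g i) p
      + cpd d a (T b) p $ i *\<^sub>R conn c g i p" for i
    unfolding 2[symmetric]
    by (intro cpd_bilinear[OF bounded_bilinear_scaleR dchart assms] T_nth_diff diff_d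
        conn_diff in_c assms)
  have "cpd d a (A b) p = (\<Sum>i\<in>UNIV. T b p $ i *\<^sub>R cpd d a (conn c g i) p)
      + (\<Sum>i\<in>UNIV. cpd d a (T b) p $ i *\<^sub>R conn c g i p)"
    by (simp add: A_def[abs_def] cpd_sum[OF dchart assms] 1 3 sum.distrib)
  also have "(\<Sum>i\<in>UNIV. T b p $ i *\<^sub>R cpd d a (conn c g i) p)
      = (\<Sum>j\<in>UNIV. \<Sum>i\<in>UNIV. (T a p $ i * T b p $ j) *\<^sub>R cpd c i (conn c g j) p)"
    by (simp add: chain[OF assms conn_diff[OF in_c[OF assms]]] scaleR_sum_right mult.commute)
  also have "\<dots> = (\<Sum>i\<in>UNIV. \<Sum>j\<in>UNIV. (T a p $ i * T b p $ j) *\<^sub>R cpd c i (conn c g j) p)"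
    by (rule sum.swap)
  finally show ?thesis by (simp add: add.commute)
qed

lemma A_mult:
  "A a p ** A b p = (\<Sum>i\<in>UNIV. \<Sum>j\<in>UNIV. (T a p $ i * T b p $ j) *\<^sub>R (conn c g i p ** conn c g j p))"
  by (simp add: A_def matrix_mult_sum_left matrix_mult_sum_right matrix_mult_scaleR_left
      matrix_mult_scaleR_right scaleR_sum_right mult.commute) (rule sum.swap)

text \<open>Naturality: the pull-back \<open>F\<close> of the spacetime curvature is the curvature
  of the pulled-back connection \<open>A\<close>.\<close>

lemma F_eq:
  assumes "p \<in> cdom d"
  shows "F a b p = cpd d a (A b) p - cpd d b (A a) p + A a p ** A b p - A b p ** A a p"
proof -
  have sw: "(\<Sum>i\<in>UNIV. \<Sum>j\<in>UNIV. (T b p $ i * T a p $ j) *\<^sub>R f i j)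
    = (\<Sum>i\<in>UNIV. \<Sum>j\<in>UNIV. (T a p $ i * T b p $ j) *\<^sub>R f j i)" for f :: "'m \<Rightarrow> 'm \<Rightarrow> real^'m^'m"
    by (subst sum.swap) (simp add: mult.commute)
  have 1: "cpd d b (A a) p = (\<Sum>i\<in>UNIV. cpd d a (T b) p $ i *\<^sub>R conn c g i p)
    + (\<Sum>i\<in>UNIV. \<Sum>j\<in>UNIV. (T a p $ i * T b p $ j) *\<^sub>R cpd c j (conn c g i) p)"
    unfolding dA[OF assms] sw dT_comm[OF assms, of b a] ..
  have 2: "A b p ** A a p
      = (\<Sum>i\<in>UNIV. \<Sum>j\<in>UNIV. (T a p $ i * T b p $ j) *\<^sub>R (conn c g j p ** conn c g i p))"
    unfolding A_mult sw ..
  show ?thesis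
    unfolding 1 2 unfolding dA[OF assms] A_mult F_def curv_eq[OF in_c[OF assms]]
    by (simp add: scaleR_add_right scaleR_diff_right sum.distrib sum_subtractf)
qed

lemma nab_diff:
  assumes "p \<in> cdom d" "cdiff d W p" "cdiff d (cpd d a W) p"
  shows "cdiff d (nab a W) p"
  unfolding nab_def[abs_def]
  by (intro cdiff_add cdiff_bilinear[OF bounded_bilinear_matrix_vector_mult dchart assms(1)]
      A_diff assms)

text \<open>Mixed terms, in which \<open>A\<close> multiplies a first derivative of
  \<open>W\<close>, occur symmetrically and cancel; the rest is \<open>F_eq\<close> applied to
  \<open>W\<close>. The field needs values on the slice only.\<close>

lemma nab_commutator:
  assumes p: "p \<in> cdom d" and W: "cdiff d W p" "\<And>a. cdiff d (cpd d a W) p"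
    and cm: "cpd d a (cpd d b W) p = cpd d b (cpd d a W) p"
  shows "nab a (nab b W) p - nab b (nab a W) p = F a b p *v W p"
proof -
  have 1: "cdiff d (\<lambda>x. A a x *v W x) p" for a
    by (intro cdiff_bilinear[OF bounded_bilinear_matrix_vector_mult dchart p] A_diff p W)
  have 2: "cpd d a (nab b W) p = cpd d a (cpd d b W) p + (A b p *v cpd d a W p + cpd d a (A b) p *v W p)" for a b
    unfolding nab_def[abs_def]
    by (simp add: cpd_add[OF dchart p W(2) 1]
        cpd_bilinear[OF bounded_bilinear_matrix_vector_mult dchart p A_diff[OF p] W(1)])
  have 3: "nab a (nab b W) p = cpd d a (nab b W) p + A a p *v nab b W p" for a b
    by (simp add: nab_def)
  show ?thesis
    unfolding 3 2 unfolding nab_def F_eq[OF p] cm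
    by (simp add: algebra_simps matrix_vector_mul_assoc)
qed

lemma nab_compatible:
  assumes p: "p \<in> cdom d" and V: "cdiff d V p" and W: "cdiff d W p"
  shows "cpd d a (\<lambda>x. V x \<bullet> (g x *v W x)) p
    = nab a V p \<bullet> (g p *v W p) + V p \<bullet> (g p *v nab a W p)"
proof -
  have g: "cdiff d g p" by (intro diff_d diff in_c p)
  have gW: "cdiff d (\<lambda>x. g x *v W x) p"
    by (intro cdiff_bilinear[OF bounded_bilinear_matrix_vector_mult dchart p] g W)
  have "cpd d a (\<lambda>x. V x \<bullet> (g x *v W x)) p
      = V p \<bullet> (g p *v cpd d a W p + cpd d a g p *v W p) + cpd d a V p \<bullet> (g p *v W p)"
    by (simp add: cpd_bilinear[OF bounded_bilinear_inner dchart p V gW]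
        cpd_bilinear[OF bounded_bilinear_matrix_vector_mult dchart p g W])
  then show ?thesis
    by (simp add: dg[OF p] nab_def matrix_vector_mult_add_rdistrib inner_vector_matrix_mult
        matrix_vector_mul_assoc[symmetric] matrix_vector_right_distrib inner_add_left inner_add_right)
qed

lemma ip_diff:
  assumes p: "p \<in> cdom d" and V: "cdiff d V p" and W: "cdiff d W p"
  shows "cdiff d (\<lambda>x. V x \<bullet> (g x *v W x)) p"
  by (intro cdiff_bilinear[OF bounded_bilinear_inner dchart p] V W diff_d diff in_c p
      cdiff_bilinear[OF bounded_bilinear_matrix_vector_mult dchart p])

text \<open>Symmetry of the Christoffel symbols. Combined with the commuting derivatives of the
  embedding it says that the pulled-back connection is torsion free on tangent fields.\<close>

lemma A_mult_T:
  assumes p: "p \<in> cdom d"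
  shows "A a p *v T b p = A b p *v T a p"
proof -
  have "(A a p *v T b p) $ k = (\<Sum>i\<in>UNIV. \<Sum>j\<in>UNIV. christoffel c g k i j p * T a p $ i * T b p $ j)" for a b k
    by (simp add: A_def conn_def matrix_vector_mult_def sum_distrib_right sum_distrib_left mult_ac)
      (rule sum.swap)
  moreover have "(\<Sum>i\<in>UNIV. \<Sum>j\<in>UNIV. christoffel c g k i j p * T a p $ i * T b p $ j)
     = (\<Sum>i\<in>UNIV. \<Sum>j\<in>UNIV. christoffel c g k i j p * T b p $ i * T a p $ j)" for k
    by (subst sum.swap) (simp add: christoffel_sym[OF in_c[OF p], of k] mult_ac)
  ultimately show ?thesis by (simp add: vec_eq_iff)
qed

lemma nab_T_sym: "p \<in> cdom d \<Longrightarrow> nab a (T b) p = nab b (T a) p"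
  by (simp add: nab_def dT_comm[of p a b] A_mult_T[of p a b])

lemma dq_entry:
  assumes p: "p \<in> cdom d"
  shows "cpd d k (\<lambda>x. q x $ a $ b) p
    = nab k (T a) p \<bullet> (g p *v T b p) + T a p \<bullet> (g p *v nab k (T b) p)"
  by (simp add: q_def nab_compatible[OF p T_diff[OF p] T_diff[OF p]])

lemma q_diff:
  assumes p: "p \<in> cdom d"
  shows "cdiff d q p"
  unfolding q_def[abs_def] by (intro cdiff_vec_lambda cdiff_vec_lambda_real ip_diff p T_diff)

lemma dq:
  assumes p: "p \<in> cdom d"
  shows "cpd d k q p
    = (\<chi> a b. nab k (T a) p \<bullet> (g p *v T b p) + T a p \<bullet> (g p *v nab k (T b) p))"
  using cpd_linear[OF bounded_linear_entry dchart p q_diff[OF p], of k] dq_entry[OF p]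
  by (simp add: vec_eq_iff)

end

text \<open>The derivative of \<open>q\<close> is again built from inner products of
  \<open>T\<close> and \<open>nab\<close>, both differentiable, which gives the second derivative of
  \<open>q\<close>.\<close>

sublocale embedded_chart \<subseteq> induced: metric_chart d q
proof
  show "quadrant_chart d" by (rule dchart)
  fix x assume x: "x \<in> cdom d"
  show "transpose (q x) = q x"
    using ip_sym[OF in_c[OF x]] by (simp add: q_def transpose_def)
  show "invertible (q x)"
    using qinv[OF x] by (simp add: q_def T_def bil_inner)
  show "cdiff d q x" by (rule q_diff[OF x])
  fix k
  have "cdiff d (\<lambda>x. \<chi> a b. nab k (T a) x \<bullet> (g x *v T b x) + T a x \<bullet> (g x *v nab k (T b) x)) x"
    by (intro cdiff_vec_lambda cdiff_vec_lambda_real cdiff_add ip_diff x T_diff nab_diff dT_diff)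
  then show "cdiff d (cpd d k q) x"
    by (subst cdiff_cong[OF x dq]) auto
qed

context embedded_chart
begin

text \<open>Koszul's formula: in the combination of derivatives of \<open>q\<close> that defines
  \<open>conn_low\<close>, torsion freeness leaves two equal terms. Hence the tangential part of the
  spacetime connection is the Levi-Civita connection of the induced metric.\<close>

lemma T_nab_T:
  assumes p: "p \<in> cdom d"
  shows "T e p \<bullet> (g p *v nab a (T b) p) = conn_low d q a p $ e $ b"
  using nab_T_sym[OF p, of a b] nab_T_sym[OF p, of a e] nab_T_sym[OF p, of b e] ip_sym[OF in_c[OF p]]
  by (simp add: conn_low_def dq[OF p])

text \<open>Differentiating the orthogonality of \<open>n\<close> and \<open>T b\<close> moves the
  derivative from the normal to the tangent vector, at the price of a sign.\<close>

lemma n_nab_T: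
  assumes p: "p \<in> cdom d"
  shows "n p \<bullet> (g p *v nab a (T b) p) = - K a b p"
proof -
  have "cpd d a (\<lambda>x. n x \<bullet> (g x *v T b x)) p = cpd d a (\<lambda>x. 0) p"
    by (rule cpd_cong[OF p]) (use orth in \<open>simp add: bil_inner T_def\<close>)
  then show ?thesis
    using nab_compatible[OF p ndiff[OF p] T_diff[OF p], of a b]
    by (simp add: cpd_const[OF dchart p] K_def)
qed

lemma K_sym: "p \<in> cdom d \<Longrightarrow> K a b p = K b a p"
  using n_nab_T nab_T_sym by (metis minus_equation_iff)

end

text \<open>Moves the innermost summation out past four others, which is how the four spacetime
  indices are extracted in the double trace.\<close>

lemma sum_swap4:
  fixes f :: "'i::finite \<Rightarrow> 'j::finite \<Rightarrow> 'k::finite \<Rightarrow> 'l::finite \<Rightarrow> 'r::finite \<Rightarrow> real"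
  shows "(\<Sum>i\<in>UNIV. \<Sum>j\<in>UNIV. \<Sum>k\<in>UNIV. \<Sum>l\<in>UNIV. \<Sum>r\<in>UNIV. f i j k l r)
    = (\<Sum>r\<in>UNIV. \<Sum>i\<in>UNIV. \<Sum>j\<in>UNIV. \<Sum>k\<in>UNIV. \<Sum>l\<in>UNIV. f i j k l r)"
proof -
  have "(\<Sum>i\<in>UNIV. \<Sum>j\<in>UNIV. \<Sum>k\<in>UNIV. \<Sum>l\<in>UNIV. \<Sum>r\<in>UNIV. f i j k l r)
      = (\<Sum>i\<in>UNIV. \<Sum>j\<in>UNIV. \<Sum>k\<in>UNIV. \<Sum>r\<in>UNIV. \<Sum>l\<in>UNIV. f i j k l r)"
    by (intro sum.cong refl sum.swap)
  also have "\<dots> = (\<Sum>i\<in>UNIV. \<Sum>j\<in>UNIV. \<Sum>r\<in>UNIV. \<Sum>k\<in>UNIV. \<Sum>l\<in>UNIV. f i j k l r)"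
    by (intro sum.cong refl sum.swap)
  also have "\<dots> = (\<Sum>i\<in>UNIV. \<Sum>r\<in>UNIV. \<Sum>j\<in>UNIV. \<Sum>k\<in>UNIV. \<Sum>l\<in>UNIV. f i j k l r)"
    by (intro sum.cong refl sum.swap)
  also have "\<dots> = (\<Sum>r\<in>UNIV. \<Sum>i\<in>UNIV. \<Sum>j\<in>UNIV. \<Sum>k\<in>UNIV. \<Sum>l\<in>UNIV. f i j k l r)"
    by (rule sum.swap)
  finally show ?thesis .
qed

text \<open>Lowering the contracted upper index brings the trace to a form to which the index
  symmetries and the Gauss equation apply.\<close>

lemma (in metric_chart) scalar_curv_eq:
  assumes "p \<in> cdom c"
  shows "scalar_curv c h p = (\<Sum>i\<in>UNIV. \<Sum>j\<in>UNIV. \<Sum>k\<in>UNIV. \<Sum>l\<in>UNIV.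
    matrix_inv (h p) $ i $ j * matrix_inv (h p) $ k $ l * (h p ** curv c h k j p) $ l $ i)"
proof -
  have "curv c h k j p = matrix_inv (h p) ** (h p ** curv c h k j p)" for k j
    by (simp add: matrix_mul_assoc matrix_inv_inverse[OF inv[OF assms]])
  then have "curv c h k j p $ k $ i = (\<Sum>l\<in>UNIV. matrix_inv (h p) $ k $ l * (h p ** curv c h k j p) $ l $ i)" for i j k
    by (metis (no_types, lifting) matrix_matrix_mult_def vec_lambda_beta sum.cong)
  moreover have "ricci c h p $ i $ j = (\<Sum>k\<in>UNIV. curv c h k j p $ k $ i)" for i j
    by (simp add: ricci_def curv_def)
  ultimately show ?thesis
    by (simp add: scalar_curv_def mtrace_def sum_distrib_left mult_ac)
qed

lemma (in metric_chart) ricci_eq: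
  assumes "p \<in> cdom c"
  shows "ricci c h p $ i $ j = (\<Sum>k\<in>UNIV. \<Sum>l\<in>UNIV. matrix_inv (h p) $ k $ l * (h p ** curv c h k j p) $ l $ i)"
proof -
  have "curv c h k j p = matrix_inv (h p) ** (h p ** curv c h k j p)" for k
    by (simp add: matrix_mul_assoc matrix_inv_inverse[OF inv[OF assms]])
  then have "curv c h k j p $ k $ i = (\<Sum>l\<in>UNIV. matrix_inv (h p) $ k $ l * (h p ** curv c h k j p) $ l $ i)" for k
    by (metis (no_types, lifting) matrix_matrix_mult_def vec_lambda_beta sum.cong)
  then show ?thesis by (simp add: ricci_def curv_def)
qed

context embedded_chart
begin

section \<open>The frame of tangent vectors and normal\<close>

abbreviation qi :: "'a \<Rightarrow> real^'n^'n" where "qi p \<equiv> matrix_inv (q p)"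

text \<open>Inner products with \<open>n\<close> and with the \<open>T b\<close> recover -s and
  \<open>q p *v u\<close>. As \<open>q p\<close> is invertible, the coefficient map is injective,
  and the dimensions agree, so it is onto.\<close>

lemma frame_spans:
  assumes p: "p \<in> cdom d"
  obtains u s where "v = (\<Sum>a\<in>UNIV. u $ a *\<^sub>R T a p) + s *\<^sub>R n p"
proof -
  let ?f = "\<lambda>(u :: real^'n, s). (\<Sum>a\<in>UNIV. u $ a *\<^sub>R T a p) + s *\<^sub>R n p"
  have lin: "linear ?f"
    by (auto intro!: linearI simp: scaleR_add_left sum.distrib scaleR_add_right scaleR_sum_right)
  have qu: "(q p *v u) $ b = (\<Sum>a\<in>UNIV. u $ a * (T b p \<bullet> (g p *v T a p)))" for u b
    unfolding matrix_vector_mult_def[of "q p"] by (simp add: q_def mult.commute)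
  have T: "(q p *v u) $ b = T b p \<bullet> (g p *v ?f (u, s))" for u s b
    using orth[OF p, of b] ip_sym[OF in_c[OF p], of "n p" "T b p"]
    by (simp add: qu T_def[symmetric] bil_inner matrix_vector_right_distrib
        inner_add_right linear_sum[OF matrix_vector_mul_linear] inner_sum_right
        matrix_vector_mult_scaleR mult.commute)
  have N: "n p \<bullet> (g p *v ?f (u, s)) = - s" for u s
    using orth[OF p] unit[OF p]
    by (simp add: T_def[symmetric] bil_inner matrix_vector_right_distrib
        inner_add_right linear_sum[OF matrix_vector_mul_linear] inner_sum_right
        matrix_vector_mult_scaleR)
  have "inj ?f"
  proof (subst linear_injective_0[OF lin], clarify)
    fix u s assume 0: "(\<Sum>a\<in>UNIV. u $ a *\<^sub>R T a p) + s *\<^sub>R n p = 0"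
    then have "s = 0" using N[of u s] by simp
    moreover have "q p *v u = 0" using T[of u _ s] 0 by (simp add: vec_eq_iff)
    then have "qi p *v (q p *v u) = 0" by simp
    then have "u = 0"
      using matrix_inv_inverse(2)[OF induced.inv[OF p]] by (simp add: matrix_vector_mul_assoc)
    ultimately show "(u, s) = 0" by (simp add: zero_prod_def)
  qed
  then have "dim (range ?f) = dim (UNIV :: ((real^'n) \<times> real) set)"
    using lin by (intro dim_image_eq) (auto simp: span_UNIV)
  then have "dim (range ?f) = DIM(real^'m)" using dim by simp
  then have "span (range ?f) = UNIV" by (simp only: dim_eq_full)
  then have "v \<in> range ?f"
    unfolding span_eq_iff[THEN iffD2, OF linear_subspace_image[OF lin subspace_UNIV]] by simp
  then obtain w where "v = ?f w" by (rule rangeE)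
  then show ?thesis using that by (cases w) auto
qed

text \<open>The inverse metric is the inverse induced metric on tangent vectors minus the square of
  the normal. The candidate \<open>H\<close> inverts \<open>g p\<close> on each frame vector, and
  the frame spans.\<close>

lemma completeness:
  assumes p: "p \<in> cdom d"
  shows "(\<Sum>a\<in>UNIV. \<Sum>b\<in>UNIV. qi p $ a $ b * T a p $ i * T b p $ j)
    = matrix_inv (g p) $ i $ j + n p $ i * n p $ j"
proof -
  define H :: "real^'m^'m" where "H = (\<chi> i j. (\<Sum>a\<in>UNIV. \<Sum>b\<in>UNIV. qi p $ a $ b * T a p $ i * T b p $ j)
    - n p $ i * n p $ j)"
  have Hw: "H *v w = (\<Sum>a\<in>UNIV. \<Sum>b\<in>UNIV. (qi p $ a $ b * (T b p \<bullet> w)) *\<^sub>R T a p) - (n p \<bullet> w) *\<^sub>R n p" for w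
  proof -
    have "(\<Sum>j\<in>UNIV. (\<Sum>a\<in>UNIV. \<Sum>b\<in>UNIV. qi p $ a $ b * T a p $ i * T b p $ j) * w $ j)
      = (\<Sum>a\<in>UNIV. \<Sum>b\<in>UNIV. \<Sum>j\<in>UNIV. qi p $ a $ b * T a p $ i * T b p $ j * w $ j)" for i
      unfolding sum_distrib_right by (subst sum.swap) (intro sum.cong refl sum.swap)
    then have "(H *v w) $ i = (\<Sum>a\<in>UNIV. \<Sum>b\<in>UNIV. \<Sum>j\<in>UNIV. qi p $ a $ b * T a p $ i * T b p $ j * w $ j)
        - (\<Sum>j\<in>UNIV. n p $ i * n p $ j * w $ j)" for i
      by (simp add: matrix_vector_mult_def H_def left_diff_distrib sum_subtractf)
    then show ?thesis
      by (simp add: vec_eq_iff inner_vec_def sum_distrib_left sum_distrib_right mult_ac)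
  qed
  have q1: "(\<Sum>b\<in>UNIV. qi p $ a $ b * q p $ b $ e) = (if a = e then 1 else 0)" for a e
    using matrix_inv_inverse(2)[OF induced.inv[OF p]]
    by (auto simp: matrix_matrix_mult_def vec_eq_iff mat_def)
  have HT: "H *v (g p *v T e p) = T e p" for e
  proof -
    have "H *v (g p *v T e p) = (\<Sum>a\<in>UNIV. (\<Sum>b\<in>UNIV. qi p $ a $ b * q p $ b $ e) *\<^sub>R T a p)"
      using orth[OF p, of e] by (simp add: Hw q_def T_def[symmetric] bil_inner scaleR_sum_left)
    also have "\<dots> = (\<Sum>a\<in>UNIV. if a = e then T a p else 0)"
      by (intro sum.cong refl) (simp add: q1)
    finally show ?thesis by simp
  qed
  have Hn: "H *v (g p *v n p) = n p"
  proof -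
    have "T b p \<bullet> (g p *v n p) = 0" for b
      using orth[OF p, of b] ip_sym[OF in_c[OF p], of "n p" "T b p"] by (simp add: T_def[symmetric] bil_inner)
    then show ?thesis using unit[OF p] by (simp add: Hw bil_inner)
  qed
  have "(H ** g p) *v v = mat 1 *v v" for v
  proof -
    obtain u s where v: "v = (\<Sum>a\<in>UNIV. u $ a *\<^sub>R T a p) + s *\<^sub>R n p" using frame_spans[OF p] .
    show ?thesis
      unfolding v
      by (simp add: matrix_vector_mul_assoc[symmetric] matrix_vector_right_distrib
          linear_sum[OF matrix_vector_mul_linear] matrix_vector_mult_scaleR HT Hn)
  qed
  then have "H ** g p = mat 1" unfolding matrix_eq by blast
  then have "H ** (g p ** matrix_inv (g p)) = matrix_inv (g p)" by (simp add: matrix_mul_assoc)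
  then have "H = matrix_inv (g p)" by (simp add: matrix_inv_inverse[OF inv[OF in_c[OF p]]])
  then have "matrix_inv (g p) $ i $ j = H $ i $ j" by simp
  then show ?thesis by (simp add: H_def)
qed

lemma ip_frame:
  assumes p: "p \<in> cdom d"
  shows "v \<bullet> (g p *v w) = (\<Sum>a\<in>UNIV. \<Sum>b\<in>UNIV. qi p $ a $ b * (T a p \<bullet> (g p *v v)) * (T b p \<bullet> (g p *v w)))
    - (n p \<bullet> (g p *v v)) * (n p \<bullet> (g p *v w))"
proof -
  have exp: "x \<bullet> (matrix_inv (g p) *v y)
    = (\<Sum>a\<in>UNIV. \<Sum>b\<in>UNIV. qi p $ a $ b * (T a p \<bullet> x) * (T b p \<bullet> y)) - (n p \<bullet> x) * (n p \<bullet> y)" for x y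
  proof -
    have "x \<bullet> (matrix_inv (g p) *v y) = (\<Sum>i\<in>UNIV. \<Sum>j\<in>UNIV.
        ((\<Sum>a\<in>UNIV. \<Sum>b\<in>UNIV. qi p $ a $ b * T a p $ i * T b p $ j) - n p $ i * n p $ j) * x $ i * y $ j)"
      by (simp add: completeness[OF p] bil_inner[symmetric] bil_def)
    also have "\<dots> = (\<Sum>i\<in>UNIV. \<Sum>j\<in>UNIV. \<Sum>a\<in>UNIV. \<Sum>b\<in>UNIV. qi p $ a $ b * (T a p $ i * x $ i) * (T b p $ j * y $ j))
        - (n p \<bullet> x) * (n p \<bullet> y)"
    proof -
      have "(n p \<bullet> x) * (n p \<bullet> y) = (\<Sum>i\<in>UNIV. \<Sum>j\<in>UNIV. n p $ i * n p $ j * x $ i * y $ j)"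
        by (simp add: inner_vec_def sum_product mult_ac)
      then show ?thesis
        by (simp add: left_diff_distrib sum_subtractf sum_distrib_right) (simp add: mult_ac)
    qed
    also have "(\<Sum>i\<in>UNIV. \<Sum>j\<in>UNIV. \<Sum>a\<in>UNIV. \<Sum>b\<in>UNIV. qi p $ a $ b * (T a p $ i * x $ i) * (T b p $ j * y $ j))
        = (\<Sum>i\<in>UNIV. \<Sum>a\<in>UNIV. \<Sum>j\<in>UNIV. \<Sum>b\<in>UNIV. qi p $ a $ b * (T a p $ i * x $ i) * (T b p $ j * y $ j))"
      by (intro sum.cong refl sum.swap)
    also have "\<dots> = (\<Sum>a\<in>UNIV. \<Sum>i\<in>UNIV. \<Sum>j\<in>UNIV. \<Sum>b\<in>UNIV. qi p $ a $ b * (T a p $ i * x $ i) * (T b p $ j * y $ j))"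
      by (rule sum.swap)
    also have "\<dots> = (\<Sum>a\<in>UNIV. \<Sum>i\<in>UNIV. \<Sum>b\<in>UNIV. \<Sum>j\<in>UNIV. qi p $ a $ b * (T a p $ i * x $ i) * (T b p $ j * y $ j))"
      by (intro sum.cong refl sum.swap)
    also have "\<dots> = (\<Sum>a\<in>UNIV. \<Sum>b\<in>UNIV. \<Sum>i\<in>UNIV. \<Sum>j\<in>UNIV. qi p $ a $ b * (T a p $ i * x $ i) * (T b p $ j * y $ j))"
      by (intro sum.cong refl sum.swap)
    also have "\<dots> = (\<Sum>a\<in>UNIV. \<Sum>b\<in>UNIV. qi p $ a $ b * (T a p \<bullet> x) * (T b p \<bullet> y))"
      by (simp add: sum_distrib_left sum_distrib_right inner_vec_def mult_ac)
    finally show ?thesis .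
  qed
  have "v \<bullet> (g p *v w) = (g p *v v) \<bullet> (matrix_inv (g p) *v (g p *v w))"
    by (simp add: matrix_vector_mul_assoc matrix_inv_inverse[OF inv[OF in_c[OF p]]]
        ip_sym[OF in_c[OF p], of v w] inner_commute)
  then show ?thesis unfolding exp .
qed

text \<open>Differentiating \<open>g(e\<^sub>f, \<nabla>\<^sub>b e\<^sub>e)\<close> instead of the Gauss formula for \<open>\<nabla>\<^sub>b e\<^sub>e\<close> avoids any derivative of \<open>K\<close>.\<close>

lemma gauss_equation:
  assumes p: "p \<in> cdom d"
  shows "T f p \<bullet> (g p *v (F a b p *v T e p))
    = (q p ** curv d q a b p) $ f $ e + K a f p * K b e p - K b f p * K a e p"
proof -
  \<comment> \<open>In the frame the tangential parts reproduce the quadratic Christoffel term of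
    the induced curvature, while the two normal parts, each minus an entry of \<open>K\<close>,
    enter with the sign of g(n,n) = -1.\<close>
  have norm: "nab a (T f) p \<bullet> (g p *v nab b (T e) p)
    = (transpose (conn d q a p) ** conn_low d q b p) $ f $ e - K a f p * K b e p" for a b
  proof -
    have "transpose (conn d q a p) = transpose (conn_low d q a p) ** qi p"
      by (simp add: induced.conn_eq[OF p] matrix_transpose_mul induced.matrix_inv_sym[OF p])
    then have "(transpose (conn d q a p) ** conn_low d q b p) $ f $ e
      = (\<Sum>l\<in>UNIV. \<Sum>k\<in>UNIV. qi p $ k $ l * conn_low d q a p $ k $ f * conn_low d q b p $ l $ e)"
      by (simp add: matrix_matrix_mult_def transpose_def sum_distrib_left sum_distrib_right mult_ac)
    also have "\<dots> = (\<Sum>k\<in>UNIV. \<Sum>l\<in>UNIV. qi p $ k $ l * conn_low d q a p $ k $ f * conn_low d q b p $ l $ e)"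
      by (rule sum.swap)
    finally show ?thesis
      unfolding ip_frame[OF p, of "nab a (T f) p"] by (simp add: T_nab_T[OF p] n_nab_T[OF p])
  qed
  have D: "cpd d a (conn_low d q b) p $ f $ e
    = nab a (T f) p \<bullet> (g p *v nab b (T e) p) + T f p \<bullet> (g p *v nab a (nab b (T e)) p)" for a b
  proof -
    have "cpd d a (conn_low d q b) p $ f $ e = cpd d a (\<lambda>x. conn_low d q b x $ f $ e) p"
      by (rule cpd_linear[OF bounded_linear_entry dchart p induced.conn_low_diff[OF p], symmetric])
    also have "\<dots> = cpd d a (\<lambda>x. T f x \<bullet> (g x *v nab b (T e) x)) p"
      by (rule cpd_cong[OF p]) (simp add: T_nab_T)
    finally show ?thesis
      by (simp add: nab_compatible[OF p T_diff[OF p] nab_diff[OF p T_diff[OF p] dT_diff[OF p]]])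
  qed
  have "F a b p *v T e p = nab a (nab b (T e)) p - nab b (nab a (T e)) p"
    by (rule nab_commutator[OF p T_diff[OF p] dT_diff[OF p] ddT_comm[OF p], symmetric])
  then show ?thesis
    by (simp add: induced.mult_curv[OF p] D norm matrix_vector_mult_diff_distrib inner_diff_right)
qed

end

section \<open>The Hamiltonian constraint\<close>

lemma sum_swap_pairs:
  fixes f :: "'i::finite \<Rightarrow> 'j::finite \<Rightarrow> 'k::finite \<Rightarrow> 'l::finite \<Rightarrow> real"
  shows "(\<Sum>i\<in>UNIV. \<Sum>j\<in>UNIV. \<Sum>k\<in>UNIV. \<Sum>l\<in>UNIV. f i j k l)
    = (\<Sum>k\<in>UNIV. \<Sum>l\<in>UNIV. \<Sum>i\<in>UNIV. \<Sum>j\<in>UNIV. f i j k l)"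
proof -
  have "(\<Sum>i\<in>UNIV. \<Sum>j\<in>UNIV. \<Sum>k\<in>UNIV. \<Sum>l\<in>UNIV. f i j k l)
      = (\<Sum>i\<in>UNIV. \<Sum>k\<in>UNIV. \<Sum>j\<in>UNIV. \<Sum>l\<in>UNIV. f i j k l)"
    by (intro sum.cong refl sum.swap)
  also have "\<dots> = (\<Sum>k\<in>UNIV. \<Sum>i\<in>UNIV. \<Sum>j\<in>UNIV. \<Sum>l\<in>UNIV. f i j k l)"
    by (rule sum.swap)
  also have "\<dots> = (\<Sum>k\<in>UNIV. \<Sum>i\<in>UNIV. \<Sum>l\<in>UNIV. \<Sum>j\<in>UNIV. f i j k l)"
    by (intro sum.cong refl sum.swap)
  also have "\<dots> = (\<Sum>k\<in>UNIV. \<Sum>l\<in>UNIV. \<Sum>i\<in>UNIV. \<Sum>j\<in>UNIV. f i j k l)"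
    by (intro sum.cong refl sum.swap)
  finally show ?thesis .
qed

lemma sum_reverse4:
  fixes f :: "'i::finite \<Rightarrow> 'j::finite \<Rightarrow> 'k::finite \<Rightarrow> 'l::finite \<Rightarrow> real"
  shows "(\<Sum>i\<in>UNIV. \<Sum>j\<in>UNIV. \<Sum>k\<in>UNIV. \<Sum>l\<in>UNIV. f i j k l)
    = (\<Sum>l\<in>UNIV. \<Sum>k\<in>UNIV. \<Sum>j\<in>UNIV. \<Sum>i\<in>UNIV. f i j k l)"
proof -
  have "(\<Sum>i\<in>UNIV. \<Sum>j\<in>UNIV. \<Sum>k\<in>UNIV. \<Sum>l\<in>UNIV. f i j k l)
      = (\<Sum>k\<in>UNIV. \<Sum>l\<in>UNIV. \<Sum>i\<in>UNIV. \<Sum>j\<in>UNIV. f i j k l)"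
    by (rule sum_swap_pairs)
  also have "\<dots> = (\<Sum>k\<in>UNIV. \<Sum>l\<in>UNIV. \<Sum>j\<in>UNIV. \<Sum>i\<in>UNIV. f i j k l)"
    by (intro sum.cong refl sum.swap)
  also have "\<dots> = (\<Sum>l\<in>UNIV. \<Sum>k\<in>UNIV. \<Sum>j\<in>UNIV. \<Sum>i\<in>UNIV. f i j k l)"
    by (rule sum.swap)
  finally show ?thesis .
qed

text \<open>For the entrywise inner product of matrices the adjoint of a multiplication is
  multiplication by the transpose. All later contractions with the metric are moved around with this
  rule and its right-hand version.\<close>

lemma inner_matrix_mult_left: "A \<bullet> (B ** C) = (transpose B ** A) \<bullet> (C :: real^'n::finite^'m::finite)"
  for A :: "real^'n^'k::finite"
proof -
  have "A \<bullet> (B ** C) = (\<Sum>i\<in>UNIV. \<Sum>j\<in>UNIV. \<Sum>k\<in>UNIV. A $ i $ j * B $ i $ k * C $ k $ j)"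
    by (simp add: inner_vec_def matrix_matrix_mult_def sum_distrib_left mult_ac)
  also have "\<dots> = (\<Sum>i\<in>UNIV. \<Sum>k\<in>UNIV. \<Sum>j\<in>UNIV. A $ i $ j * B $ i $ k * C $ k $ j)"
    by (intro sum.cong refl sum.swap)
  also have "\<dots> = (\<Sum>k\<in>UNIV. \<Sum>i\<in>UNIV. \<Sum>j\<in>UNIV. A $ i $ j * B $ i $ k * C $ k $ j)"
    by (rule sum.swap)
  also have "\<dots> = (\<Sum>k\<in>UNIV. \<Sum>j\<in>UNIV. \<Sum>i\<in>UNIV. A $ i $ j * B $ i $ k * C $ k $ j)"
    by (intro sum.cong refl sum.swap)
  finally show ?thesis
    by (simp add: inner_vec_def matrix_matrix_mult_def transpose_def sum_distrib_left sum_distrib_right mult_ac)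
qed

lemma inner_transpose: "transpose A \<bullet> transpose B = A \<bullet> (B :: real^'n::finite^'m::finite)"
  by (simp add: inner_vec_def transpose_def) (rule sum.swap)

lemma inner_matrix_mult_right: "A \<bullet> (B ** C) = (A ** transpose C) \<bullet> (B :: real^'k::finite^'m::finite)"
  for A :: "real^'n::finite^'m"
  using inner_matrix_mult_left[of "transpose A" "transpose C" "transpose B"]
    inner_transpose[of A "B ** C"] inner_transpose[of "A ** transpose C" B]
  by (simp add: matrix_transpose_mul)

lemma mtrace_inner: "mtrace h A = matrix_inv h \<bullet> A"
  by (simp add: mtrace_def inner_vec_def)

lemma up_trace_inner: "up_trace h A = h \<bullet> A"
  by (simp add: up_trace_def inner_vec_def)

lemma matrix_sandwich_entry:
  "(B ** A ** transpose B) $ a $ b = (\<Sum>c\<in>UNIV. \<Sum>d\<in>UNIV. B $ a $ c * B $ b $ d * (A :: real^'n::finite^'n) $ c $ d)"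
  unfolding matrix_matrix_mult_def transpose_def
  by (simp add: sum_distrib_left sum_distrib_right mult_ac) (rule sum.swap)

lemma raise2_eq: "raise2 h A = matrix_inv h ** A ** transpose (matrix_inv h)"
  by (simp add: raise2_def vec_eq_iff matrix_sandwich_entry)

lemma lower2_eq: "lower2 h A = h ** A ** transpose h"
  by (simp add: lower2_def vec_eq_iff matrix_sandwich_entry)

context embedded_chart
begin

definition Kmat :: "'a \<Rightarrow> real^'n^'n" where "Kmat p = (\<chi> a b. K a b p)"

lemma F_entry:
  "T l p \<bullet> (g p *v (F k j p *v T i p)) = (\<Sum>s\<in>UNIV. \<Sum>\<nu>\<in>UNIV. \<Sum>r\<in>UNIV. \<Sum>\<mu>\<in>UNIV.
     T k p $ r * T j p $ \<nu> * T l p $ \<mu> * T i p $ s * (g p ** curv c g r \<nu> p) $ \<mu> $ s)"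
proof -
  have F: "F k j p *v w = (\<Sum>r\<in>UNIV. \<Sum>\<nu>\<in>UNIV. (T k p $ r * T j p $ \<nu>) *\<^sub>R (curv c g r \<nu> p *v w))" for w
    unfolding F_def
    by (simp add: bounded_bilinear.sum_left[OF bounded_bilinear_matrix_vector_mult]
        bounded_bilinear.scaleR_left[OF bounded_bilinear_matrix_vector_mult])
  have "T l p \<bullet> (g p *v (F k j p *v T i p))
    = (\<Sum>r\<in>UNIV. \<Sum>\<nu>\<in>UNIV. T k p $ r * T j p $ \<nu> * bil (g p ** curv c g r \<nu> p) (T l p) (T i p))"
    by (simp add: F bil_inner linear_sum[OF matrix_vector_mul_linear] matrix_vector_mult_scaleR
        inner_sum_right matrix_vector_mul_assoc)
  also have "\<dots> = (\<Sum>r\<in>UNIV. \<Sum>\<nu>\<in>UNIV. \<Sum>\<mu>\<in>UNIV. \<Sum>s\<in>UNIV.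
     T k p $ r * T j p $ \<nu> * T l p $ \<mu> * T i p $ s * (g p ** curv c g r \<nu> p) $ \<mu> $ s)"
    by (simp add: bil_def sum_distrib_left mult_ac)
  also have "\<dots> = (\<Sum>s\<in>UNIV. \<Sum>\<mu>\<in>UNIV. \<Sum>\<nu>\<in>UNIV. \<Sum>r\<in>UNIV.
     T k p $ r * T j p $ \<nu> * T l p $ \<mu> * T i p $ s * (g p ** curv c g r \<nu> p) $ \<mu> $ s)"
    by (rule sum_reverse4)
  also have "\<dots> = (\<Sum>s\<in>UNIV. \<Sum>\<nu>\<in>UNIV. \<Sum>\<mu>\<in>UNIV. \<Sum>r\<in>UNIV.
     T k p $ r * T j p $ \<nu> * T l p $ \<mu> * T i p $ s * (g p ** curv c g r \<nu> p) $ \<mu> $ s)"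
    by (intro sum.cong refl sum.swap)
  also have "\<dots> = (\<Sum>s\<in>UNIV. \<Sum>\<nu>\<in>UNIV. \<Sum>r\<in>UNIV. \<Sum>\<mu>\<in>UNIV.
     T k p $ r * T j p $ \<nu> * T l p $ \<mu> * T i p $ s * (g p ** curv c g r \<nu> p) $ \<mu> $ s)"
    by (intro sum.cong refl sum.swap)
  finally show ?thesis .
qed

text \<open>By \<open>completeness\<close> each trace over the slice is a spacetime trace plus a
  contraction with two normals. The product has four terms: the scalar curvature, Ric(n,n) twice,
  and a term with four normals that vanishes by antisymmetry. As g(n,n) = -1, the total is 2
  G(n,n).\<close>

lemma ambient_double_trace:
  assumes p: "p \<in> cdom d"
  shows "(\<Sum>i\<in>UNIV. \<Sum>j\<in>UNIV. \<Sum>k\<in>UNIV. \<Sum>l\<in>UNIV.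
      qi p $ i $ j * qi p $ k $ l * (T l p \<bullet> (g p *v (F k j p *v T i p))))
    = scalar_curv c g p + 2 * bil (ricci c g p) (n p) (n p)" (is "?S = _")
proof -
  define Z where "Z r \<nu> \<mu> s = (g p ** curv c g r \<nu> p) $ \<mu> $ s" for r \<nu> \<mu> s
  have Z1: "Z r \<nu> \<mu> s = - Z \<nu> r \<mu> s" for r \<nu> \<mu> s
    unfolding Z_def curv_antisym[OF in_c[OF p], of r] 
    by (simp add: matrix_matrix_mult_def sum_negf)
  have Z2: "Z r \<nu> \<mu> s = - Z r \<nu> s \<mu>" for r \<nu> \<mu> s
  proof -
    have "transpose (g p ** curv c g r \<nu> p) $ s $ \<mu> = - (g p ** curv c g r \<nu> p) $ s $ \<mu>"
      by (simp only: mult_curv_antisym[OF in_c[OF p] comm[OF in_c[OF p]]] uminus_vec_def vec_lambda_beta)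
    then show ?thesis by (simp add: Z_def transpose_def)
  qed
  let ?G = "matrix_inv (g p)"
  have "?S = (\<Sum>i\<in>UNIV. \<Sum>j\<in>UNIV. \<Sum>k\<in>UNIV. \<Sum>l\<in>UNIV. \<Sum>s\<in>UNIV. \<Sum>\<nu>\<in>UNIV. \<Sum>r\<in>UNIV. \<Sum>\<mu>\<in>UNIV.
      (qi p $ i $ j * T i p $ s * T j p $ \<nu>) * (qi p $ k $ l * T k p $ r * T l p $ \<mu>) * Z r \<nu> \<mu> s)"
    by (simp add: F_entry Z_def sum_distrib_left mult_ac)
  also have "\<dots> = (\<Sum>s\<in>UNIV. \<Sum>i\<in>UNIV. \<Sum>j\<in>UNIV. \<Sum>k\<in>UNIV. \<Sum>l\<in>UNIV. \<Sum>\<nu>\<in>UNIV. \<Sum>r\<in>UNIV. \<Sum>\<mu>\<in>UNIV.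
      (qi p $ i $ j * T i p $ s * T j p $ \<nu>) * (qi p $ k $ l * T k p $ r * T l p $ \<mu>) * Z r \<nu> \<mu> s)"
    by (rule sum_swap4)
  also have "\<dots> = (\<Sum>s\<in>UNIV. \<Sum>\<nu>\<in>UNIV. \<Sum>i\<in>UNIV. \<Sum>j\<in>UNIV. \<Sum>k\<in>UNIV. \<Sum>l\<in>UNIV. \<Sum>r\<in>UNIV. \<Sum>\<mu>\<in>UNIV.
      (qi p $ i $ j * T i p $ s * T j p $ \<nu>) * (qi p $ k $ l * T k p $ r * T l p $ \<mu>) * Z r \<nu> \<mu> s)"
    by (intro sum.cong refl sum_swap4)
  also have "\<dots> = (\<Sum>s\<in>UNIV. \<Sum>\<nu>\<in>UNIV. \<Sum>r\<in>UNIV. \<Sum>i\<in>UNIV. \<Sum>j\<in>UNIV. \<Sum>k\<in>UNIV. \<Sum>l\<in>UNIV. \<Sum>\<mu>\<in>UNIV.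
      (qi p $ i $ j * T i p $ s * T j p $ \<nu>) * (qi p $ k $ l * T k p $ r * T l p $ \<mu>) * Z r \<nu> \<mu> s)"
    by (intro sum.cong refl sum_swap4)
  also have "\<dots> = (\<Sum>s\<in>UNIV. \<Sum>\<nu>\<in>UNIV. \<Sum>r\<in>UNIV. \<Sum>\<mu>\<in>UNIV. \<Sum>i\<in>UNIV. \<Sum>j\<in>UNIV. \<Sum>k\<in>UNIV. \<Sum>l\<in>UNIV.
      (qi p $ i $ j * T i p $ s * T j p $ \<nu>) * (qi p $ k $ l * T k p $ r * T l p $ \<mu>) * Z r \<nu> \<mu> s)"
    by (intro sum.cong refl sum_swap4)
  also have "\<dots> = (\<Sum>s\<in>UNIV. \<Sum>\<nu>\<in>UNIV. \<Sum>r\<in>UNIV. \<Sum>\<mu>\<in>UNIV.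
      (\<Sum>i\<in>UNIV. \<Sum>j\<in>UNIV. qi p $ i $ j * T i p $ s * T j p $ \<nu>)
      * (\<Sum>k\<in>UNIV. \<Sum>l\<in>UNIV. qi p $ k $ l * T k p $ r * T l p $ \<mu>) * Z r \<nu> \<mu> s)"
    by (simp only: sum_distrib_right) (simp only: sum_distrib_left sum_distrib_right)
  also have "\<dots> = (\<Sum>s\<in>UNIV. \<Sum>\<nu>\<in>UNIV. \<Sum>r\<in>UNIV. \<Sum>\<mu>\<in>UNIV.
        (?G $ s $ \<nu> * ?G $ r $ \<mu>) * Z r \<nu> \<mu> s)
      + (\<Sum>s\<in>UNIV. \<Sum>\<nu>\<in>UNIV. \<Sum>r\<in>UNIV. \<Sum>\<mu>\<in>UNIV. (n p $ s * n p $ \<nu> * ?G $ r $ \<mu>) * Z r \<nu> \<mu> s)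
      + (\<Sum>s\<in>UNIV. \<Sum>\<nu>\<in>UNIV. \<Sum>r\<in>UNIV. \<Sum>\<mu>\<in>UNIV. (?G $ s $ \<nu> * n p $ r * n p $ \<mu>) * Z r \<nu> \<mu> s)
      + (\<Sum>s\<in>UNIV. \<Sum>\<nu>\<in>UNIV. \<Sum>r\<in>UNIV. \<Sum>\<mu>\<in>UNIV. (n p $ s * n p $ \<nu> * n p $ r * n p $ \<mu>) * Z r \<nu> \<mu> s)"
    (is "_ = ?t1 + ?t2 + ?t3 + ?t4")
    unfolding completeness[OF p] sum.distrib[symmetric]
    by (intro sum.cong refl) (simp add: algebra_simps)
  also have "?t1 = scalar_curv c g p"
    by (simp add: scalar_curv_eq[OF in_c[OF p]] Z_def)
  also have t2: "?t2 = bil (ricci c g p) (n p) (n p)"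
    by (simp add: bil_def ricci_eq[OF in_c[OF p]] Z_def sum_distrib_left sum_distrib_right mult_ac)
  also have "?t3 = (\<Sum>\<mu>\<in>UNIV. \<Sum>r\<in>UNIV. \<Sum>\<nu>\<in>UNIV. \<Sum>s\<in>UNIV. (?G $ s $ \<nu> * n p $ r * n p $ \<mu>) * Z r \<nu> \<mu> s)"
    by (rule sum_reverse4)
  \<comment> \<open>One sign change in each antisymmetric index pair turns this contraction into the
    previous one with its indices renamed.\<close>
  also have "\<dots> = (\<Sum>\<mu>\<in>UNIV. \<Sum>r\<in>UNIV. \<Sum>\<nu>\<in>UNIV. \<Sum>s\<in>UNIV. (n p $ \<mu> * n p $ r * ?G $ \<nu> $ s) * Z \<nu> r s \<mu>)"
  proof (intro sum.cong refl)
    fix \<mu> r \<nu> s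
    have "?G $ s $ \<nu> = ?G $ \<nu> $ s"
      using matrix_inv_sym[OF in_c[OF p]] by (metis transpose_nth)
    moreover have "Z r \<nu> \<mu> s = Z \<nu> r s \<mu>" using Z1[of r \<nu> \<mu> s] Z2[of \<nu> r \<mu> s] by simp
    ultimately show "(?G $ s $ \<nu> * n p $ r * n p $ \<mu>) * Z r \<nu> \<mu> s = (n p $ \<mu> * n p $ r * ?G $ \<nu> $ s) * Z \<nu> r s \<mu>"
      by simp
  qed
  also have "\<dots> = bil (ricci c g p) (n p) (n p)" by (rule t2)
  \<comment> \<open>Exchanging \<open>r\<close> and \<nu> leaves the normals unchanged and flips the
    sign of \<open>Z\<close>, so the sum equals its own negative.\<close>
  also have "?t4 = 0"
  proof -
    have "?t4 = (\<Sum>s\<in>UNIV. \<Sum>r\<in>UNIV. \<Sum>\<nu>\<in>UNIV. \<Sum>\<mu>\<in>UNIV. (n p $ s * n p $ \<nu> * n p $ r * n p $ \<mu>) * Z r \<nu> \<mu> s)"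
      by (intro sum.cong refl sum.swap)
    also have "\<dots> = (\<Sum>s\<in>UNIV. \<Sum>r\<in>UNIV. \<Sum>\<nu>\<in>UNIV. \<Sum>\<mu>\<in>UNIV. - ((n p $ s * n p $ r * n p $ \<nu> * n p $ \<mu>) * Z \<nu> r \<mu> s))"
    proof (intro sum.cong refl)
      fix s r \<nu> \<mu>
      show "(n p $ s * n p $ \<nu> * n p $ r * n p $ \<mu>) * Z r \<nu> \<mu> s = - ((n p $ s * n p $ r * n p $ \<nu> * n p $ \<mu>) * Z \<nu> r \<mu> s)"
        unfolding Z1[of r \<nu>] by (simp add: mult_ac)
    qed
    also have "\<dots> = - ?t4" by (simp only: sum_negf)
    finally show ?thesis by simp
  qed
  finally show ?thesis by simp
qed

text \<open>The Gauss equation is traced twice with the inverse induced metric: one product of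
  extrinsic curvatures contracts to the square of the trace, the other to the full square.\<close>

lemma hamiltonian_constraint:
  assumes p: "p \<in> cdom d"
  shows "2 * bil (einstein c g p) (n p) (n p)
    = scalar_curv d q p + (mtrace (q p) (Kmat p))\<^sup>2 - raise2 (q p) (Kmat p) \<bullet> Kmat p"
proof -
  have Ks: "Kmat p $ a $ b = Kmat p $ b $ a" for a b by (simp add: Kmat_def K_sym[OF p, of a b])
  have KT: "transpose (Kmat p) = Kmat p" using Ks by (simp add: transpose_def vec_eq_iff)
  have R: "(q p ** curv d q k j p) $ l $ i
    = T l p \<bullet> (g p *v (F k j p *v T i p)) - Kmat p $ k $ l * Kmat p $ j $ i + Kmat p $ k $ i * Kmat p $ j $ l" for k j l i
    by (simp add: gauss_equation[OF p] Kmat_def)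
  have "scalar_curv d q p = (\<Sum>i\<in>UNIV. \<Sum>j\<in>UNIV. \<Sum>k\<in>UNIV. \<Sum>l\<in>UNIV.
      qi p $ i $ j * qi p $ k $ l * (T l p \<bullet> (g p *v (F k j p *v T i p))))
    - (\<Sum>i\<in>UNIV. \<Sum>j\<in>UNIV. \<Sum>k\<in>UNIV. \<Sum>l\<in>UNIV. qi p $ i $ j * qi p $ k $ l * (Kmat p $ k $ l * Kmat p $ j $ i))
    + (\<Sum>i\<in>UNIV. \<Sum>j\<in>UNIV. \<Sum>k\<in>UNIV. \<Sum>l\<in>UNIV. qi p $ i $ j * qi p $ k $ l * (Kmat p $ k $ i * Kmat p $ j $ l))"
    (is "_ = _ - ?u + ?v")
    unfolding induced.scalar_curv_eq[OF p] R sum.distrib[symmetric] sum_subtractf[symmetric]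
    by (intro sum.cong refl) (simp only: ring_distribs)
  moreover have "?u = (mtrace (q p) (Kmat p))\<^sup>2"
  proof -
    have "?u = (\<Sum>i\<in>UNIV. \<Sum>j\<in>UNIV. qi p $ i $ j * Kmat p $ i $ j) * (\<Sum>k\<in>UNIV. \<Sum>l\<in>UNIV. qi p $ k $ l * Kmat p $ k $ l)"
      unfolding sum_distrib_right unfolding sum_distrib_left
      by (intro sum.cong refl) (simp add: Ks mult_ac)
    then show ?thesis by (simp add: mtrace_def power2_eq_square)
  qed
  moreover have "?v = raise2 (q p) (Kmat p) \<bullet> Kmat p"
  proof -
    have "?v = (\<Sum>k\<in>UNIV. \<Sum>l\<in>UNIV. \<Sum>i\<in>UNIV. \<Sum>j\<in>UNIV. qi p $ i $ j * qi p $ k $ l * (Kmat p $ k $ i * Kmat p $ j $ l))"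
      by (rule sum_swap_pairs)
    also have "\<dots> = (\<Sum>k\<in>UNIV. \<Sum>l\<in>UNIV. \<Sum>i\<in>UNIV. \<Sum>j\<in>UNIV. Kmat p $ k $ i * Kmat p $ l $ j * qi p $ i $ j * qi p $ k $ l)"
      using Ks by (intro sum.cong refl) (simp add: mult_ac)
    also have "\<dots> = qi p \<bullet> (Kmat p ** qi p ** transpose (Kmat p))"
      by (simp add: inner_vec_def matrix_sandwich_entry sum_distrib_left mult_ac)
    also have "\<dots> = raise2 (q p) (Kmat p) \<bullet> Kmat p"
      using inner_matrix_mult_right[of "qi p" "Kmat p ** qi p" "transpose (Kmat p)"]
        inner_matrix_mult_right[of "Kmat p" "qi p ** Kmat p" "qi p"]
      by (simp add: raise2_eq KT induced.matrix_inv_sym[OF p] inner_commute)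
    finally show ?thesis .
  qed
  moreover have "bil (einstein c g p) (n p) (n p)
      = bil (ricci c g p) (n p) (n p) - scalar_curv c g p / 2 * bil (g p) (n p) (n p)"
    by (simp add: einstein_def bil_inner matrix_vector_mult_diff_rdistrib inner_diff_right
        scaleR_matrix_vector_assoc[symmetric])
  ultimately show ?thesis
    using ambient_double_trace[OF p] unit[OF p] by simp
qed

end

section \<open>Positive definite and Lorentzian forms\<close>

lemma bil_linear_left: "linear (\<lambda>v. bil h v w)"
  and bil_linear_right: "linear (bil h v)"
  by (auto intro!: linearI simp: bil_inner inner_add_left inner_add_right matrix_vector_right_distrib
      matrix_vector_mult_scaleR)

lemmas bil_algebra = linear_add[OF bil_linear_left] linear_add[OF bil_linear_right]
  linear_diff[OF bil_linear_left] linear_diff[OF bil_linear_right]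
  linear_scale[OF bil_linear_left] linear_scale[OF bil_linear_right]

lemma bil_sym: "transpose h = h \<Longrightarrow> bil h v w = bil h w v"
  by (metis bil_inner inner_commute inner_vector_matrix_mult transpose_matrix_vector)

lemma bil_congruence: "bil h (E *v x) (E *v y) = bil (transpose E ** h ** E) x y"
  by (simp add: bil_inner matrix_vector_mul_assoc[symmetric] inner_vector_matrix_mult)

text \<open>Extends an orthonormal family by a kernel vector instead of a Gram-Schmidt projection.
  The map \<open>f\<close> records the pairings with the vectors already found; it misses the axis
  of the new index, so it is not onto, hence not injective.\<close>

lemma pos_def_frame:
  fixes q :: "real^'n::finite^'n"
  assumes sym: "transpose q = q" and pos: "\<And>v. v \<noteq> 0 \<Longrightarrow> bil q v v > 0"
  obtains E :: "real^'n^'n" where "transpose E ** q ** E = mat 1"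
proof -
  have "\<exists>w :: 'n \<Rightarrow> real^'n. \<forall>i\<in>I. \<forall>j\<in>I. bil q (w i) (w j) = (if i = j then 1 else 0)"
    if "finite I" for I :: "'n set"
    using that
  proof (induction I rule: finite_induct)
    case (insert k I)
    then obtain w :: "'n \<Rightarrow> real^'n"
      where w: "\<And>i j. i \<in> I \<Longrightarrow> j \<in> I \<Longrightarrow> bil q (w i) (w j) = (if i = j then 1 else 0)" by blast
    define f where "f v = (\<chi> j. if j \<in> I then bil q (w j) v else 0)" for v
    have lin: "linear f"
      by (auto intro!: linearI simp: f_def vec_eq_iff bil_algebra)
    have "\<not> surj f"
    proof
      assume "surj f"
      then obtain v where "axis k 1 = f v" by (metis surj_def)
      then have "axis k (1::real) $ k = f v $ k" by simp
      then show False using insert.hyps by (simp add: f_def)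
    qed
    then have "\<not> inj f" using linear_injective_imp_surjective[OF lin] by blast
    then obtain v where v: "v \<noteq> 0" "f v = 0" using linear_injective_0[OF lin] by blast
    have orth: "bil q (w j) v = 0" if "j \<in> I" for j
    proof -
      have "f v $ j = 0" using v(2) by simp
      then show ?thesis using that by (simp add: f_def)
    qed
    define u where "u = (1 / sqrt (bil q v v)) *\<^sub>R v"
    have "bil q u u = 1" using pos[OF v(1)] by (simp add: u_def bil_algebra)
    moreover have "bil q (w j) u = 0" "bil q u (w j) = 0" if "j \<in> I" for j
      using orth[OF that] bil_sym[OF sym, of u "w j"] by (simp_all add: u_def bil_algebra)
    ultimately show ?case
      using w insert.hyps by (intro exI[of _ "w(k := u)"]) auto
  qed simp
  from this[of UNIV] obtain w :: "'n \<Rightarrow> real^'n"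
    where w: "\<And>i j. bil q (w i) (w j) = (if i = j then 1 else 0)" by auto
  define E where "E = (\<chi> a i. w i $ a)"
  have "transpose E ** q ** E = mat 1"
  proof -
    have "(transpose E ** q ** E) $ i $ j = bil q (w i) (w j)" for i j
      unfolding matrix_matrix_mult_def transpose_def
      by (simp add: E_def bil_def sum_distrib_left sum_distrib_right mult_ac) (rule sum.swap)
    then show ?thesis by (simp add: w vec_eq_iff mat_def)
  qed
  then show ?thesis by (rule that)
qed

lemma pos_def_det:
  fixes q :: "real^'n::finite^'n"
  assumes sym: "transpose q = q" and pos: "\<And>v. v \<noteq> 0 \<Longrightarrow> bil q v v > 0"
  shows "det q > 0"
proof -
  obtain E :: "real^'n^'n" where "transpose E ** q ** E = mat 1" using pos_def_frame[OF assms] .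
  then have "det (transpose E ** q ** E) = 1" by simp
  then have "(det E)\<^sup>2 * det q = 1" by (simp add: det_mul det_transpose power2_eq_square mult_ac)
  then show ?thesis by (metis zero_less_mult_pos zero_less_one zero_le_power2 mult_zero_left less_eq_real_def)
qed

text \<open>In an orthonormal frame \<open>E\<close> the inverse of \<open>q\<close> is
  \<open>E ** transpose E\<close>, so the trace is the sum of the values of \<open>H\<close> on the
  frame vectors.\<close>

lemma pos_def_mtrace_nonpos:
  fixes q :: "real^'n::finite^'n"
  assumes sym: "transpose q = q" and pos: "\<And>v. v \<noteq> 0 \<Longrightarrow> bil q v v > 0"
    and H: "\<And>v. bil H v v \<le> 0"
  shows "mtrace q H \<le> 0"
proof -
  obtain E :: "real^'n^'n" where E: "transpose E ** q ** E = mat 1" using pos_def_frame[OF assms(1,2)] .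
  then have "E ** (transpose E ** q) = mat 1" by (simp add: matrix_left_right_inverse)
  moreover have "invertible q" using pos_def_det[OF assms(1,2)] by (simp add: invertible_det_nz)
  ultimately have "matrix_inv q = E ** transpose E"
    by (metis matrix_inv_inverse(1) matrix_mul_assoc matrix_mul_lid matrix_mul_rid)
  then have "mtrace q H = (E ** transpose E) \<bullet> H" by (simp add: mtrace_inner)
  also have "\<dots> = mat 1 \<bullet> (transpose E ** H ** E)"
    using inner_matrix_mult_right[of H E "transpose E"] inner_matrix_mult_left[of E "transpose E" "mat 1"]
      inner_matrix_mult_left[of "H ** E" E "mat 1"]
    by (simp add: inner_commute matrix_mul_assoc)
  also have "\<dots> = (\<Sum>i\<in>UNIV. (transpose E ** H ** E) $ i $ i)"
    by (simp add: inner_vec_def mat_def if_distrib[of "\<lambda>x. x * _"] cong: if_cong)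
  also have "\<dots> = (\<Sum>i\<in>UNIV. bil H (E *v axis i 1) (E *v axis i 1))"
    unfolding bil_congruence
    by (simp add: bil_def axis_def if_distrib[of "\<lambda>x. _ * x"] if_distrib[of "\<lambda>x. x * _"] cong: if_cong)
  also have "\<dots> \<le> 0" by (intro sum_nonpos H)
  finally show ?thesis .
qed

text \<open>Writing \<open>q\<close> as \<open>transpose B ** B\<close> turns the expression into
  the squared norm of \<open>B ** S ** transpose B\<close>.\<close>

lemma pos_def_lower2_nonneg:
  fixes q :: "real^'n::finite^'n"
  assumes sym: "transpose q = q" and pos: "\<And>v. v \<noteq> 0 \<Longrightarrow> bil q v v > 0"
  shows "S \<bullet> lower2 q S \<ge> 0"
proof -
  obtain E :: "real^'n^'n" where E: "transpose E ** q ** E = mat 1" using pos_def_frame[OF assms] .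
  then have E2: "E ** (transpose E ** q) = mat 1" by (simp add: matrix_left_right_inverse)
  define B where "B = transpose E ** q"
  have q: "q = transpose B ** B"
    using E2 sym by (simp add: B_def matrix_transpose_mul) (metis matrix_mul_assoc matrix_mul_rid)
  have "S \<bullet> lower2 q S = S \<bullet> (transpose B ** (B ** S ** transpose B) ** B)"
    by (simp add: lower2_eq q matrix_transpose_mul matrix_mul_assoc)
  also have "\<dots> = (B ** S ** transpose B) \<bullet> (B ** S ** transpose B)"
    using inner_matrix_mult_right[of S "transpose B ** (B ** S ** transpose B)" B]
      inner_matrix_mult_left[of "S ** transpose B" "transpose B" "B ** S ** transpose B"]
    by (simp add: matrix_mul_assoc)
  finally show ?thesis by simp
qed

section \<open>Timelike and causal vectors of a Lorentzian form\<close>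

lemma lorentzian_invertible:
  fixes h :: "real^'m::finite^'m"
  assumes "lorentzian_form h"
  shows "invertible h"
proof -
  obtain E :: "real^'m^'m" and t
    where E: "transpose E ** h ** E = (\<chi> i j. if i = j then (if i = t then - 1 else 1) else 0)"
    using assms by (auto simp: lorentzian_form_def)
  have "det (transpose E ** h ** E) = (\<Prod>i\<in>UNIV. if i = t then - 1 else 1)"
    unfolding E by (subst det_diagonal) auto
  then have "det (transpose E ** h ** E) \<noteq> 0" by simp
  then show ?thesis by (simp add: det_mul invertible_det_nz)
qed

text \<open>In diagonalising coordinates orthogonality equates the product of the time components
  with the spatial inner product. Cauchy-Schwarz and the dominance of the time component of
  \<open>v\<close> then bound the time component of \<open>w\<close>.\<close>

lemma lorentzian_orthogonal_timelike:
  fixes h :: "real^'m::finite^'m"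
  assumes "lorentzian_form h" and v: "bil h v v < 0" and vw: "bil h v w = 0"
  shows "bil h w w \<ge> 0"
proof -
  obtain E :: "real^'m^'m" and t
    where E: "transpose E ** h ** E = (\<chi> i j. if i = j then (if i = t then - 1 else 1) else 0)"
    using assms by (auto simp: lorentzian_form_def)
  have "det (transpose E ** h ** E) = (\<Prod>i\<in>UNIV. if i = t then - 1 else 1)"
    unfolding E by (subst det_diagonal) auto
  then have "det (transpose E ** h ** E) \<noteq> 0" by simp
  then have "invertible E" by (simp add: det_mul invertible_det_nz)
  then have inv: "x = E *v (matrix_inv E *v x)" for x
    by (simp add: matrix_vector_mul_assoc matrix_inv_inverse)
  define x y where "x = matrix_inv E *v v" and "y = matrix_inv E *v w"
  have b: "bil h (E *v a) (E *v b) = (\<Sum>i\<in>UNIV - {t}. a $ i * b $ i) - a $ t * b $ t" for a b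
  proof -
    have "bil h (E *v a) (E *v b) = (\<Sum>i\<in>UNIV. (if i = t then - 1 else 1) * a $ i * b $ i)"
      unfolding bil_congruence E unfolding bil_def
      by (simp add: if_distrib[of "\<lambda>x. x * _"] cong: if_cong)
    then show ?thesis by (simp add: sum.remove[of UNIV t])
  qed
  let ?xx = "\<Sum>i\<in>UNIV - {t}. (x $ i)\<^sup>2" and ?yy = "\<Sum>i\<in>UNIV - {t}. (y $ i)\<^sup>2"
    and ?xy = "\<Sum>i\<in>UNIV - {t}. x $ i * y $ i"
  have 1: "?xx < (x $ t)\<^sup>2" and 2: "?xy = x $ t * y $ t" and 3: "bil h w w = ?yy - (y $ t)\<^sup>2"
    using v vw b[of x x] b[of x y] b[of y y] inv[of v] inv[of w]
    by (simp_all add: x_def[symmetric] y_def[symmetric] power2_eq_square)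
  have "(x $ t)\<^sup>2 * (y $ t)\<^sup>2 \<le> ?xx * ?yy"
    using Cauchy_Schwarz_ineq_sum[of "\<lambda>i. x $ i" "\<lambda>i. y $ i" "UNIV - {t}"]
    by (simp add: 2 power_mult_distrib)
  also have "\<dots> \<le> (x $ t)\<^sup>2 * ?yy"
    using 1 by (intro mult_right_mono sum_nonneg) auto
  finally have "(x $ t)\<^sup>2 * (y $ t)\<^sup>2 \<le> (x $ t)\<^sup>2 * ?yy" .
  moreover have "(x $ t)\<^sup>2 > 0" using 1 by (meson le_less_trans sum_nonneg zero_le_power2)
  ultimately have "(y $ t)\<^sup>2 \<le> ?yy" by (meson mult_le_cancel_left_pos)
  then show ?thesis using 3 by simp
qed

text \<open>The factor \<open>r\<close> makes j - r n orthogonal to the time direction, so this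
  vector cannot be timelike. If g(j,n) were nonnegative, its square would be negative thanks to the
  term r^2 g(n,n). Strictness therefore also holds for null \<open>j\<close>.\<close>

lemma future_causal_timelike_neg:
  fixes h :: "real^'m::finite^'m"
  assumes L: "lorentzian_form h" and t: "bil h t t < 0"
    and n: "bil h n n < 0" "bil h n t < 0" and j: "bil h j j \<le> 0" "bil h j t < 0"
  shows "bil h j n < 0"
proof (rule ccontr)
  assume "\<not> bil h j n < 0"
  have sym: "transpose h = h" using L by (simp add: lorentzian_form_def)
  define r where "r = bil h j t / bil h n t"
  have r: "r > 0" using n j by (simp add: r_def divide_neg_neg)
  let ?w = "j - r *\<^sub>R n"
  have "bil h t ?w = 0"
    using n by (simp add: bil_algebra bil_sym[OF sym, of t] r_def)
  then have "bil h ?w ?w \<ge> 0" by (rule lorentzian_orthogonal_timelike[OF L t])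
  moreover have "bil h ?w ?w = bil h j j - 2 * r * bil h j n + r\<^sup>2 * bil h n n"
    by (simp add: bil_algebra bil_sym[OF sym, of n j] power2_eq_square algebra_simps)
  moreover have "2 * r * bil h j n \<ge> 0" using r \<open>\<not> bil h j n < 0\<close> by simp
  moreover have "r\<^sup>2 * bil h n n < 0" using r n(1) by (simp add: mult_pos_neg)
  ultimately show False using j(1) by linarith
qed

section \<open>The maximum principle on a slice\<close>

lemma has_derivative_along_chart_line:
  fixes g :: "'a \<Rightarrow> real"
  assumes d: "quadrant_chart d" and int: "z + t *\<^sub>R v \<in> interior (cimg d)"
    and g: "\<And>x. x \<in> cdom d \<Longrightarrow> cdiff d g x"
  shows "DERIV (\<lambda>t. g (cinv d (z + t *\<^sub>R v))) t :> (\<Sum>i\<in>UNIV. v $ i * cpd d i g (cinv d (z + t *\<^sub>R v)))"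
proof -
  let ?y = "z + t *\<^sub>R v" and ?p = "cinv d (z + t *\<^sub>R v)"
  have y: "?y \<in> cimg d" using int interior_subset by blast
  have p: "?p \<in> cdom d" by (rule cinv_cdom[OF y])
  obtain f' where f': "has_cder d g f' ?p" using g[OF p] by (auto simp: cdiff_iff)
  then have "(g \<circ> cinv d has_derivative f') (at ?y)"
    by (simp add: has_cder_def cmap_cinv[OF y] at_within_interior[OF int])
  moreover have "((\<lambda>t. z + t *\<^sub>R v) has_derivative (\<lambda>h. h *\<^sub>R v)) (at t)"
    by (auto intro!: derivative_eq_intros)
  ultimately have "((\<lambda>t. (g \<circ> cinv d) (z + t *\<^sub>R v)) has_derivative (\<lambda>h. f' (h *\<^sub>R v))) (at t)"
    using diff_chain_at[of "\<lambda>t. z + t *\<^sub>R v" "\<lambda>h. h *\<^sub>R v" t "g \<circ> cinv d" f'] by (simp add: o_def)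
  moreover have "f' (h *\<^sub>R v) = h * f' v" for h
    using f' by (simp add: has_cder_def linear_scale[OF has_derivative_linear])
  ultimately show ?thesis
    using has_cder_expand[OF f' d p, of v]
    by (intro has_derivative_imp_has_field_derivative) (auto simp: o_def)
qed

text \<open>Restriction to lines through the maximum; \<psi> is the derivative of \<phi>. If the
  second derivative at 0 were positive, \<psi> would be positive just after 0, and the mean value
  theorem would give a value above the maximum.\<close>

lemma interior_maximum_second_derivative:
  fixes N :: "'a \<Rightarrow> real"
  assumes d: "quadrant_chart d" and p: "p \<in> cdom d" and int: "cmap d p \<in> interior (cimg d)"
    and N: "csmooth d N" and max: "\<And>x. x \<in> cdom d \<Longrightarrow> N x \<le> N p"
  shows "cpd d i N p = 0"
    and "(\<Sum>i\<in>UNIV. \<Sum>j\<in>UNIV. cpd d i (cpd d j N) p * v $ i * v $ j) \<le> 0"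
proof -
  let ?z = "cmap d p"
  define \<phi> where "\<phi> v t = N (cinv d (?z + t *\<^sub>R v))" for v t
  define \<psi> where "\<psi> v t = (\<Sum>i\<in>UNIV. v $ i * cpd d i N (cinv d (?z + t *\<^sub>R v)))" for v t
  have z: "cinv d ?z = p" by (rule cinv_cmap[OF d p])
  have nbhd: "\<exists>\<delta>>0. \<forall>t. \<bar>t\<bar> < \<delta> \<longrightarrow> ?z + t *\<^sub>R v \<in> interior (cimg d)" for v
  proof -
    obtain e where e: "e > 0" "ball ?z e \<subseteq> interior (cimg d)"
      using int open_contains_ball[of "interior (cimg d)"] by auto
    have "?z + t *\<^sub>R v \<in> interior (cimg d)" if "\<bar>t\<bar> < e / (norm v + 1)" for t
    proof -
      have "\<bar>t\<bar> * norm v \<le> \<bar>t\<bar> * (norm v + 1)" by (intro mult_left_mono) auto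
      also have "\<dots> < e" using that by (simp add: pos_less_divide_eq add_nonneg_pos)
      finally show ?thesis using e(2) by (intro subsetD[OF e(2)]) (simp add: dist_norm)
    qed
    then show ?thesis using e(1) by (intro exI[of _ "e / (norm v + 1)"]) (simp add: add_nonneg_pos)
  qed
  have d1: "DERIV (\<phi> v) t :> \<psi> v t" if "?z + t *\<^sub>R v \<in> interior (cimg d)" for v t
    unfolding \<phi>_def \<psi>_def by (rule has_derivative_along_chart_line[OF d that csmooth_cdiff[OF N]])
  have max': "\<phi> v t \<le> \<phi> v 0" if "?z + t *\<^sub>R v \<in> interior (cimg d)" for v t
    using that interior_subset[of "cimg d"] by (auto simp: \<phi>_def z intro!: max cinv_cdom)
  have \<psi>0: "\<psi> v 0 = 0" for v
  proof -
    obtain \<delta> where \<delta>: "\<delta> > 0" "\<And>t. \<bar>t\<bar> < \<delta> \<Longrightarrow> ?z + t *\<^sub>R v \<in> interior (cimg d)" using nbhd by blast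
    show ?thesis
      by (rule DERIV_local_max[OF d1 \<delta>(1)]) (use \<delta> max' int in auto)
  qed
  show "cpd d i N p = 0" for i
    using \<psi>0[of "axis i 1"] by (simp add: \<psi>_def z axis_def if_distrib[of "\<lambda>x. x * _"] cong: if_cong)
  have d2: "DERIV (\<psi> v) 0 :> (\<Sum>i\<in>UNIV. v $ i * (\<Sum>j\<in>UNIV. v $ j * cpd d j (cpd d i N) p))"
    unfolding \<psi>_def
  proof (intro DERIV_sum DERIV_cmult)
    fix i
    show "DERIV (\<lambda>t. cpd d i N (cinv d (?z + t *\<^sub>R v))) 0 :> (\<Sum>j\<in>UNIV. v $ j * cpd d j (cpd d i N) p)"
      using has_derivative_along_chart_line[OF d, of ?z 0 v "cpd d i N"] int csmooth_cdiff[OF csmooth_cpd[OF N]]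
      by (simp add: z)
  qed
  obtain \<delta> where \<delta>: "\<delta> > 0" "\<And>t. \<bar>t\<bar> < \<delta> \<Longrightarrow> ?z + t *\<^sub>R v \<in> interior (cimg d)" using nbhd by blast
  have "\<not> (\<Sum>i\<in>UNIV. v $ i * (\<Sum>j\<in>UNIV. v $ j * cpd d j (cpd d i N) p)) > 0"
  proof
    assume "(\<Sum>i\<in>UNIV. v $ i * (\<Sum>j\<in>UNIV. v $ j * cpd d j (cpd d i N) p)) > 0"
    from DERIV_pos_inc_right[OF d2 this] obtain \<epsilon>
      where \<epsilon>: "\<epsilon> > 0" "\<And>t. 0 < t \<Longrightarrow> t < \<epsilon> \<Longrightarrow> \<psi> v t > 0" by (auto simp: \<psi>0)
    define t where "t = min \<delta> \<epsilon> / 2"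
    have t: "0 < t" "t < \<delta>" "t < \<epsilon>" using \<delta>(1) \<epsilon>(1) by (auto simp: t_def)
    have "\<exists>s. 0 < s \<and> s < t \<and> \<phi> v t - \<phi> v 0 = (t - 0) * \<psi> v s"
      by (rule MVT2[OF t(1)]) (use \<delta> t in \<open>auto intro!: d1\<close>)
    then obtain s where s: "0 < s" "s < t" "\<phi> v t - \<phi> v 0 = t * \<psi> v s" by auto
    then have "\<phi> v t - \<phi> v 0 > 0" using \<epsilon>(2)[of s] t by auto
    then show False using max'[of t v] \<delta>(2)[of t] t by auto
  qed
  then show "(\<Sum>i\<in>UNIV. \<Sum>j\<in>UNIV. cpd d i (cpd d j N) p * v $ i * v $ j) \<le> 0"
    by (subst sum.swap) (simp add: sum_distrib_left mult_ac not_less)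
qed

text \<open>The first derivatives vanish at the maximum, so the Christoffel terms disappear and the
  covariant Hessian is the matrix of second partial derivatives.\<close>

lemma laplacian_nonpos_at_maximum:
  fixes N :: "'a \<Rightarrow> real"
  assumes "quadrant_chart d" "p \<in> cdom d" "cmap d p \<in> interior (cimg d)"
    "csmooth d N" "\<And>x. x \<in> cdom d \<Longrightarrow> N x \<le> N p"
    and sym: "transpose (h p) = h p" and pos: "\<And>v. v \<noteq> 0 \<Longrightarrow> bil (h p) v v > 0"
  shows "laplacian d h N p \<le> 0"
  unfolding laplacian_def
proof (rule pos_def_mtrace_nonpos[OF sym pos])
  fix v
  show "bil (hessian d h N p) v v \<le> 0"
    using interior_maximum_second_derivative[OF assms(1-5)] by (simp add: bil_def hessian_def)
qed auto

section \<open>From charts to the whole slice\<close>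

lemma continuous_on_locally:
  fixes f :: "'a::t2_space \<Rightarrow> 'b::topological_space"
  assumes "\<And>p. p \<in> S \<Longrightarrow> \<exists>C. openin (top_of_set S) C \<and> p \<in> C \<and> continuous_on C f"
  shows "continuous_on S f"
  unfolding continuous_on_eq_continuous_within
proof
  fix p assume "p \<in> S"
  then obtain C where C: "openin (top_of_set S) C" "p \<in> C" "continuous_on C f" using assms by blast
  obtain U where U: "open U" "C = S \<inter> U" using C(1) by (auto simp: openin_open)
  have "at p within C = at p within S"
    by (rule at_within_nhd[of p U]) (use C U in auto)
  then show "continuous (at p within S) f"
    using C(2,3) by (metis continuous_on_eq_continuous_within continuous_within)
qed

lemma csmooth_linear:
  assumes "quadrant_chart c" "bounded_linear L" "csmooth c f"
  shows "csmooth c (\<lambda>x. L (f x))"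
  using Ck_on_bounded_linear[OF _ assms(2), of "cimg c" _ "f \<circ> cinv c"] assms
  by (simp add: csmooth_def smooth_on_def quadrant_chart_def o_def)

lemma laplacian_uminus:
  assumes d: "quadrant_chart d" and p: "p \<in> cdom d" and N: "csmooth d N"
  shows "laplacian d h (\<lambda>x. - N x) p = - laplacian d h N p"
proof -
  have L: "bounded_linear (\<lambda>x :: real. - x)" by (rule bounded_linear_minus[OF bounded_linear_ident])
  have 1: "cpd d j (\<lambda>x. - N x) x = - cpd d j N x" if "x \<in> cdom d" for j x
    by (rule cpd_linear[OF L d that csmooth_cdiff[OF N that]])
  have "cpd d i (cpd d j (\<lambda>x. - N x)) p = cpd d i (\<lambda>x. - cpd d j N x) p" for i j
    by (rule cpd_cong[OF p 1])
  also have "cpd d i (\<lambda>x. - cpd d j N x) p = - cpd d i (cpd d j N) p" for i j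
    by (rule cpd_linear[OF L d p csmooth_cdiff[OF csmooth_cpd[OF N] p]])
  finally have "hessian d h (\<lambda>x. - N x) p = - hessian d h N p"
    by (simp add: hessian_def vec_eq_iff 1[OF p] sum_negf)
  then show ?thesis by (simp add: laplacian_def mtrace_inner)
qed

text \<open>\<open>N\<close> is a function on all of spacetime and arbitrary off the slice, so only
  its vanishing on the chart domain is available.\<close>

lemma laplacian_zero:
  fixes N :: "'a \<Rightarrow> real"
  assumes d: "quadrant_chart d" and p: "p \<in> cdom d" and N: "\<And>x. x \<in> cdom d \<Longrightarrow> N x = 0"
  shows "laplacian d h N p = 0"
proof -
  have 0: "cpd d i f x = 0" if "x \<in> cdom d" "\<And>x. x \<in> cdom d \<Longrightarrow> f x = 0" for i x and f :: "'a \<Rightarrow> real"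
  proof -
    have "cpd d i f x = cpd d i (\<lambda>x. 0 :: real) x" by (rule cpd_cong[OF that])
    then show ?thesis by (simp add: cpd_const[OF d that(1)])
  qed
  have 1: "cpd d j N x = 0" if "x \<in> cdom d" for j x by (rule 0[OF that N])
  then have "cpd d i (cpd d j N) p = 0" for i j by (rule 0[OF p])
  then have "hessian d h N p = 0" by (simp add: hessian_def vec_eq_iff 1[OF p])
  then show ?thesis by (simp add: laplacian_def mtrace_inner)
qed

lemma slice_chart_facts:
  assumes M: "lorentzian_spacetime M" and \<sigma>: "spatial_slice M \<sigma> E" and e: "(c, d) \<in> E"
  shows "c \<in> atlas M" "quadrant_chart c" "quadrant_chart d" "cdom d \<subseteq> cdom c" "cdom d \<subseteq> \<sigma>"
    "csmooth d (cmap c)" "csmooth c (metric M c)"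
    "\<And>x. x \<in> cdom c \<Longrightarrow> lorentzian_form (metric M c x)"
    "openin (top_of_set \<sigma>) (cdom d)" "continuous_on (cdom d) (cmap d)"
    "\<exists>i. openin (top_of_set {z. 0 \<le> z $ i}) (cimg d)"
proof -
  have E: "(c, d) \<in> slice_charts M \<sigma>" using \<sigma> e by (simp add: spatial_slice_def)
  then show c: "c \<in> atlas M" and "cdom d \<subseteq> cdom c" "csmooth d (cmap c)"
    "openin (top_of_set \<sigma>) (cdom d)" "continuous_on (cdom d) (cmap d)"
    "\<exists>i. openin (top_of_set {z. 0 \<le> z $ i}) (cimg d)"
    by (auto simp: slice_charts_def homeomorphism_def)
  then show "cdom d \<subseteq> \<sigma>" by (auto simp: openin_open)
  have inj: "inj_on (cmap c) (cdom c)" if "homeomorphism (cdom c) (cimg c) (cmap c) (cinv c)"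
    for c :: "('a, 'k::finite) chart"
    using that by (auto simp: homeomorphism_def intro!: inj_on_inverseI[of _ "cinv c"])
  show "quadrant_chart d"
    using E inj[of d] quadrant_open_halfspace by (auto simp: slice_charts_def quadrant_chart_def)
  show "quadrant_chart c"
    using M c inj[of c] quadrant_open_open[of "cimg c"]
    by (auto simp: lorentzian_spacetime_def smooth_atlas_def quadrant_chart_def)
  show "csmooth c (metric M c)" "\<And>x. x \<in> cdom c \<Longrightarrow> lorentzian_form (metric M c x)"
    using M c unfolding lorentzian_spacetime_def by blast+
qed

lemma induced_metric_pos_def:
  assumes M: "lorentzian_spacetime M" and \<sigma>: "spatial_slice M \<sigma> E" and e: "e \<in> E" and p: "p \<in> sdom e"
  shows "transpose (induced_metric M e p) = induced_metric M e p"
    and "v \<noteq> 0 \<Longrightarrow> bil (induced_metric M e p) v v > 0"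
proof -
  obtain c d where [simp]: "e = (c, d)" by (cases e)
  have "transpose (metric M c p) = metric M c p"
    using slice_chart_facts[OF M \<sigma>, of c d] e p by (auto simp: lorentzian_form_def)
  then show "transpose (induced_metric M e p) = induced_metric M e p"
    using bil_sym[of "metric M c p"] by (simp only: induced_metric_def transpose_def vec_eq_iff) simp
  show "v \<noteq> 0 \<Longrightarrow> bil (induced_metric M e p) v v > 0"
    using \<sigma> e p unfolding spatial_slice_def by blast
qed

lemma weak_maximum_principle:
  fixes N :: "'a::{t2_space,second_countable_topology} \<Rightarrow> real" and M :: "('a, 'm::finite) spacetime"
  assumes M: "lorentzian_spacetime M" and \<sigma>: "compact \<sigma>" "spatial_slice M \<sigma> E"
    and N: "\<And>e. e \<in> E \<Longrightarrow> csmooth (snd e) N" and bd: "\<And>p. p \<in> slice_boundary E \<Longrightarrow> N p = 0"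
    and eq: "\<And>e p. e \<in> E \<Longrightarrow> p \<in> sdom e \<Longrightarrow> laplacian (snd e) (induced_metric M e) N p = V e p * N p"
    and V: "\<And>e p. e \<in> E \<Longrightarrow> p \<in> sdom e \<Longrightarrow> V e p > 0"
    and p0: "p0 \<in> \<sigma>"
  shows "N p0 \<le> 0"
proof (rule ccontr)
  assume "\<not> N p0 \<le> 0"
  have cover: "\<exists>c d. (c, d) \<in> E \<and> p \<in> cdom d" if "p \<in> \<sigma>" for p
  proof -
    have "(\<Union>e\<in>E. sdom e) = \<sigma>" using \<sigma>(2) unfolding spatial_slice_def by blast
    with \<open>p \<in> \<sigma>\<close> obtain e where "e \<in> E" "p \<in> sdom e" by blast
    then show ?thesis by (cases e) auto
  qed
  have "continuous_on \<sigma> N"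
  proof (rule continuous_on_locally)
    fix p assume "p \<in> \<sigma>"
    then obtain c d where e: "(c, d) \<in> E" "p \<in> cdom d" using cover by blast
    note facts = slice_chart_facts[OF M \<sigma>(2) e(1)]
    have "Ck_on 0 (cimg d) (N \<circ> cinv d)"
      using N[OF e(1)] unfolding csmooth_def smooth_on_def by simp
    then have "continuous_on (cmap d ` cdom d) (N \<circ> cinv d)" by (simp add: cimg_def)
    then have "continuous_on (cdom d) ((N \<circ> cinv d) \<circ> cmap d)"
      by (rule continuous_on_compose[OF facts(10)])
    then have "continuous_on (cdom d) N"
      by (subst (asm) continuous_on_cong[OF refl, of _ _ N]) (simp_all add: cinv_cmap[OF facts(3)])
    then show "\<exists>C. openin (top_of_set \<sigma>) C \<and> p \<in> C \<and> continuous_on C N"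
      using e(2) facts(9) by blast
  qed
  then obtain p where p: "p \<in> \<sigma>" and max: "\<And>x. x \<in> \<sigma> \<Longrightarrow> N x \<le> N p"
    using continuous_attains_sup[OF \<sigma>(1)] p0 by blast
  then have pos: "N p > 0" using \<open>\<not> N p0 \<le> 0\<close> p0 by (metis less_le_trans not_le)
  obtain c d where e: "(c, d) \<in> E" "p \<in> cdom d" using cover p by blast
  note facts = slice_chart_facts[OF M \<sigma>(2) e(1)]
  obtain i where i: "openin (top_of_set {z. 0 \<le> z $ i}) (cimg d)" using facts(11) by blast
  \<comment> \<open>Boundary points are those with vanishing half-space coordinate. A positive value
    thus forces that coordinate to be positive, which puts the point in the interior of the chart
    image, where two-sided derivatives exist.\<close>
  have "p \<notin> slice_boundary E" using bd pos by fastforce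
  then have "cmap d p $ i \<noteq> 0" using e i by (force simp: slice_boundary_def)
  moreover have img: "cmap d p \<in> cimg d" by (rule cmap_cimg[OF e(2)])
  moreover have "cimg d \<subseteq> {z. 0 \<le> z $ i}" using openin_imp_subset[OF i] .
  ultimately have pi: "cmap d p $ i > 0" by force
  obtain U where U: "open U" "cimg d = {z. 0 \<le> z $ i} \<inter> U" using i by (auto simp: openin_open)
  have "open {z :: real^'b. 0 < z $ i}"
    using open_halfspace_component_gt_cart[of 0 i] by simp
  then have "open ({z. 0 < z $ i} \<inter> U)" using U(1) by (rule open_Int)
  moreover have "{z. 0 < z $ i} \<inter> U \<subseteq> cimg d"
  proof
    fix z assume "z \<in> {z. 0 < z $ i} \<inter> U"
    then have "0 \<le> z $ i" "z \<in> U" by simp_all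
    then show "z \<in> cimg d" unfolding U(2) by blast
  qed
  ultimately have "{z. 0 < z $ i} \<inter> U \<subseteq> interior (cimg d)" by (simp only: interior_maximal)
  moreover have "cmap d p \<in> U" using img unfolding U(2) by blast
  ultimately have int: "cmap d p \<in> interior (cimg d)" using pi by blast
  have "laplacian d (induced_metric M (c, d)) N p \<le> 0"
  proof (rule laplacian_nonpos_at_maximum[OF facts(3) e(2) int])
    show "csmooth d N" using N[OF e(1)] by simp
    show "N x \<le> N p" if "x \<in> cdom d" for x using max facts(5) that by blast
    have "p \<in> sdom (c, d)" using e(2) by simp
    note pd = induced_metric_pos_def[OF M \<sigma>(2) e(1) this]
    show "transpose (induced_metric M (c, d) p) = induced_metric M (c, d) p" by (rule pd(1))
    show "bil (induced_metric M (c, d) p) v v > 0" if "v \<noteq> 0" for v by (rule pd(2)[OF that])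
  qed
  moreover have "laplacian d (induced_metric M (c, d)) N p > 0"
    using eq[OF e(1)] V[OF e(1)] e(2) pos by simp
  ultimately show False by simp
qed

lemma trivial_kernel:
  fixes N :: "'a::{t2_space,second_countable_topology} \<Rightarrow> real" and M :: "('a, 'm::finite) spacetime"
  assumes M: "lorentzian_spacetime M" and \<sigma>: "compact \<sigma>" "spatial_slice M \<sigma> E"
    and N: "\<And>e. e \<in> E \<Longrightarrow> csmooth (snd e) N" and bd: "\<And>p. p \<in> slice_boundary E \<Longrightarrow> N p = 0"
    and eq: "\<And>e p. e \<in> E \<Longrightarrow> p \<in> sdom e \<Longrightarrow> laplacian (snd e) (induced_metric M e) N p = V e p * N p"
    and V: "\<And>e p. e \<in> E \<Longrightarrow> p \<in> sdom e \<Longrightarrow> V e p > 0"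
    and p: "p \<in> \<sigma>"
  shows "N p = 0"
proof -
  have qc: "quadrant_chart (snd e)" if "e \<in> E" for e
    using slice_chart_facts(3)[OF M \<sigma>(2)] that by (metis prod.collapse)
  have "N p \<le> 0" by (rule weak_maximum_principle[OF assms])
  moreover have "- N p \<le> 0"
  proof (rule weak_maximum_principle[OF M \<sigma> _ _ _ V p])
    show "csmooth (snd e) (\<lambda>x. - N x)" if "e \<in> E" for e
      by (rule csmooth_linear[OF qc[OF that] bounded_linear_minus[OF bounded_linear_ident] N[OF that]])
  qed (simp_all add: bd eq laplacian_uminus qc N)
  ultimately show ?thesis by simp
qed

section \<open>Positivity of the potential\<close>

text \<open>The coefficient \<open>y\<close> stands for the contribution of the normal derivative of
  \<Phi>. It is pure trace, so it disappears from the trace-free momentum, which is \<open>x\<close>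
  times the trace-free extrinsic curvature. The prefactor of the potential is exactly 1/2 divided by
  the square of \<open>x\<close>.\<close>

lemma gauge_potential_momentum:
  fixes q K P :: "real^'n::finite^'n"
  assumes sym: "transpose q = q" and pos: "\<And>v. v \<noteq> 0 \<Longrightarrow> bil q v v > 0"
    and \<kappa>: "\<kappa> \<noteq> 0" and a: "coupling \<alpha> \<phi> \<noteq> 0"
    and P: "P = (1 / \<kappa> * coupling \<alpha> \<phi> * sqrt (det q)) *\<^sub>R (raise2 q K - mtrace q K *\<^sub>R matrix_inv q)
      + y *\<^sub>R matrix_inv q"
  shows "up_trace q P = 1 / \<kappa> * coupling \<alpha> \<phi> * sqrt (det q) * (1 - real CARD('n)) * mtrace q K
      + y * real CARD('n)" (is ?tr)
    and "gauge_potential \<kappa> \<alpha> wg \<delta> q P \<phi> R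
      = (raise2 q K \<bullet> K - (mtrace q K)\<^sup>2 / real CARD('n)) / 2 + R / 2
        + \<delta>\<^sup>2 * (\<kappa>\<^sup>2 * (real CARD('n) + 1) / (2 * wg\<^sup>2 * real CARD('n) * (real CARD('n) - 1)\<^sup>2))" (is ?gp)
    and "(mtrace q K)\<^sup>2 / real CARD('n) \<le> raise2 q K \<bullet> K" (is ?nn)
proof -
  define Q where "Q = matrix_inv q"
  define t where "t = mtrace q K"
  define D where "D = real CARD('n)"
  define x where "x = 1 / \<kappa> * coupling \<alpha> \<phi> * sqrt (det q)"
  define S where "S = raise2 q K - (t / D) *\<^sub>R Q"
  have D: "D > 0" by (simp add: D_def)
  have det: "det q > 0" by (rule pos_def_det[OF sym pos])
  then have inv: "invertible q" by (simp add: invertible_det_nz)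
  have qQ: "q ** Q = mat 1" "Q ** q = mat 1" using matrix_inv_inverse[OF inv] by (simp_all add: Q_def)
  have Qs: "transpose Q = Q"
  proof -
    have "transpose Q ** q = mat 1" using qQ(1) sym by (metis matrix_transpose_mul transpose_mat)
    then have "transpose Q ** (q ** Q) = Q" by (simp add: matrix_mul_assoc)
    then show ?thesis by (simp add: qQ)
  qed
  have r: "raise2 q K = Q ** K ** Q" by (simp add: raise2_eq Q_def[symmetric] Qs)
  have t: "Q \<bullet> K = t" by (simp add: t_def mtrace_inner Q_def)
  have q_Q: "q \<bullet> Q = D"
  proof -
    have "q \<bullet> Q = (mat 1 :: real^'n^'n) \<bullet> mat 1"
      using inner_matrix_mult_right[of q "mat 1" Q] by (simp add: Qs qQ)
    then show ?thesis
      by (simp add: inner_vec_def mat_def D_def if_distrib[of "\<lambda>x. x * _"] cong: if_cong)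
  qed
  have q_r: "q \<bullet> raise2 q K = t"
  proof -
    have "q \<bullet> raise2 q K = mat 1 \<bullet> (Q ** K)"
      using inner_matrix_mult_right[of q "Q ** K" Q] by (simp add: r Qs qQ)
    also have "\<dots> = Q \<bullet> K"
      using inner_matrix_mult_left[of "mat 1" Q K] by (simp add: Qs)
    finally show ?thesis by (simp add: t)
  qed
  have P': "P = x *\<^sub>R (raise2 q K - t *\<^sub>R Q) + y *\<^sub>R Q" by (simp add: P x_def t_def Q_def)
  have tr: "up_trace q P = x * (1 - D) * t + y * D"
    by (simp add: up_trace_inner P' inner_add_right inner_diff_right q_r q_Q algebra_simps)
  then show ?tr by (simp add: x_def D_def t_def)
  have tf: "trace_free q P = x *\<^sub>R S"
  proof -
    have "trace_free q P = x *\<^sub>R raise2 q K + (y - x * t - up_trace q P / D) *\<^sub>R Q"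
      by (simp add: trace_free_def P' Q_def[symmetric] D_def[symmetric] algebra_simps)
    also have "y - x * t - up_trace q P / D = - (x * (t / D))"
      using D by (simp add: tr field_simps)
    finally show ?thesis by (simp add: S_def algebra_simps)
  qed
  have lS: "lower2 q S = K - (t / D) *\<^sub>R q"
  proof -
    have "lower2 q S = q ** (Q ** K ** Q) ** q - (t / D) *\<^sub>R (q ** Q ** q)"
      by (simp add: lower2_eq S_def r sym matrix_mult_diff_left matrix_mult_diff_right
          matrix_mult_scaleR_left matrix_mult_scaleR_right)
    also have "q ** (Q ** K ** Q) ** q = (q ** Q) ** K ** (Q ** q)" by (simp add: matrix_mul_assoc)
    finally show ?thesis by (simp add: qQ)
  qed
  have SS: "S \<bullet> lower2 q S = raise2 q K \<bullet> K - t\<^sup>2 / D"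
  proof -
    have "S \<bullet> lower2 q S = raise2 q K \<bullet> K - (t / D) * (q \<bullet> raise2 q K) - (t / D) * (Q \<bullet> K)
        + (t / D) * (t / D) * (q \<bullet> Q)"
      unfolding lS unfolding S_def
      by (simp add: inner_diff_left inner_diff_right inner_commute algebra_simps)
    then show ?thesis using D by (simp add: q_r t q_Q power2_eq_square)
  qed
  show ?nn
    using pos_def_lower2_nonneg[OF sym pos, of S] SS by (simp add: t_def D_def)
  have l2: "lower2 q (x *\<^sub>R S) = x *\<^sub>R lower2 q S"
    by (simp add: lower2_eq matrix_mult_scaleR_left matrix_mult_scaleR_right)
  have "\<kappa>\<^sup>2 / (2 * det q * (coupling \<alpha> \<phi>)\<^sup>2) * (\<Sum>a\<in>UNIV. \<Sum>b\<in>UNIV. (x *\<^sub>R S) $ a $ b * lower2 q (x *\<^sub>R S) $ a $ b)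
      = \<kappa>\<^sup>2 / (2 * det q * (coupling \<alpha> \<phi>)\<^sup>2) * (x\<^sup>2 * (S \<bullet> lower2 q S))"
    by (simp add: l2 inner_vec_def sum_distrib_left power2_eq_square mult_ac)
  also have "\<dots> = (S \<bullet> lower2 q S) / 2"
    using det \<kappa> a by (simp add: x_def power_mult_distrib power_divide)
  finally show ?gp
    by (simp add: gauge_potential_def Let_def tf SS t_def D_def)
qed

text \<open>The prescribed \<alpha>, combined with the weight (1 - D)/4, cancels the terms with the
  normal derivative \<nu>. The same weight turns \<open>4 * \<alpha>\<close> into the term that
  removes \<alpha> \<phi>^2 from the coupling, leaving a multiple of the mean curvature
  \<open>k\<close> alone.\<close>

lemma conf_generator_value:
  fixes q K P :: "real^'n::finite^'n" and D :: real
  assumes D: "D = real CARD('n)" "D \<noteq> 0" and nz: "\<kappa> \<noteq> 0" "l \<noteq> 0"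
    and \<alpha>: "\<alpha> = - (\<kappa> * (D - 1)) / (8 * l * D)" and w: "w = (1 - D) / 4 * wg"
    and tr: "up_trace q P = 1 / \<kappa> * coupling \<alpha> \<phi> * s * (1 - D) * k + (2 * \<alpha> / \<kappa> * s * \<phi> * \<nu>) * D"
    and \<pi>: "\<pi> = - (1 / l) * s * \<nu> + 4 * \<alpha> / \<kappa> * s * \<phi> * k"
  shows "conf_generator wg w q P \<phi> \<pi> = - ((D - 1) * wg / \<kappa>) * s * k"
proof -
  have \<alpha>': "2 * \<alpha> / \<kappa> * D = - ((D - 1) / (4 * l))" using D(2) nz by (simp add: \<alpha> field_simps)
  have eq: "(2 * \<alpha> / \<kappa> * s * \<phi> * \<nu>) * D = (2 * \<alpha> / \<kappa> * D) * (s * \<phi> * \<nu>)" by (simp add: mult_ac)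
  have tr': "up_trace q P = 1 / \<kappa> * coupling \<alpha> \<phi> * s * (1 - D) * k - (D - 1) / (4 * l) * (s * \<phi> * \<nu>)"
    unfolding tr eq \<alpha>' by simp
  show ?thesis
    unfolding conf_generator_def tr' \<pi> w coupling_def
    using nz by (simp add: field_simps power2_eq_square)
qed

text \<open>Pairing the energy current with a vector undoes the raised index. With both vectors
  equal to the normal, a negative pairing says that the energy density is positive.\<close>

lemma dominant_energy_density:
  fixes T :: "real^'m::finite^'m"
  assumes L: "lorentzian_form h"
  shows "bil h (\<chi> \<nu>. - (\<Sum>\<mu>\<in>UNIV. \<Sum>\<rho>\<in>UNIV. T $ \<mu> $ \<rho> * matrix_inv h $ \<rho> $ \<nu> * v $ \<mu>)) w = - bil T v w"
proof -
  have "(\<chi> \<nu>. - (\<Sum>\<mu>\<in>UNIV. \<Sum>\<rho>\<in>UNIV. T $ \<mu> $ \<rho> * matrix_inv h $ \<rho> $ \<nu> * v $ \<mu>))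
      = - (transpose (T ** matrix_inv h) *v v)"
    by (simp only: vec_eq_iff matrix_vector_mult_def transpose_def matrix_matrix_mult_def)
      (simp add: sum_distrib_right)
  moreover have "bil h (transpose (T ** matrix_inv h) *v v) w = v \<bullet> (T ** matrix_inv h *v (h *v w))"
    by (metis bil_inner inner_commute inner_vector_matrix_mult transpose_matrix_vector)
  moreover have "T ** matrix_inv h *v (h *v w) = T *v w"
    using matrix_inv_inverse[OF lorentzian_invertible[OF L]]
    by (metis matrix_mul_assoc matrix_mul_rid matrix_vector_mul_assoc)
  ultimately show ?thesis by (simp add: bil_inner)
qed

text \<open>Transfers the constraint from the locale to slice charts: the data of a spatial slice
  satisfy the locale assumptions, and \<open>X.q\<close> and \<open>X.Kmat\<close> are the induced
  metric and the extrinsic curvature.\<close>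

lemma slice_hamiltonian_constraint:
  fixes M :: "('a::{t2_space,second_countable_topology}, 'm::finite) spacetime"
    and E :: "('a, 'm, 'n::finite) schart set"
  assumes dim: "CARD('m) = CARD('n) + 1"
    and M: "lorentzian_spacetime M" and \<sigma>: "spatial_slice M \<sigma> E" and n: "future_unit_normal M E n"
    and e: "e \<in> E" and p: "p \<in> sdom e"
  shows "2 * bil (einstein (fst e) (metric M (fst e)) p) (n (fst e) p) (n (fst e) p)
    = scalar_curv (snd e) (induced_metric M e) p
      + (mtrace (induced_metric M e p) (extrinsic_curv M n e p))\<^sup>2
      - raise2 (induced_metric M e p) (extrinsic_curv M n e p) \<bullet> extrinsic_curv M n e p"
proof -
  obtain c d where [simp]: "e = (c, d)" by (cases e)
  have cd: "(c, d) \<in> E" using e by simp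
  note facts = slice_chart_facts[OF M \<sigma> cd]
  have nn: "csmooth d (n c)" "\<And>x. x \<in> cdom d \<Longrightarrow> bil (metric M c x) (n c x) (n c x) = - 1"
    "\<And>x a. x \<in> cdom d \<Longrightarrow> bil (metric M c x) (n c x) (tangent (c, d) a x) = 0"
    using n cd unfolding future_unit_normal_def by force+
  interpret X: embedded_chart c "metric M c" d "n c"
  proof
    show "transpose (metric M c x) = metric M c x" if "x \<in> cdom c" for x
      using facts(8)[OF that] by (simp add: lorentzian_form_def)
    show "invertible (metric M c x)" if "x \<in> cdom c" for x
      by (rule lorentzian_invertible[OF facts(8)[OF that]])
    show "invertible (\<chi> a b. bil (metric M c x) (cpd d a (cmap c) x) (cpd d b (cmap c) x))"
      if "x \<in> cdom d" for x
    proof -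
      have "det (induced_metric M e x) > 0"
        using induced_metric_pos_def[OF M \<sigma> e] that by (intro pos_def_det) auto
      then show ?thesis by (simp add: invertible_det_nz induced_metric_def tangent_def)
    qed
    show "bil (metric M c x) (n c x) (cpd d a (cmap c) x) = 0" if "x \<in> cdom d" for x a
      using nn(3)[OF that] by (simp add: tangent_def)
    show "cdiff c (metric M c) x" if "x \<in> cdom c" for x
      by (rule csmooth_cdiff[OF facts(7) that])
    show "cdiff c (cpd c i (metric M c)) x" if "x \<in> cdom c" for x i
      by (rule csmooth_cdiff[OF csmooth_cpd[OF facts(7)] that])
    show "cpd c i (cpd c j (metric M c)) x = cpd c j (cpd c i (metric M c)) x" if "x \<in> cdom c" for x i j
      by (rule csmooth_cpd_commute[OF facts(2) that facts(7)])
    show "cdiff d (n c) x" if "x \<in> cdom d" for x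
      by (rule csmooth_cdiff[OF nn(1) that])
  qed (fact facts dim nn)+
  have q: "X.q = induced_metric M e"
    by (simp add: fun_eq_iff X.q_def X.T_def induced_metric_def tangent_def bil_inner)
  have K: "X.Kmat p = extrinsic_curv M n e p"
  proof -
    have "X.A a p *v w = (\<chi> \<mu>. \<Sum>\<nu>\<in>UNIV. \<Sum>\<rho>\<in>UNIV. christoffel c (metric M c) \<mu> \<nu> \<rho> p
        * tangent e a p $ \<nu> * w $ \<rho>)" for a w
      unfolding X.A_def conn_def
      by (simp add: vec_eq_iff matrix_vector_mult_def X.T_def tangent_def sum_distrib_left sum_distrib_right mult_ac)
        (intro allI sum.swap)
    then show ?thesis
      by (simp add: X.Kmat_def extrinsic_curv_def X.K_def X.nab_def bil_inner X.T_def tangent_def)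
  qed
  show ?thesis using X.hamiltonian_constraint[of p] p by (simp add: q K)
qed

lemma gauge_potential_pos:
  fixes M :: "('a::{t2_space,second_countable_topology}, 'm::finite) spacetime"
    and E :: "('a, 'm, 'n::finite) schart set" and \<delta> :: real
  defines "D \<equiv> real CARD('n)"
  assumes dim: "CARD('n) \<ge> 2" "CARD('m) = CARD('n) + 1"
    and constants: "\<kappa> > 0" "l \<noteq> 0" "wg \<noteq> 0" "\<alpha> = - (\<kappa> * (D - 1)) / (8 * l * D)" "w\<Phi> = (1 - D) / 4 * wg"
    and M: "lorentzian_spacetime M" and field_eqs: "conformal_scalar_solution \<kappa> l \<alpha> M \<Phi>"
    and \<sigma>: "spatial_slice M \<sigma> E" and n: "future_unit_normal M E n"
    and e: "e \<in> E" and p: "p \<in> sdom e" and a: "coupling \<alpha> (\<Phi> p) \<noteq> 0"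
    and gauge: "conf_generator wg w\<Phi> (induced_metric M e p) (momentum_metric \<kappa> \<alpha> M n \<Phi> e p) (\<Phi> p)
      (momentum_scalar \<kappa> l \<alpha> M n \<Phi> e p) - sqrt (det (induced_metric M e p)) * \<delta> = 0"
    and weak: "\<delta> \<noteq> 0 \<Longrightarrow> weak_energy_condition_at M (energy_momentum \<kappa> l \<alpha> M \<Phi>) p"
    and dominant: "\<delta> = 0 \<Longrightarrow> dominant_energy_condition_at M (energy_momentum \<kappa> l \<alpha> M \<Phi>) p"
  shows "gauge_potential \<kappa> \<alpha> wg \<delta> (induced_metric M e p) (momentum_metric \<kappa> \<alpha> M n \<Phi> e p) (\<Phi> p)
    (scalar_curv (snd e) (induced_metric M e) p) > 0"
proof -
  obtain c d where ecd: "e = (c, d)" by (cases e)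
  have cd: "(c, d) \<in> E" and pd: "p \<in> cdom d" using e p by (simp_all add: ecd)
  note facts = slice_chart_facts[OF M \<sigma> cd]
  have pc: "p \<in> cdom c" using pd facts(4) by blast
  define q where "q = induced_metric M e p"
  define K where "K = extrinsic_curv M n e p"
  define k where "k = mtrace q K"
  define s where "s = sqrt (det q)"
  define T where "T = energy_momentum \<kappa> l \<alpha> M \<Phi> c p"
  define N where "N = n c p"
  define R where "R = scalar_curv (snd e) (induced_metric M e) p"
  have D: "D > 1" using dim by (simp add: D_def)
  have sym: "transpose q = q" and pos: "\<And>v. v \<noteq> 0 \<Longrightarrow> bil q v v > 0"
    using induced_metric_pos_def[OF M \<sigma> e p] by (simp_all add: q_def)
  have s: "s > 0" using pos_def_det[OF sym pos] by (simp add: s_def)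
  have Pm: "momentum_metric \<kappa> \<alpha> M n \<Phi> e p
    = (1 / \<kappa> * coupling \<alpha> (\<Phi> p) * sqrt (det q)) *\<^sub>R (raise2 q K - mtrace q K *\<^sub>R matrix_inv q)
      + (2 * \<alpha> / \<kappa> * s * \<Phi> p * normal_deriv n \<Phi> e p) *\<^sub>R matrix_inv q"
    by (simp add: momentum_metric_def Let_def q_def K_def s_def)
  have \<kappa>: "\<kappa> \<noteq> 0" using constants by simp
  note mom = gauge_potential_momentum[OF sym pos \<kappa> a Pm, folded D_def k_def]
  have "conf_generator wg w\<Phi> q (momentum_metric \<kappa> \<alpha> M n \<Phi> e p) (\<Phi> p) (momentum_scalar \<kappa> l \<alpha> M n \<Phi> e p)
      = - ((D - 1) * wg / \<kappa>) * s * k"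
  proof (rule conf_generator_value[OF D_def[THEN meta_eq_to_obj_eq] _ \<kappa> constants(2,4,5)])
    show "up_trace q (momentum_metric \<kappa> \<alpha> M n \<Phi> e p) = 1 / \<kappa> * coupling \<alpha> (\<Phi> p) * s * (1 - D) * k
        + (2 * \<alpha> / \<kappa> * s * \<Phi> p * normal_deriv n \<Phi> e p) * D"
      using mom(1) by (simp add: s_def)
    show "momentum_scalar \<kappa> l \<alpha> M n \<Phi> e p
        = - (1 / l) * s * normal_deriv n \<Phi> e p + 4 * \<alpha> / \<kappa> * s * \<Phi> p * k"
      by (simp add: momentum_scalar_def Let_def q_def K_def s_def k_def)
  qed (use D in simp)
  then have "s * (- ((D - 1) * wg / \<kappa>) * k) = s * \<delta>"
    using gauge by (simp add: q_def[symmetric] s_def[symmetric] mult_ac)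
  then have \<delta>: "\<delta> = - ((D - 1) * wg / \<kappa>) * k"
    using s unfolding mult_cancel_left by auto
  have "bil (einstein c (metric M c) p) N N = 8 * pi * bil T N N"
  proof -
    have "einstein c (metric M c) p = (8 * pi) *\<^sub>R T"
      using field_eqs facts(1) pc unfolding conformal_scalar_solution_def T_def by blast
    then show ?thesis by (simp add: bil_inner scaleR_matrix_vector_assoc[symmetric])
  qed
  then have constraint: "16 * pi * bil T N N = R + k\<^sup>2 - raise2 q K \<bullet> K"
    using slice_hamiltonian_constraint[OF dim(2) M \<sigma> n e p]
    by (simp add: ecd q_def K_def k_def R_def N_def)
  have N: "future_timelike M c p N"
    using n cd pd unfolding future_unit_normal_def N_def by force
  \<comment> \<open>For \<delta> = 0 the mean curvature vanishes, so strictness must come from the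
    energy density; this is where the current being future causal, in particular nonzero, enters.
    For nonzero \<delta> the term in \<open>k\<close> is strict and a nonnegative density is
    enough.\<close>
  have density: "8 * pi * bil T N N + k\<^sup>2 / D > 0"
  proof (cases "\<delta> = 0")
    case True
    define j where "j = (\<chi> \<nu>. - (\<Sum>\<mu>\<in>UNIV. \<Sum>\<rho>\<in>UNIV. T $ \<mu> $ \<rho> * matrix_inv (metric M c p) $ \<rho> $ \<nu> * N $ \<mu>))"
    have "future_causal M c p j"
      using dominant[OF True] facts(1) pc N unfolding dominant_energy_condition_at_def j_def T_def by blast
    moreover have "timelike M c p (time_field M c p)"
      using M facts(1) pc unfolding lorentzian_spacetime_def by blast
    ultimately have "bil (metric M c p) j N < 0"
      using N facts(8)[OF pc] future_causal_timelike_neg[of "metric M c p" "time_field M c p" N j]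
      unfolding future_causal_def future_timelike_def timelike_def by blast
    then have "bil T N N > 0" unfolding j_def dominant_energy_density[OF facts(8)[OF pc]] by simp
    then show ?thesis using D by (intro add_pos_nonneg) auto
  next
    case False
    have "bil T N N \<ge> 0"
      using weak[OF False] facts(1) pc N unfolding weak_energy_condition_at_def T_def by blast
    moreover have "k \<noteq> 0" using False \<delta> by auto
    ultimately show ?thesis using D by (intro add_nonneg_pos) auto
  qed
  have "\<delta>\<^sup>2 * (\<kappa>\<^sup>2 * (D + 1) / (2 * wg\<^sup>2 * D * (D - 1)\<^sup>2)) = k\<^sup>2 * (D + 1) / (2 * D)"
    using D \<kappa> constants(3) by (simp add: \<delta> power_mult_distrib power_divide)
  also have "\<dots> = k\<^sup>2 / 2 + k\<^sup>2 / D / 2" using D by (simp add: field_simps)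
  finally have "gauge_potential \<kappa> \<alpha> wg \<delta> q (momentum_metric \<kappa> \<alpha> M n \<Phi> e p) (\<Phi> p) R
      = (raise2 q K \<bullet> K - k\<^sup>2 / D) / 2 + R / 2 + (k\<^sup>2 / 2 + k\<^sup>2 / D / 2)"
    using mom(2)[where wg = wg and \<delta> = \<delta> and R = R] by simp
  \<comment> \<open>The constraint removes R/2; its k^2/2 cancels and its half of the squared
    extrinsic curvature completes the first term. The term \<open>k\<^sup>2 / D\<close> is
    subtracted and added back to separate the trace-free square from the strictly positive
    part.\<close>
  also have "\<dots> = (raise2 q K \<bullet> K - k\<^sup>2 / D) + (8 * pi * bil T N N + k\<^sup>2 / D)"
    using constraint by (simp add: field_simps)
  also have "\<dots> > 0" using mom(3) density by linarith
  finally show ?thesis by (simp add: q_def R_def)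
qed

theorem mainTheorem2:
  fixes M :: "('a::{t2_space,second_countable_topology}, 'm::finite) spacetime"
    and \<Phi> :: "'a \<Rightarrow> real"
    and \<sigma> :: "'a set"
    and E :: "('a, 'm, 'n::finite) schart set"
    and n :: "('a, 'm) chart \<Rightarrow> 'a \<Rightarrow> real^'m"
    and D :: nat
    and \<kappa> l \<alpha> wg w\<Phi> \<delta> :: real
    and q P :: "('a, 'm, 'n) schart \<Rightarrow> 'a \<Rightarrow> real^'n^'n"
    and \<pi>\<Phi> \<P> :: "('a, 'm, 'n) schart \<Rightarrow> 'a \<Rightarrow> real"
  assumes dim: "D \<ge> 2" "CARD('n) = D" "CARD('m) = D + 1"
    and constants: "\<kappa> > 0" "l \<noteq> 0" "wg \<noteq> 0"
      "\<alpha> = - (\<kappa> * (real D - 1)) / (8 * l * real D)"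
      "w\<Phi> = (1 - real D) / 4 * wg"
    and spacetime: "lorentzian_spacetime M" "globally_hyperbolic M"
    and field_eqs: "conformal_scalar_solution \<kappa> l \<alpha> M \<Phi>"
    and slice: "compact \<sigma>" "spatial_slice M \<sigma> E"
    and normal: "future_unit_normal M E n"
    and data: "q = induced_metric M" "P = momentum_metric \<kappa> \<alpha> M n \<Phi>"
      "\<pi>\<Phi> = momentum_scalar \<kappa> l \<alpha> M n \<Phi>"
    and coupling_nz: "\<forall>p\<in>\<sigma>. coupling \<alpha> (\<Phi> p) \<noteq> 0"
    and gauge: "\<forall>e\<in>E. \<forall>p\<in>sdom e.
      conf_generator wg w\<Phi> (q e p) (P e p) (\<Phi> p) (\<pi>\<Phi> e p) - sqrt (det (q e p)) * \<delta> = 0"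
    and weak: "\<delta> \<noteq> 0 \<Longrightarrow>
      \<forall>p\<in>\<sigma>. weak_energy_condition_at M (energy_momentum \<kappa> l \<alpha> M \<Phi>) p"
    and dominant: "\<delta> = 0 \<Longrightarrow>
      \<forall>p\<in>\<sigma>. dominant_energy_condition_at M (energy_momentum \<kappa> l \<alpha> M \<Phi>) p"
    and potential: "\<P> = (\<lambda>e p. gauge_potential \<kappa> \<alpha> wg \<delta> (q e p) (P e p) (\<Phi> p)
      (scalar_curv (snd e) (q e) p))"
  shows "(\<forall>e\<in>E. \<forall>p\<in>sdom e. \<P> e p > 0) \<and>
    (\<forall>N::'a \<Rightarrow> real.
       (\<forall>e\<in>E. csmooth (snd e) N) \<and> (\<forall>p\<in>slice_boundary E. N p = 0) \<longrightarrow>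
       ((\<forall>e\<in>E. \<forall>p\<in>sdom e. laplacian (snd e) (q e) N p - \<P> e p * N p = 0)
          \<longleftrightarrow> (\<forall>p\<in>\<sigma>. N p = 0))) \<and>
    locally_good_gauge_fixing E wg q \<P>"
proof -
  have pos: "\<P> e p > 0" if "e \<in> E" "p \<in> sdom e" for e p
  proof -
    have "p \<in> \<sigma>" using slice_chart_facts(5)[OF spacetime(1) slice(2), of "fst e" "snd e"] that by auto
    note hyps = coupling_nz[rule_format, OF this] weak[rule_format, OF _ this] dominant[rule_format, OF _ this]
    show ?thesis
      unfolding potential data
    proof (rule gauge_potential_pos[OF _ _ constants(1,2,3) _ _ spacetime(1) field_eqs slice(2) normal that])
      show "conf_generator wg w\<Phi> (induced_metric M e p) (momentum_metric \<kappa> \<alpha> M n \<Phi> e p) (\<Phi> p)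
          (momentum_scalar \<kappa> l \<alpha> M n \<Phi> e p) - sqrt (det (induced_metric M e p)) * \<delta> = 0"
        using gauge that unfolding data by blast
    qed (use dim constants hyps in simp_all)
  qed
  have qc: "quadrant_chart (snd e)" if "e \<in> E" for e
    using slice_chart_facts(3)[OF spacetime(1) slice(2), of "fst e" "snd e"] that by simp
  have kernel: "N p = 0"
    if "\<forall>e\<in>E. csmooth (snd e) N" "\<forall>p\<in>slice_boundary E. N p = 0"
      "\<forall>e\<in>E. \<forall>p\<in>sdom e. laplacian (snd e) (q e) N p - \<P> e p * N p = 0" "p \<in> \<sigma>" for N p
  proof (rule trivial_kernel[OF spacetime(1) slice _ _ _ _ that(4)])
    show "laplacian (snd e) (induced_metric M e) N p = \<P> e p * N p" if "e \<in> E" "p \<in> sdom e" for e p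
    proof -
      have "laplacian (snd e) (q e) N p - \<P> e p * N p = 0"
        using \<open>\<forall>e\<in>E. \<forall>p\<in>sdom e. laplacian (snd e) (q e) N p - \<P> e p * N p = 0\<close> that by blast
      then show ?thesis by (simp add: data(1))
    qed
  qed (use that pos in blast)+
  have sub: "p \<in> \<sigma>" if "e \<in> E" "p \<in> sdom e" for e p
    using slice_chart_facts(5)[OF spacetime(1) slice(2), of "fst e" "snd e"] that by auto
  show ?thesis
  proof (intro conjI allI impI)
    show "\<forall>e\<in>E. \<forall>p\<in>sdom e. \<P> e p > 0" using pos by blast
    fix N :: "'a \<Rightarrow> real"
    assume N: "(\<forall>e\<in>E. csmooth (snd e) N) \<and> (\<forall>p\<in>slice_boundary E. N p = 0)"
    show "(\<forall>e\<in>E. \<forall>p\<in>sdom e. laplacian (snd e) (q e) N p - \<P> e p * N p = 0) \<longleftrightarrow> (\<forall>p\<in>\<sigma>. N p = 0)"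
    proof
      assume "\<forall>e\<in>E. \<forall>p\<in>sdom e. laplacian (snd e) (q e) N p - \<P> e p * N p = 0"
      then show "\<forall>p\<in>\<sigma>. N p = 0" using kernel N by blast
    next
      assume 0: "\<forall>p\<in>\<sigma>. N p = 0"
      then have "laplacian (snd e) (q e) N p = 0" if "e \<in> E" "p \<in> sdom e" for e p
        using sub that by (intro laplacian_zero[OF qc]) auto
      then show "\<forall>e\<in>E. \<forall>p\<in>sdom e. laplacian (snd e) (q e) N p - \<P> e p * N p = 0"
        using 0 sub by auto
    qed
  next
    show "locally_good_gauge_fixing E wg q \<P>"
      unfolding locally_good_gauge_fixing_def
    proof (intro allI impI)
      fix N :: "'a \<Rightarrow> real"
      assume N: "(\<forall>e\<in>E. csmooth (snd e) N) \<and> (\<forall>p\<in>slice_boundary E. N p = 0) \<and>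
        (\<forall>e\<in>E. \<forall>p\<in>sdom e. bracket_operator wg q \<P> N e p = 0)"
      have "laplacian (snd e) (q e) N p - \<P> e p * N p = 0" if "e \<in> E" "p \<in> sdom e" for e p
      proof -
        \<comment> \<open>The bracket carries the factors D - 1, the square root of this determinant
          and \<open>wg\<close>; all are nonzero, so it has the same kernel as the elliptic
          equation.\<close>
        have "det (q e p) > 0"
          using induced_metric_pos_def[OF spacetime(1) slice(2) that] unfolding data
          by (intro pos_def_det) auto
        moreover have "bracket_operator wg q \<P> N e p = 0" using N that by blast
        ultimately show ?thesis using dim constants(3) by (simp add: bracket_operator_def)
      qed
      then show "\<forall>e\<in>E. \<forall>p\<in>sdom e. N p = 0" using kernel N sub by blast
    qed
  qed
qed

end
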